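(* Let $\mathbb C$ be a VC class and $\mathcal P$ a distribution on $\mathcal X$. If $\tilde\theta_f<\infty$ for every $f\in\mathbb C$ (where $\tilde\theta_f$ is taken with respect to $\mathbb C$ and $\mathcal P$), then $(\mathbb C,\mathcal P)$ is learnable at an exponential rate. If this condition holds for all distributions $\mathcal P$ on $\mathcal X$, then $\mathbb C$ is learnable at an exponential rate.
   Context: Setting. $(\mathcal X,\mathcal F)$ is a standard Borel space; a classifier is a measurable $h:\mathcal X\to\{-1,+1\}$; a concept space $\mathbb C$ is a set of classifiers; a VC class is a concept space whose VC dimension $d$ satisfies $0<d<\infty$. All sets arising are implicitly assumed measurable. For a probability measure ("distribution") $\mathcal P$ on $\mathcal X$ and a target function $f\in\mathbb C$: $X_1,X_2,\ldots$ are i.i.d. $\mathcal P$, $Y_i=f(X_i)$, and $\mathrm{er}(h)=\mathcal P(x:h(x)\ne f(x))$. An active learning algorithm (possibly randomized) gets a label budget $n\in\mathbb N$ and access to $X_1,X_2,\ldots$; it sequentially requests labels $Y_i$ of indices of its choice (choices may depend on labels already seen), at most $n$ in total, and returns a classifier $\mathcal A(n)$. It achieves label complexity $\Lambda$ if for every $f\in\mathbb C$, distribution $\mathcal P$, $\varepsilon\in(0,1)$ and integer $n\ge\Lambda(\varepsilon,f,\mathcal P)$, $\mathbb E[\mathrm{er}(\mathcal A(n))]\le\varepsilon$. Label complexities take values in $\{1,2,\ldots\}\cup\{\infty\}$. $\mathrm{Polylog}(1/\varepsilon)$ is the class of $g:(0,1)\to[0,\infty)$ with $g(\varepsilon)=O(\log^k(1/\varepsilon))$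 as $\varepsilon\to0^+$ for some $k\in[0,\infty)$. $(\mathbb C,\mathcal P)$ is learnable at an exponential rate if there is an active learning algorithm achieving a label complexity $\Lambda$ such that $\Lambda(\varepsilon,f,\mathcal P)\in\mathrm{Polylog}(1/\varepsilon)$ for all $f\in\mathbb C$. $\mathbb C$ is learnable at an exponential rate if there is an active learning algorithm achieving a label complexity $\Lambda$ such that $\Lambda(\varepsilon,f,\mathcal P)\in\mathrm{Polylog}(1/\varepsilon)$ for all distributions $\mathcal P$ and all $f\in\mathbb C$. $\mathcal H$ shatters $S=(x_1,\ldots,x_k)\in\mathcal X^k$ if for all $(y_1,\ldots,y_k)\in\{-1,+1\}^k$ some $h\in\mathcal H$ has $h(x_i)=y_i$ for all $i$. $\mathrm B(f,r)=\{g\in\mathbb C:\mathcal P(x:g(x)\ne f(x))\le r\}$. $\partial^kf=\lim_{r\to0^+}\{S\in\mathcal X^k:\mathrm B(f,r)\text{ shatters }S\}$ (decreasing limit). $\tilde d_f=\min\{k\in\mathbb N:\mathcal P^k(\partial^kf)=0\}$ (at most $d+1$), where $\mathcal P^k$ is the $k$-fold product measure. $\tilde\theta_f=1\vee\sup_{r>0}\mathcal P^{\tilde d_f}(S\in\mathcal X^{\tilde d_f}:\mathrm B(f,r)\text{ shatters }S)/r$. *)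

theory Defs
  imports "HOL-Probability.Probability"
begin

definition standard_borel :: "'a measure \<Rightarrow> bool" where
  "standard_borel M \<longleftrightarrow>
     (\<exists>T. topspace T = space M \<and> completely_metrizable_space T \<and> separable_space T \<and>
          sets M = sigma_sets (space M) {U. openin T U})"

definition distributions :: "'a measure \<Rightarrow> 'a measure set" where
  "distributions M = {P. prob_space P \<and> sets P = sets M}"

definition classifiers :: "'a measure \<Rightarrow> ('a \<Rightarrow> int) set" where
  "classifiers M = M \<rightarrow>\<^sub>M count_space {-1, 1}"

definition er :: "'a measure \<Rightarrow> ('a \<Rightarrow> int) \<Rightarrow> ('a \<Rightarrow> int) \<Rightarrow> real" where
  "er P f h = measure P {x \<in> space P. h x \<noteq> f x}"

text \<open>A point \<open>S\<close> of the \<open>k\<close>-fold product space is an (extensional) function on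
  \<open>{..<k}\<close>, that is, an element of \<open>space (\<Pi>\<^sub>M i\<in>{..<k}. M)\<close>.\<close>

definition shatters :: "('a \<Rightarrow> int) set \<Rightarrow> nat \<Rightarrow> (nat \<Rightarrow> 'a) \<Rightarrow> bool" where
  "shatters H k S \<longleftrightarrow> (\<forall>y \<in> {..<k} \<rightarrow> {-1, 1}. \<exists>h\<in>H. \<forall>i<k. h (S i) = y i)"

definition vc_dim :: "'a measure \<Rightarrow> ('a \<Rightarrow> int) set \<Rightarrow> enat" where
  "vc_dim M C = Sup {enat k |k. \<exists>S \<in> space (\<Pi>\<^sub>M i\<in>{..<k}. M). shatters C k S}"

definition vc_class :: "'a measure \<Rightarrow> ('a \<Rightarrow> int) set \<Rightarrow> bool" where
  "vc_class M C \<longleftrightarrow> C \<subseteq> classifiers M \<and> 0 < vc_dim M C \<and> vc_dim M C < \<infinity>"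

definition cball_class :: "('a \<Rightarrow> int) set \<Rightarrow> 'a measure \<Rightarrow> ('a \<Rightarrow> int) \<Rightarrow> real \<Rightarrow> ('a \<Rightarrow> int) set" where
  "cball_class C P f r = {g \<in> C. er P f g \<le> r}"

definition shattered_tuples ::
    "('a \<Rightarrow> int) set \<Rightarrow> 'a measure \<Rightarrow> ('a \<Rightarrow> int) \<Rightarrow> nat \<Rightarrow> real \<Rightarrow> (nat \<Rightarrow> 'a) set" where
  "shattered_tuples C P f k r =
     {S \<in> space (\<Pi>\<^sub>M i\<in>{..<k}. P). shatters (cball_class C P f r) k S}"

text \<open>\<open>shattered_tuples\<close> is monotone in \<open>r\<close>, so its limit as \<open>r\<close> decreases to \<open>0\<close> is the
  intersection over all \<open>r > 0\<close>.\<close>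

definition disagreement_core ::
    "('a \<Rightarrow> int) set \<Rightarrow> 'a measure \<Rightarrow> ('a \<Rightarrow> int) \<Rightarrow> nat \<Rightarrow> (nat \<Rightarrow> 'a) set" where
  "disagreement_core C P f k = (\<Inter>r\<in>{0<..}. shattered_tuples C P f k r)"

text \<open>For \<open>f \<in> C\<close> the value \<open>k = 0\<close> is never the minimum: the \<open>0\<close>-fold product is a point
  mass on the empty tuple, which every nonempty set of classifiers shatters.\<close>

definition d_tilde :: "('a \<Rightarrow> int) set \<Rightarrow> 'a measure \<Rightarrow> ('a \<Rightarrow> int) \<Rightarrow> nat" where
  "d_tilde C P f =
     (LEAST k. emeasure (\<Pi>\<^sub>M i\<in>{..<k}. P) (disagreement_core C P f k) = 0)"

definition theta_tilde :: "('a \<Rightarrow> int) set \<Rightarrow> 'a measure \<Rightarrow> ('a \<Rightarrow> int) \<Rightarrow> ennreal" where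
  "theta_tilde C P f =
     (let k = d_tilde C P f in
        max 1 (SUP r\<in>{0<..}. emeasure (\<Pi>\<^sub>M i\<in>{..<k}. P) (shattered_tuples C P f k r) / ennreal r))"

text \<open>The standing convention that all sets that arise are measurable is made explicit by the
  next two conditions. The first concerns the samples \<open>S\<close> with prescribed labels \<open>y\<close> for which
  some member of \<open>C\<close> is consistent with \<open>(S, y)\<close>; finite Boolean combinations of such sets
  express, for instance, that a version space \<open>{h \<in> C. \<forall>i<m. h (x i) = y i}\<close> shatters a tuple,
  jointly in the sample \<open>x\<close> and the tuple. The second concerns the sets that occur in
  \<open>disagreement_core\<close>, \<open>d_tilde\<close> and \<open>theta_tilde\<close>; without it \<open>emeasure\<close> would be \<open>0\<close> on them
  by default.\<close>

definition sample_sets_measurable :: "'a measure \<Rightarrow> ('a \<Rightarrow> int) set \<Rightarrow> bool" where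
  "sample_sets_measurable M C \<longleftrightarrow>
     (\<forall>(k::nat) y. {S \<in> space (\<Pi>\<^sub>M i\<in>{..<k}. M). \<exists>h\<in>C. \<forall>i<k. h (S i) = y i}
              \<in> sets (\<Pi>\<^sub>M i\<in>{..<k}. M))"

definition shatter_sets_measurable :: "('a \<Rightarrow> int) set \<Rightarrow> 'a measure \<Rightarrow> bool" where
  "shatter_sets_measurable C P \<longleftrightarrow>
     (\<forall>f\<in>C. \<forall>k. \<forall>r>0. shattered_tuples C P f k r \<in> sets (\<Pi>\<^sub>M i\<in>{..<k}. P))"

text \<open>An active learner gets the budget \<open>n\<close>, a random seed, the whole unlabeled sequence and the
  history of (index, label) pairs obtained so far. \<open>query\<close> yields the index whose label is
  requested next, or \<open>None\<close> to stop; \<open>answer\<close> yields the returned classifier. The seed is uniform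
  on the unit interval, which is enough to simulate any countable supply of random bits.\<close>

type_synonym history = "(nat \<times> int) list"

record 'a active_learner =
  query :: "nat \<Rightarrow> real \<Rightarrow> (nat \<Rightarrow> 'a) \<Rightarrow> history \<Rightarrow> nat option"
  answer :: "nat \<Rightarrow> real \<Rightarrow> (nat \<Rightarrow> 'a) \<Rightarrow> history \<Rightarrow> 'a \<Rightarrow> int"

definition seed :: "real measure" where
  "seed = uniform_measure lborel {0..1}"

text \<open>Joint measurability in seed, unlabeled sequence and (for \<open>answer\<close>) test point; in particular
  every returned function is a classifier and its error rate is a random variable.\<close>

definition active_learning_algorithm :: "'a measure \<Rightarrow> 'a active_learner \<Rightarrow> bool" where
  "active_learning_algorithm M A \<longleftrightarrow>
     (\<forall>n H. (\<lambda>(u, X). query A n u X H) \<in>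
              (seed \<Otimes>\<^sub>M (\<Pi>\<^sub>M i\<in>UNIV. M)) \<rightarrow>\<^sub>M count_space UNIV) \<and>
     (\<forall>n H. (\<lambda>((u, X), x). answer A n u X H x) \<in>
              ((seed \<Otimes>\<^sub>M (\<Pi>\<^sub>M i\<in>UNIV. M)) \<Otimes>\<^sub>M M) \<rightarrow>\<^sub>M count_space {-1, 1})"

primrec interact :: "(history \<Rightarrow> nat option) \<Rightarrow> (nat \<Rightarrow> int) \<Rightarrow> nat \<Rightarrow> history" where
  "interact q Y 0 = []"
| "interact q Y (Suc t) =
     (let H = interact q Y t in case q H of None \<Rightarrow> H | Some i \<Rightarrow> H @ [(i, Y i)])"

text \<open>With budget \<open>n\<close> there are at most \<open>n\<close> rounds, each with at most one label request.\<close>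

definition returned ::
    "'a active_learner \<Rightarrow> nat \<Rightarrow> ('a \<Rightarrow> int) \<Rightarrow> real \<Rightarrow> (nat \<Rightarrow> 'a) \<Rightarrow> 'a \<Rightarrow> int" where
  "returned A n f u X = answer A n u X (interact (query A n u X) (\<lambda>i. f (X i)) n)"

definition expected_er :: "'a active_learner \<Rightarrow> nat \<Rightarrow> ('a \<Rightarrow> int) \<Rightarrow> 'a measure \<Rightarrow> ennreal" where
  "expected_er A n f P =
     (\<integral>\<^sup>+ (u, X). ennreal (er P f (returned A n f u X)) \<partial>(seed \<Otimes>\<^sub>M (\<Pi>\<^sub>M i\<in>UNIV. P)))"

definition achieves_label_complexity ::
    "'a measure \<Rightarrow> ('a \<Rightarrow> int) set \<Rightarrow> 'a active_learner \<Rightarrow>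
     (real \<Rightarrow> ('a \<Rightarrow> int) \<Rightarrow> 'a measure \<Rightarrow> enat) \<Rightarrow> bool" where
  "achieves_label_complexity M C A \<Lambda> \<longleftrightarrow>
     (\<forall>f\<in>C. \<forall>P\<in>distributions M. \<forall>\<epsilon>\<in>{0<..<1}.
        1 \<le> \<Lambda> \<epsilon> f P \<and>
        (\<forall>n. enat n \<ge> \<Lambda> \<epsilon> f P \<longrightarrow> expected_er A n f P \<le> ennreal \<epsilon>))"

definition Polylog :: "(real \<Rightarrow> real) set" where
  "Polylog = {g. (\<forall>\<epsilon>\<in>{0<..<1}. 0 \<le> g \<epsilon>) \<and>
                 (\<exists>k\<ge>0. g \<in> O[at_right 0](\<lambda>\<epsilon>. ln (1 / \<epsilon>) powr k))}"

definition enat_Polylog :: "(real \<Rightarrow> enat) \<Rightarrow> bool" where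
  "enat_Polylog g \<longleftrightarrow>
     (\<forall>\<epsilon>\<in>{0<..<1}. g \<epsilon> \<noteq> \<infinity>) \<and> (\<lambda>\<epsilon>. real (the_enat (g \<epsilon>))) \<in> Polylog"

definition exponential_rate_under :: "'a measure \<Rightarrow> ('a \<Rightarrow> int) set \<Rightarrow> 'a measure \<Rightarrow> bool" where
  "exponential_rate_under M C P \<longleftrightarrow>
     (\<exists>A \<Lambda>. active_learning_algorithm M A \<and> achieves_label_complexity M C A \<Lambda> \<and>
        (\<forall>f\<in>C. enat_Polylog (\<lambda>\<epsilon>. \<Lambda> \<epsilon> f P)))"

definition exponential_rate :: "'a measure \<Rightarrow> ('a \<Rightarrow> int) set \<Rightarrow> bool" where
  "exponential_rate M C \<longleftrightarrow>
     (\<exists>A \<Lambda>. active_learning_algorithm M A \<and> achieves_label_complexity M C A \<Lambda> \<and>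
        (\<forall>P\<in>distributions M. \<forall>f\<in>C. enat_Polylog (\<lambda>\<epsilon>. \<Lambda> \<epsilon> f P)))"

end

theory Submission
  imports Defs "HOL-Real_Asymp.Real_Asymp"
begin

text \<open>
  The whole unlabeled sequence is visible, so a tail of it, disjoint from the points that are
  labeled, determines \<open>P\<^sup>k\<close>-probabilities almost surely exactly, as limits of relative
  frequencies over disjoint blocks. We may thus argue as if the learner knew \<open>P\<close>.

  With \<open>t\<close> about the fifth root of the budget, the learner labels the first \<open>2\<^sup>t\<close> points. The first
  \<open>t\<^sup>4\<close> labels are requested. Afterwards, let \<open>V\<close> be the current version space and \<open>k + 1\<close> the
  least order at which \<open>V\<close> shatters with probability at most \<open>1/t\<close>. The label of \<open>x\<close> is
  requested only if both halves \<open>{h \<in> V. h x = -1}\<close> and \<open>{h \<in> V. h x = 1}\<close> shatter a \<open>k\<close>-tuple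
  with at least half the probability of \<open>V\<close>; otherwise a half below this
  threshold is discarded and the other label inferred.

  Almost surely \<open>V\<close> shatters almost all of \<open>\<partial>\<^sup>k f\<close>, because functions arbitrarily close to \<open>f\<close>
  agree with \<open>f\<close> on a finite sample; the same holds for the half that contains \<open>f\<close>. Once \<open>V\<close> lies
  in a small ball around \<open>f\<close>, it shatters little beyond \<open>\<partial>\<^sup>k f\<close>, so \<open>k + 1\<close> is the critical
  order, inferred labels are correct, and inclusion-exclusion shows that at a requested \<open>x\<close>
  both halves shatter simultaneously with probability bounded below. Hence the requests have mass
  \<open>O(\<theta> r)\<close> when \<open>V\<close> lies in the ball of radius \<open>r\<close>. By the \<open>\<epsilon>\<close>-net theorem \<open>r\<close> is of order
  \<open>t\<^sup>2/i\<close> after \<open>i\<close> points, so \<open>O(t\<^sup>3)\<close> further requests are expected up to \<open>2\<^sup>t\<close> points.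
  An exponential moment bound makes exceeding the budget exponentially unlikely, and the final
  error is \<open>O(t\<^sup>2/2\<^sup>t)\<close>.
\<close>

section \<open>Independent sequences\<close>

lemma (in sequence_space) pair_sigma_finite_sequences:
  "pair_sigma_finite M S" "pair_sigma_finite S M" "pair_sigma_finite S S"
  by (auto simp: pair_sigma_finite_def intro: M.sigma_finite_measure_axioms P.sigma_finite_measure_axioms)

lemma (in sequence_space) distr_fun_upd:
  "distr (M \<Otimes>\<^sub>M S) S (\<lambda>(x, w). w(i := x)) = S"
  using distr_pair_PiM_eq_PiM[of UNIV "\<lambda>_. M" i] M.prob_space_axioms by simp

lemma (in sequence_space) measurable_fun_upd_pair:
  "(\<lambda>(x, w). w(i := x)) \<in> M \<Otimes>\<^sub>M S \<rightarrow>\<^sub>M S"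
proof (rule measurable_PiM_single')
  show "(\<lambda>v. (case v of (x, w) \<Rightarrow> w(i := x)) j) \<in> M \<Otimes>\<^sub>M S \<rightarrow>\<^sub>M M" for j
    by (cases "j = i") (auto simp: split_beta')
qed (auto simp: space_pair_measure space_PiM PiE_def)

text \<open>Replacing coordinate \<open>i\<close> by an independent draw preserves the law of the
  sequence, and \<open>F x\<close> does not notice the replacement. Fubini then integrates
  \<open>w i\<close> out as a separate variable.\<close>

lemma (in sequence_space) nn_integral_coordinate:
  fixes F :: "'a \<Rightarrow> (nat \<Rightarrow> 'a) \<Rightarrow> ennreal"
  assumes F[measurable]: "case_prod F \<in> borel_measurable (M \<Otimes>\<^sub>M S)"
    and indep: "\<And>x y w. F x (w(i := y)) = F x w"
  shows "(\<integral>\<^sup>+w. F (w i) w \<partial>S) = (\<integral>\<^sup>+w. \<integral>\<^sup>+x. F x w \<partial>M \<partial>S)"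
proof -
  have "(\<integral>\<^sup>+w. F (w i) w \<partial>S) = (\<integral>\<^sup>+w. F (w i) w \<partial>distr (M \<Otimes>\<^sub>M S) S (\<lambda>(x, w). w(i := x)))"
    by (simp add: distr_fun_upd)
  also have "\<dots> = (\<integral>\<^sup>+v. F (fst v) (snd v) \<partial>(M \<Otimes>\<^sub>M S))"
    by (subst nn_integral_distr[OF measurable_fun_upd_pair]) (auto simp: split_beta' indep)
  also have "\<dots> = (\<integral>\<^sup>+w. \<integral>\<^sup>+x. F x w \<partial>M \<partial>S)"
    using pair_sigma_finite.nn_integral_snd[OF pair_sigma_finite_sequences(1), of "case_prod F"] F
    by (simp add: split_beta')
  finally show ?thesis .
qed

text \<open>The same exchange for null sets. It turns statements about the next sample point into
  statements about a fresh test point and back.\<close>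

lemma (in sequence_space) AE_coordinate:
  assumes Q[measurable]: "Measurable.pred (M \<Otimes>\<^sub>M S) (\<lambda>(x, w). Q x w)"
    and indep: "\<And>x y w. Q x (w(i := y)) = Q x w"
  shows "(AE w in S. Q (w i) w) \<longleftrightarrow> (AE w in S. AE x in M. Q x w)"
proof -
  interpret MS: pair_sigma_finite M S by (rule pair_sigma_finite_sequences)
  have "(AE w in S. Q (w i) w) \<longleftrightarrow> (AE w in distr (M \<Otimes>\<^sub>M S) S (\<lambda>(x, w). w(i := x)). Q (w i) w)"
    by (simp only: distr_fun_upd)
  also have "\<dots> \<longleftrightarrow> (AE v in M \<Otimes>\<^sub>M S. Q (fst v) (snd v))"
    by (subst AE_distr_iff[OF measurable_fun_upd_pair]) (auto simp: split_beta' indep)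
  also have "\<dots> \<longleftrightarrow> (AE x in M. AE w in S. Q x w)"
    by (subst MS.AE_pair_iff) (auto simp: split_beta')
  also have "\<dots> \<longleftrightarrow> (AE w in S. AE x in M. Q x w)"
    by (subst MS.AE_commute) (auto simp: split_beta')
  finally show ?thesis .
qed

text \<open>A supermartingale bound without conditional expectations: the last coordinate is
  integrated out while the earlier factors, which do not depend on it, are held fixed; induction
  does the rest. It yields exponential moments for adaptively chosen events.\<close>

lemma (in sequence_space) nn_integral_prod_le:
  fixes G :: "nat \<Rightarrow> 'a \<Rightarrow> (nat \<Rightarrow> 'a) \<Rightarrow> ennreal" and c :: "nat \<Rightarrow> ennreal"
  assumes G[measurable]: "\<And>i. (\<lambda>(x, w). G i x w) \<in> borel_measurable (M \<Otimes>\<^sub>M S)"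
    and past: "\<And>i x w w'. (\<And>j. j < i \<Longrightarrow> w j = w' j) \<Longrightarrow> G i x w = G i x w'"
    and le: "\<And>i w. i < N \<Longrightarrow> w \<in> space S \<Longrightarrow> (\<integral>\<^sup>+x. G i x w \<partial>M) \<le> c i"
  shows "(\<integral>\<^sup>+w. (\<Prod>i<N. G i (w i) w) \<partial>S) \<le> (\<Prod>i<N. c i)"
  using le
proof (induction N)
  case 0
  then show ?case by (simp add: P.emeasure_space_1)
next
  case (Suc N)
  have [measurable]: "(\<lambda>w. \<Prod>i<N. G i (w i) w) \<in> borel_measurable S" by measurable
  have "(\<integral>\<^sup>+w. (\<Prod>i<Suc N. G i (w i) w) \<partial>S) =
      (\<integral>\<^sup>+w. (\<lambda>x w. (\<Prod>i<N. G i (w i) w) * G N x w) (w N) w \<partial>S)"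
    by simp
  also have "\<dots> = (\<integral>\<^sup>+w. \<integral>\<^sup>+x. (\<Prod>i<N. G i (w i) w) * G N x w \<partial>M \<partial>S)"
  proof (rule nn_integral_coordinate)
    show "(\<Prod>i<N. G i ((w(N := y)) i) (w(N := y))) * G N x (w(N := y)) =
        (\<Prod>i<N. G i (w i) w) * G N x w" for x y w
      by (intro arg_cong2[where f = "(*)"] prod.cong) (auto intro!: past)
  qed measurable
  also have "\<dots> \<le> (\<integral>\<^sup>+w. (\<Prod>i<N. G i (w i) w) * c N \<partial>S)"
    by (intro nn_integral_mono) (auto simp: nn_integral_cmult intro!: mult_left_mono Suc.prems)
  also have "\<dots> \<le> (\<Prod>i<N. c i) * c N"
    using Suc by (auto simp: nn_integral_multc intro!: mult_right_mono)
  finally show ?case by simp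
qed

text \<open>Gluing the first \<open>N\<close> entries of one sequence to an independent second
  sequence reproduces the law, so head and tail of a single sequence behave like an independent
  pair.\<close>

lemma (in sequence_space) AE_tail:
  assumes Q[measurable]: "Measurable.pred (S \<Otimes>\<^sub>M S) (\<lambda>(w, w'). Q w w')"
    and AE: "\<And>w. w \<in> space S \<Longrightarrow> AE w' in S. Q w w'"
    and past: "\<And>w w' w''. (\<And>j. j < N \<Longrightarrow> w j = w' j) \<Longrightarrow> Q w w'' \<longleftrightarrow> Q w' w''"
  shows "AE w in S. Q w (\<lambda>j. w (j + N))"
proof -
  interpret pair_sigma_finite S S by (rule pair_sigma_finite_sequences)
  have "AE v in S \<Otimes>\<^sub>M S. Q (fst v) (snd v)"
    by (rule AE_pair_measure) (use AE in \<open>auto simp: split_beta'\<close>)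
  moreover have "Q (comb_seq N w w') (\<lambda>j. comb_seq N w w' (j + N)) \<longleftrightarrow> Q w w'" for w w'
    using past[of "comb_seq N w w'" w] by (simp add: comb_seq_less comb_seq_add)
  ultimately have "AE v in S \<Otimes>\<^sub>M S. Q (comb_seq N (fst v) (snd v)) (\<lambda>j. comb_seq N (fst v) (snd v) (j + N))"
    by simp
  moreover have [measurable]: "(\<lambda>w j. w (j + N)) \<in> S \<rightarrow>\<^sub>M S"
    by (rule measurable_PiM_single') (auto simp: space_PiM)
  ultimately have "AE w in distr (S \<Otimes>\<^sub>M S) S (\<lambda>(w, w'). comb_seq N w w'). Q w (\<lambda>j. w (j + N))"
    by (subst AE_distr_iff) (auto simp: split_beta')
  then show ?thesis by (simp only: PiM_comb_seq)
qed

section \<open>Relative frequencies over disjoint blocks\<close>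

definition block :: "nat \<Rightarrow> nat \<Rightarrow> (nat \<Rightarrow> 'a) \<Rightarrow> nat \<Rightarrow> 'a" where
  "block k b w = (\<lambda>i\<in>{..<k}. w (b * k + i))"

text \<open>\<open>lim\<close> is total, with an unspecified value where the averages diverge. For a
  fixed measurable \<open>Q\<close> this happens with probability zero, so the value may serve as an
  exact probability.\<close>

definition freq :: "nat \<Rightarrow> ((nat \<Rightarrow> 'a) \<Rightarrow> bool) \<Rightarrow> (nat \<Rightarrow> 'a) \<Rightarrow> real" where
  "freq k Q w = lim (\<lambda>B. (\<Sum>b<B. of_bool (Q (block k b w))) / real B)"

lemma measurable_block[measurable]:
  "block k b \<in> Pi\<^sub>M UNIV (\<lambda>_. M) \<rightarrow>\<^sub>M Pi\<^sub>M {..<k} (\<lambda>_. M)"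
  unfolding block_def by measurable

lemma (in sequence_space) distr_block:
  "distr S (Pi\<^sub>M {..<k} (\<lambda>_. M)) (block k b) = Pi\<^sub>M {..<k} (\<lambda>_. M)"
  using distr_PiM_reindex[of UNIV "\<lambda>_. M" "\<lambda>i. b * k + i" "{..<k}"]
  by (simp add: M.prob_space_axioms inj_on_def block_def[abs_def])

text \<open>Block \<open>b\<close> is a function of the coordinates in \<open>?K b\<close>, and
  these index intervals are disjoint.\<close>

lemma (in sequence_space) indep_block:
  "P.indep_vars (\<lambda>_. Pi\<^sub>M {..<k} (\<lambda>_. M)) (block k) UNIV"
proof -
  let ?K = "\<lambda>b. {b * k..<Suc b * k}"
  have "P.indep_vars (\<lambda>_. M) (\<lambda>i w. w i) (UNIV :: nat set)"
  proof (subst P.indep_vars_iff_distr_eq_PiM)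
    show "distr S (Pi\<^sub>M UNIV (\<lambda>_. M)) (\<lambda>x. \<lambda>i\<in>UNIV. x i) = Pi\<^sub>M UNIV (\<lambda>i. distr S M (\<lambda>w. w i))"
      by (simp add: PiM_component distr_id restrict_UNIV)
  qed auto
  then have "P.indep_vars (\<lambda>b. Pi\<^sub>M (?K b) (\<lambda>_. M)) (\<lambda>b w. restrict (\<lambda>i. w i) (?K b)) UNIV"
  proof (rule P.indep_vars_restrict)
    have False if "x \<in> ?K b \<inter> ?K c" "b < c" for x b c
      using that mult_le_mono1[of "Suc b" c k] by auto
    then show "disjoint_family_on ?K UNIV"
      unfolding disjoint_family_on_def by (metis linorder_neqE_nat all_not_in_conv Int_commute)
  qed auto
  then have "P.indep_vars (\<lambda>_. Pi\<^sub>M {..<k} (\<lambda>_. M))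
      (\<lambda>b. (\<lambda>g. \<lambda>i\<in>{..<k}. g (b * k + i)) \<circ> (\<lambda>w. restrict (\<lambda>i. w i) (?K b))) UNIV"
    by (rule P.indep_vars_compose) (auto intro!: measurable_restrict measurable_component_singleton)
  also have "(\<lambda>b. (\<lambda>g. \<lambda>i\<in>{..<k}. g (b * k + i)) \<circ> (\<lambda>w. restrict (\<lambda>i. w i) (?K b))) = block k"
    by (auto simp: block_def fun_eq_iff restrict_def)
  finally show ?thesis .
qed

lemma borel_measurable_freq:
  assumes [measurable]: "Measurable.pred (N \<Otimes>\<^sub>M Pi\<^sub>M {..<k} (\<lambda>_. M)) (\<lambda>(v, s). Q v s)"
    and [measurable]: "g \<in> N \<rightarrow>\<^sub>M Pi\<^sub>M UNIV (\<lambda>_. M)"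
  shows "(\<lambda>v. freq k (Q v) (g v)) \<in> borel_measurable N"
  unfolding freq_def by (intro borel_measurable_lim_metric) measurable

text \<open>The tail bounds of Hoeffding's inequality are summable, so the Borel-Cantelli lemma applies.\<close>

lemma (in sequence_space) AE_freq:
  assumes Q[measurable]: "Measurable.pred (Pi\<^sub>M {..<k} (\<lambda>_. M)) Q"
  shows "AE w in S. freq k Q w = measure (Pi\<^sub>M {..<k} (\<lambda>_. M)) {s \<in> space (Pi\<^sub>M {..<k} (\<lambda>_. M)). Q s}"
proof -
  define Y where "Y b w = (of_bool (Q (block k b w)) :: real)" for b w
  define p where "p = measure (Pi\<^sub>M {..<k} (\<lambda>_. M)) {s \<in> space (Pi\<^sub>M {..<k} (\<lambda>_. M)). Q s}"
  have [measurable]: "Y b \<in> borel_measurable S" for b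
    unfolding Y_def by measurable
  have EY: "P.expectation (Y b) = p" for b
  proof -
    have "P.expectation (Y b) = (\<integral>s. of_bool (Q s) \<partial>distr S (Pi\<^sub>M {..<k} (\<lambda>_. M)) (block k b))"
      unfolding Y_def by (subst integral_distr) auto
    also have "\<dots> = (\<integral>s. indicator {s \<in> space (Pi\<^sub>M {..<k} (\<lambda>_. M)). Q s} s \<partial>Pi\<^sub>M {..<k} (\<lambda>_. M))"
      unfolding distr_block by (intro Bochner_Integration.integral_cong) (auto simp: indicator_def)
    finally show ?thesis by (simp add: p_def)
  qed
  have ind: "P.indep_vars (\<lambda>_. borel) Y I" for I
    unfolding Y_def by (rule P.indep_vars_subset[OF P.indep_vars_compose2[OF indep_block]]) auto
  have tail: "P.prob {w \<in> space S. \<bar>(\<Sum>b<B. Y b w) / B - p\<bar> \<ge> e} \<le> 2 * exp (- 2 * B * e\<^sup>2)"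
    if "e > 0" "B > 0" for e :: real and B :: nat
  proof -
    interpret H: Hoeffding_ineq S "{..<B}" Y "\<lambda>_. 0" "\<lambda>_. 1" "\<Sum>b<B. P.expectation (Y b)"
      by unfold_locales (auto simp: ind Y_def)
    have "P.prob {w \<in> space S. \<bar>(\<Sum>b<B. Y b w) / B - p\<bar> \<ge> e} =
        P.prob {w \<in> space S. \<bar>(\<Sum>b<B. Y b w) - (\<Sum>b<B. P.expectation (Y b))\<bar> \<ge> B * e}"
      using \<open>B > 0\<close> by (intro arg_cong[where f = P.prob] Collect_cong) (auto simp: EY field_simps abs_le_iff le_divide_eq)
    also have "\<dots> \<le> 2 * exp (- 2 * (B * e)\<^sup>2 / (\<Sum>b<B. (1 - 0)\<^sup>2))"
      using that by (intro H.Hoeffding_ineq_abs_ge) auto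
    also have "\<dots> = 2 * exp (- 2 * B * e\<^sup>2)"
      using \<open>B > 0\<close> by (simp add: power2_eq_square field_simps)
    finally show ?thesis .
  qed
  \<comment> \<open>The countably many accuracies \<open>1 / Suc j\<close> suffice for convergence
    and keep the exceptional set null.\<close>
  have ev: "AE w in S. eventually (\<lambda>B. \<bar>(\<Sum>b<B. Y b w) / B - p\<bar> < 1 / Suc j) sequentially" for j
  proof -
    define e where "e = 1 / real (Suc j)"
    define A where "A B = {w \<in> space S. \<bar>(\<Sum>b<B. Y b w) / real B - p\<bar> \<ge> e}" for B
    have e: "e > 0" by (simp add: e_def)
    have "AE w in S. eventually (\<lambda>B. w \<in> space S - A B) sequentially"
    proof (rule borel_cantelli_AE1)
      show "A B \<in> sets S" for B unfolding A_def by measurable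
      show "emeasure S (A B) < \<infinity>" for B by (simp add: less_top[symmetric])
      have "summable (\<lambda>B. 2 * exp (- 2 * e\<^sup>2) ^ B)"
        using e by (intro summable_mult summable_geometric) simp
      then show "summable (\<lambda>B. P.prob (A B))"
      proof (rule summable_comparison_test_ev[rotated], intro eventually_sequentiallyI[of 1])
        fix B :: nat assume "1 \<le> B"
        then show "norm (P.prob (A B)) \<le> 2 * exp (- 2 * e\<^sup>2) ^ B"
          using tail[of e B] e by (simp add: A_def exp_of_nat_mult[symmetric] mult_ac)
      qed
    qed
    then show ?thesis
      by (rule AE_mp) (auto intro!: AE_I2 elim!: eventually_mono simp: A_def e_def)
  qed
  have "AE w in S. \<forall>j. eventually (\<lambda>B. \<bar>(\<Sum>b<B. Y b w) / B - p\<bar> < 1 / Suc j) sequentially"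
    using ev by (subst AE_all_countable) auto
  then show ?thesis
  proof (eventually_elim, goal_cases)
    case (1 w)
    have "(\<lambda>B. (\<Sum>b<B. Y b w) / B) \<longlonglongrightarrow> p"
    proof (rule tendstoI)
      fix e :: real assume "0 < e"
      then obtain j where "1 / Suc j < e" using nat_approx_posE by auto
      with 1 show "eventually (\<lambda>B. dist ((\<Sum>b<B. Y b w) / B) p < e) sequentially"
        by (auto elim!: eventually_mono dest!: spec[of _ j] simp: dist_real_def)
    qed
    then show ?case
      unfolding freq_def Y_def p_def by (rule limI)
  qed
qed

section \<open>The Sauer-Shelah lemma and measurability of version spaces\<close>

text \<open>Pajor's form of the Sauer-Shelah lemma, by induction on the ground set. Deleting
  \<open>x\<close> splits \<open>F\<close> into the traces \<open>F0\<close> and \<open>F1\<close>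
  of the members without and with \<open>x\<close>. A set shattered by \<open>F0 \<union> F1\<close>
  is shattered by \<open>F\<close>; one shattered by \<open>F0 \<inter> F1\<close> stays shattered
  by \<open>F\<close> after \<open>x\<close> is added. The two kinds are disjoint and their numbers
  add up.\<close>

lemma card_le_card_shattered:
  assumes "finite U" "F \<subseteq> Pow U"
  shows "card F \<le> card {A. A \<subseteq> U \<and> (\<forall>B\<subseteq>A. \<exists>T\<in>F. T \<inter> A = B)}"
  using assms
proof (induction U arbitrary: F rule: finite_induct)
  case empty
  show ?case
  proof (cases "F = {}")
    case False
    with empty have "F = {{}}" by (simp add: subset_singleton_iff)
    define Sh where "Sh = {A. A \<subseteq> {} \<and> (\<forall>B\<subseteq>A. \<exists>T\<in>F. T \<inter> A = B)}"
    have "{} \<in> Sh" unfolding Sh_def using False by blast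
    moreover have "finite Sh" by (rule finite_subset[of _ "{{}}"]) (unfold Sh_def, blast, simp)
    ultimately have "card Sh > 0" using card_gt_0_iff by blast
    moreover have "card F = 1" using \<open>F = {{}}\<close> by simp
    ultimately show ?thesis unfolding Sh_def by linarith
  qed simp
next
  case (insert x U)
  define sh where "sh U F = {A. A \<subseteq> U \<and> (\<forall>B\<subseteq>A. \<exists>T\<in>F. T \<inter> A = B)}" for U and F :: "'a set set"
  have sh_sub: "A \<subseteq> U" if "A \<in> sh U F" for A U F
    using that by (simp add: sh_def)
  have fin_sh: "finite (sh U F)" if "finite U" for U F
    using that sh_sub by (intro finite_subset[of "sh U F" "Pow U"]) auto
  define F0 where "F0 = {T\<in>F. x \<notin> T}"
  define F1 where "F1 = (\<lambda>T. T - {x}) ` {T\<in>F. x \<in> T}"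
  have finF: "finite F"
    using insert.prems insert.hyps(1) by (meson finite_Pow_iff finite_insert finite_subset)
  have sub: "F0 \<subseteq> Pow U" "F1 \<subseteq> Pow U"
    using insert.prems by (auto simp: F0_def F1_def)
  have fin: "finite F0" "finite F1" "finite U"
    using finF insert.hyps by (auto simp: F0_def F1_def)
  have "F = F0 \<union> {T\<in>F. x \<in> T}" "F0 \<inter> {T\<in>F. x \<in> T} = {}"
    by (auto simp: F0_def)
  then have "card F = card F0 + card {T\<in>F. x \<in> T}"
    using finF card_Un_disjoint[of F0 "{T\<in>F. x \<in> T}"] fin(1) by simp
  also have "card {T\<in>F. x \<in> T} = card F1"
    unfolding F1_def by (rule card_image[symmetric], rule inj_onI) blast
  also have "card F0 + card F1 = card (F0 \<union> F1) + card (F0 \<inter> F1)"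
    using fin by (intro card_Un_Int)
  also have "\<dots> \<le> card (sh U (F0 \<union> F1)) + card (sh U (F0 \<inter> F1))"
    unfolding sh_def using sub by (intro add_mono insert.IH) blast+
  also have "card (sh U (F0 \<inter> F1)) = card (insert x ` sh U (F0 \<inter> F1))"
  proof (rule card_image[symmetric], rule inj_onI)
    fix A B assume "A \<in> sh U (F0 \<inter> F1)" "B \<in> sh U (F0 \<inter> F1)" "insert x A = insert x B"
    moreover from this have "x \<notin> A" "x \<notin> B" using sh_sub insert.hyps(2) by blast+
    ultimately show "A = B" by (simp add: insert_ident)
  qed
  also have "card (sh U (F0 \<union> F1)) + \<dots> = card (sh U (F0 \<union> F1) \<union> insert x ` sh U (F0 \<inter> F1))"
  proof (rule card_Un_disjoint[symmetric])
    show "sh U (F0 \<union> F1) \<inter> insert x ` sh U (F0 \<inter> F1) = {}"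
      using sh_sub[of _ U "F0 \<union> F1"] insert.hyps(2) by blast
  qed (use fin in \<open>simp_all add: fin_sh\<close>)
  also have "\<dots> \<le> card (sh (insert x U) F)"
  proof (rule card_mono)
    show "finite (sh (insert x U) F)"
      using fin by (simp add: fin_sh)
    have 1: "\<exists>T\<in>F. T \<inter> A = B" if A: "A \<subseteq> U" and T: "\<exists>T\<in>F0 \<union> F1. T \<inter> A = B" for A B
    proof -
      from T obtain T where T: "T \<in> F0 \<union> F1" "T \<inter> A = B" by blast
      show ?thesis
      proof (cases "T \<in> F0")
        case False
        with T obtain T' where "T' \<in> F" "T = T' - {x}" by (auto simp: F1_def)
        moreover have "x \<notin> A" using A insert.hyps(2) by blast
        ultimately show ?thesis using T(2) by (intro bexI[of _ T']) blast+
      qed (use T in \<open>auto simp: F0_def\<close>)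
    qed
    have 2: "\<exists>T\<in>F. T \<inter> insert x A = B"
      if A: "A \<subseteq> U" and B: "B \<subseteq> insert x A" and sh: "\<forall>B\<subseteq>A. \<exists>T\<in>F0 \<inter> F1. T \<inter> A = B" for A B
    proof -
      obtain T where T: "T \<in> F0" "T \<in> F1" "T \<inter> A = B - {x}"
        using sh[rule_format, of "B - {x}"] B by auto
      from T(1,2) have "T \<in> F" "x \<notin> T" "insert x T \<in> F"
        by (auto simp: F0_def F1_def insert_absorb)
      then show ?thesis
        using T(3) B A insert.hyps(2)
        by (intro bexI[of _ "if x \<in> B then insert x T else T"]) auto
    qed
    show "sh U (F0 \<union> F1) \<union> insert x ` sh U (F0 \<inter> F1) \<subseteq> sh (insert x U) F"
    proof
      fix A assume "A \<in> sh U (F0 \<union> F1) \<union> insert x ` sh U (F0 \<inter> F1)"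
      then show "A \<in> sh (insert x U) F"
      proof
        assume A: "A \<in> sh U (F0 \<union> F1)"
        then have "\<forall>B\<subseteq>A. \<exists>T\<in>F. T \<inter> A = B"
          using 1[of A] unfolding sh_def by simp
        with A show ?thesis unfolding sh_def by blast
      next
        assume "A \<in> insert x ` sh U (F0 \<inter> F1)"
        then obtain A' where A': "A = insert x A'" "A' \<in> sh U (F0 \<inter> F1)" by blast
        then have "\<forall>B\<subseteq>A. \<exists>T\<in>F. T \<inter> A = B"
          using 2[of A'] unfolding sh_def by simp
        with A' show ?thesis unfolding sh_def by blast
      qed
    qed
  qed
  finally show ?case unfolding sh_def .
qed

text \<open>A set with at most \<open>d\<close> elements is listed by a \<open>d\<close>-tuple over
  \<open>U\<close>, padded with \<open>None\<close>.\<close>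

lemma card_small_subsets:
  assumes "finite U"
  shows "card {A. A \<subseteq> U \<and> card A \<le> d} \<le> (card U + 1) ^ d"
proof -
  let ?G = "{..<d} \<rightarrow>\<^sub>E insert None (Some ` U)"
  have fin: "finite ?G" using assms by (intro finite_PiE) auto
  have "{A. A \<subseteq> U \<and> card A \<le> d} \<subseteq> (\<lambda>g. {u. \<exists>j<d. g j = Some u}) ` ?G"
  proof
    fix A assume "A \<in> {A. A \<subseteq> U \<and> card A \<le> d}"
    then have A: "A \<subseteq> U" "card A \<le> d" by auto
    then obtain g where g: "bij_betw g {..<card A} A"
      using assms by (metis bij_betw_from_nat_into_finite finite_subset)
    let ?g = "\<lambda>j\<in>{..<d}. if j < card A then Some (g j) else None"
    have gA: "g j \<in> A" if "j < card A" for j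
      using g that by (auto simp: bij_betw_def)
    then have "?g \<in> ?G" using A(1) by (auto simp: image_iff subset_iff)
    moreover have "A = {u. \<exists>j<d. ?g j = Some u}"
    proof (intro set_eqI iffI)
      fix u assume "u \<in> A"
      then obtain j where "j < card A" "u = g j"
        using g by (auto simp: bij_betw_def)
      then show "u \<in> {u. \<exists>j<d. ?g j = Some u}"
        using A(2) by (auto intro!: exI[of _ j])
    next
      fix u assume "u \<in> {u. \<exists>j<d. ?g j = Some u}"
      then show "u \<in> A"
        using g by (auto simp: bij_betw_def split: if_splits)
    qed
    ultimately show "A \<in> (\<lambda>g. {u. \<exists>j<d. g j = Some u}) ` ?G" by blast
  qed
  then have "card {A. A \<subseteq> U \<and> card A \<le> d} \<le> card ?G"
    using fin by (meson card_image_le card_mono finite_imageI order_trans)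
  also have "\<dots> = (card U + 1) ^ d"
    using assms by (simp add: card_PiE card_image)
  finally show ?thesis .
qed

lemma Sauer_Shelah:
  assumes "finite U" "F \<subseteq> Pow U"
    and "\<And>A. A \<subseteq> U \<Longrightarrow> (\<And>B. B \<subseteq> A \<Longrightarrow> \<exists>T\<in>F. T \<inter> A = B) \<Longrightarrow> card A \<le> d"
  shows "card F \<le> (card U + 1) ^ d"
proof -
  have "card F \<le> card {A. A \<subseteq> U \<and> (\<forall>B\<subseteq>A. \<exists>T\<in>F. T \<inter> A = B)}"
    using assms(1,2) by (rule card_le_card_shattered)
  also have "\<dots> \<le> card {A. A \<subseteq> U \<and> card A \<le> d}"
    using assms by (intro card_mono) auto
  also have "\<dots> \<le> (card U + 1) ^ d"
    using assms(1) by (rule card_small_subsets)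
  finally show ?thesis .
qed

section \<open>Version spaces and their measurability\<close>

definition version :: "('a \<Rightarrow> int) set \<Rightarrow> nat \<Rightarrow> (nat \<Rightarrow> 'a) \<Rightarrow> (nat \<Rightarrow> int) \<Rightarrow> ('a \<Rightarrow> int) set" where
  "version C i X l = {h\<in>C. \<forall>j<i. h (X j) = l j}"

lemma version_cong:
  assumes "\<And>j. j < i \<Longrightarrow> X j = X' j" "\<And>j. j < i \<Longrightarrow> l j = l' j"
  shows "version C i X l = version C i X' l'"
proof -
  have "(\<forall>j<i. h (X j) = l j) \<longleftrightarrow> (\<forall>j<i. h (X' j) = l' j)" for h
    using assms by metis
  then show ?thesis unfolding version_def by presburger
qed

text \<open>A half of a version space is again a version space, with a hypothetical label at one
  more point. Everything measurable about version spaces therefore carries over to their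
  halves.\<close>

lemma version_Suc_upd:
  "version C (Suc i) (X(i := x)) (l(i := y)) = {h \<in> version C i X l. h x = y}"
  by (auto simp: version_def less_Suc_eq)

locale concept_space =
  fixes M :: "'a measure" and C :: "('a \<Rightarrow> int) set"
  assumes classifiers: "C \<subseteq> classifiers M"
    and sample_sets: "sample_sets_measurable M C"
begin

lemma classifier_measurable: "h \<in> C \<Longrightarrow> h \<in> M \<rightarrow>\<^sub>M count_space {-1, 1}"
  using classifiers by (auto simp: classifiers_def)

lemma classifier_measurable_UNIV:
  assumes "h \<in> C"
  shows "h \<in> M \<rightarrow>\<^sub>M count_space UNIV"
proof -
  have "(\<lambda>y. y) \<in> count_space {-1, 1 :: int} \<rightarrow>\<^sub>M count_space UNIV" by simp
  from measurable_compose[OF classifier_measurable[OF assms] this] show ?thesis .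
qed

lemma classifier_values: "h \<in> C \<Longrightarrow> x \<in> space M \<Longrightarrow> h x \<in> {-1, 1}"
  using measurable_space[OF classifier_measurable] by auto

text \<open>The standing assumption covers fixed labels only. Labels depending on \<open>w\<close>
  are handled by a finite union over all label vectors \<open>z\<close> in \<open>?Y\<close>;
  vectors with other values are never realizable.\<close>

lemma pred_realizable:
  fixes k :: nat
  assumes g[measurable]: "\<And>j. j < k \<Longrightarrow> g j \<in> N \<rightarrow>\<^sub>M M"
    and y[measurable]: "\<And>j. j < k \<Longrightarrow> y j \<in> N \<rightarrow>\<^sub>M count_space UNIV"
  shows "Measurable.pred N (\<lambda>w. \<exists>h\<in>C. \<forall>j<k. h (g j w) = y j w)"
proof -
  let ?Y = "{..<k} \<rightarrow>\<^sub>E {-1, 1 :: int}"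
  have [measurable]: "(\<lambda>w. \<lambda>j\<in>{..<k}. g j w) \<in> N \<rightarrow>\<^sub>M Pi\<^sub>M {..<k} (\<lambda>_. M)"
    by (intro measurable_restrict) auto
  have fixed: "Measurable.pred (Pi\<^sub>M {..<k} (\<lambda>_. M)) (\<lambda>S. \<exists>h\<in>C. \<forall>j<k. h (S j) = z j)" for z
    using sample_sets[unfolded sample_sets_measurable_def, rule_format, of k z]
    unfolding pred_def .
  have "(\<exists>h\<in>C. \<forall>j<k. h (g j w) = y j w) \<longleftrightarrow>
      (\<exists>z\<in>?Y. (\<forall>j<k. y j w = z j) \<and> (\<exists>h\<in>C. \<forall>j<k. h ((\<lambda>j\<in>{..<k}. g j w) j) = z j))"
    if w: "w \<in> space N" for w
  proof (intro iffI; clarsimp)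
    fix h assume h: "h \<in> C" "\<forall>j<k. h (g j w) = y j w"
    then have "(\<lambda>j\<in>{..<k}. y j w) \<in> ?Y"
      using w classifier_values[of h] measurable_space[OF g] by force
    then show "\<exists>z\<in>?Y. (\<forall>j<k. y j w = z j) \<and> (\<exists>h\<in>C. \<forall>j<k. h (g j w) = z j)"
      using h by (intro bexI[of _ "\<lambda>j\<in>{..<k}. y j w"]) auto
  qed auto
  moreover have "Measurable.pred N (\<lambda>w. \<exists>z\<in>?Y. (\<forall>j\<in>{..<k}. y j w = z j) \<and>
      (\<exists>h\<in>C. \<forall>j<k. h ((\<lambda>j\<in>{..<k}. g j w) j) = z j))"
  proof (rule pred_intros_finite(4))
    fix z
    have "Measurable.pred N (\<lambda>w. \<exists>h\<in>C. \<forall>j<k. h ((\<lambda>j\<in>{..<k}. g j w) j) = z j)"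
      by (rule measurable_compose[OF _ fixed]) measurable
    moreover have "Measurable.pred N (\<lambda>w. \<forall>j\<in>{..<k}. y j w = z j)"
      by measurable
    ultimately show "Measurable.pred N (\<lambda>w. (\<forall>j\<in>{..<k}. y j w = z j) \<and>
        (\<exists>h\<in>C. \<forall>j<k. h ((\<lambda>j\<in>{..<k}. g j w) j) = z j))"
      by (intro pred_intros_logic)
  qed (auto intro: finite_PiE)
  ultimately show ?thesis
    by (subst measurable_cong) (auto simp: Ball_def)
qed

text \<open>Extensional label vectors form a finite set, which measurability and almost sure
  statements about shattering require.\<close>

lemma shatters_iff_PiE:
  "shatters H k S \<longleftrightarrow> (\<forall>y \<in> {..<k} \<rightarrow>\<^sub>E {-1, 1}. \<exists>h\<in>H. \<forall>i<k. h (S i) = y i)"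
proof
  assume *: "\<forall>y \<in> {..<k} \<rightarrow>\<^sub>E {-1, 1}. \<exists>h\<in>H. \<forall>i<k. h (S i) = y i"
  show "shatters H k S"
    unfolding shatters_def
  proof
    fix y :: "nat \<Rightarrow> int" assume "y \<in> {..<k} \<rightarrow> {-1, 1}"
    then show "\<exists>h\<in>H. \<forall>i<k. h (S i) = y i"
      using bspec[OF *, of "restrict y {..<k}"] by auto
  qed
qed (auto simp: shatters_def PiE_def)

text \<open>For each label vector of the tuple, the version space realizes it iff \<open>C\<close>
  realizes the concatenation of the labeled sample with the labeled tuple, a sample of size
  \<open>i + k\<close>.\<close>

lemma pred_shatters:
  assumes X[measurable]: "\<And>j. j < i \<Longrightarrow> X j \<in> N \<rightarrow>\<^sub>M M"
    and l[measurable]: "\<And>j. j < i \<Longrightarrow> l j \<in> N \<rightarrow>\<^sub>M count_space UNIV"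
    and S[measurable]: "\<And>j. j < k \<Longrightarrow> S j \<in> N \<rightarrow>\<^sub>M M"
  shows "Measurable.pred N (\<lambda>w. shatters (version C i (\<lambda>j. X j w) (\<lambda>j. l j w)) k (\<lambda>j. S j w))"
proof -
  define g where "g j = (if j < i then X j else S (j - i))" for j
  define z where "z y j w = (if j < i then l j w else y (j - i))" for j w and y :: "nat \<Rightarrow> int"
  have "(\<exists>h\<in>version C i (\<lambda>j. X j w) (\<lambda>j. l j w). \<forall>j<k. h (S j w) = y j) \<longleftrightarrow>
      (\<exists>h\<in>C. \<forall>j<i + k. h (g j w) = z y j w)" for w y
  proof -
    have "(\<forall>j<i + k. P j) \<longleftrightarrow> (\<forall>j<i. P j) \<and> (\<forall>j<k. P (i + j))" for P
    proof (intro iffI conjI allI impI; (elim conjE)?)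
      fix j assume *: "\<forall>j<i. P j" "\<forall>j<k. P (i + j)" "j < i + k"
      then show "P j"
        by (cases "j < i") (auto dest: spec[of _ "j - i"])
    qed auto
    then show ?thesis by (auto simp: version_def g_def z_def)
  qed
  moreover have "Measurable.pred N (\<lambda>w. \<exists>h\<in>C. \<forall>j<i + k. h (g j w) = z y j w)" for y
  proof (rule pred_realizable)
    show "z y j \<in> N \<rightarrow>\<^sub>M count_space UNIV" for j
      unfolding z_def by (cases "j < i") auto
  qed (auto simp: g_def)
  ultimately show ?thesis
    unfolding shatters_iff_PiE by (intro pred_intros_finite(3)) (auto intro: finite_PiE)
qed

end

lemma shatters_mono:
  assumes "shatters H k S" "H \<subseteq> H'"
  shows "shatters H' k S"
  unfolding shatters_def
proof
  fix y :: "nat \<Rightarrow> int" assume "y \<in> {..<k} \<rightarrow> {-1, 1}"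
  then obtain h where "h \<in> H" "\<forall>i<k. h (S i) = y i"
    using assms(1) unfolding shatters_def by blast
  then show "\<exists>h\<in>H'. \<forall>i<k. h (S i) = y i"
    using assms(2) by blast
qed

section \<open>Epsilon nets\<close>

text \<open>The involution exchanging the two members of each pair \<open>(l, l + i)\<close> with
  \<open>l\<close> in \<open>\<sigma>\<close>, as used in the symmetrization argument for double
  samples.\<close>

definition swap :: "nat \<Rightarrow> nat set \<Rightarrow> nat \<Rightarrow> nat" where
  "swap i \<sigma> l = (if l < i \<and> l \<in> \<sigma> then l + i else if i \<le> l \<and> l < 2 * i \<and> l - i \<in> \<sigma> then l - i else l)"

lemma swap_swap: "swap i \<sigma> (swap i \<sigma> l) = l"
  unfolding swap_def by (cases "l < i"; cases "l < 2 * i") auto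

lemma swap_less: "l < 2 * i \<Longrightarrow> swap i \<sigma> l < 2 * i"
  by (auto simp: swap_def)

text \<open>If no point of \<open>T\<close> lands in the first half, then every pair met by \<open>T\<close> is met once and
  determines its own swap.\<close>

lemma card_swap_le:
  "card {\<sigma> \<in> Pow {..<i}. (\<forall>l<i. swap i \<sigma> l \<notin> T) \<and> m \<le> card {l \<in> {i..<2*i}. swap i \<sigma> l \<in> T}} * 2 ^ m \<le> 2 ^ i"
proof -
  define A where "A = {l \<in> {..<i}. (l \<in> T) \<noteq> (l + i \<in> T)}"
  define G where "G = {\<sigma> \<in> Pow {..<i}. (\<forall>l<i. swap i \<sigma> l \<notin> T) \<and> m \<le> card {l \<in> {i..<2*i}. swap i \<sigma> l \<in> T}}"
  have finA: "finite A" "A \<subseteq> {..<i}" by (auto simp: A_def)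
  have G: "\<sigma> \<inter> A = T \<inter> A \<and> m \<le> card A" if "\<sigma> \<in> G" for \<sigma>
  proof -
    have \<sigma>: "\<sigma> \<subseteq> {..<i}" "\<And>l. l < i \<Longrightarrow> swap i \<sigma> l \<notin> T" "m \<le> card {l \<in> {i..<2*i}. swap i \<sigma> l \<in> T}"
      using that by (auto simp: G_def)
    have 1: "l + i \<notin> T" if "l < i" "l \<in> \<sigma>" for l
      using \<sigma>(2)[OF that(1)] that by (simp add: swap_def)
    have 2: "l \<notin> T" if "l < i" "l \<notin> \<sigma>" for l
      using \<sigma>(2)[OF that(1)] that by (simp add: swap_def)
    have "{l \<in> {i..<2*i}. swap i \<sigma> l \<in> T} \<subseteq> (\<lambda>l. l + i) ` A"
    proof
      fix l assume l: "l \<in> {l \<in> {i..<2*i}. swap i \<sigma> l \<in> T}"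
      define j where "j = l - i"
      have j: "l = j + i" "j < i" using l by (auto simp: j_def)
      have "(if j \<in> \<sigma> then j else j + i) \<in> T" using l j by (auto simp: swap_def)
      then have "j \<in> A" using 1[OF j(2)] 2[OF j(2)] j(2) by (auto simp: A_def split: if_splits)
      then show "l \<in> (\<lambda>l. l + i) ` A" using j(1) by blast
    qed
    then have "card {l \<in> {i..<2*i}. swap i \<sigma> l \<in> T} \<le> card A"
      using finA by (meson card_image_le card_mono finite_imageI order_trans)
    moreover have "\<sigma> \<inter> A = T \<inter> A" using 1 2 by (auto simp: A_def)
    ultimately show ?thesis using \<sigma>(3) by simp
  qed
  show ?thesis
  proof (cases "G = {}")
    case True
    then show ?thesis unfolding G_def[symmetric] by simp
  next
    case False
    then have m: "m \<le> card A" using G by blast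
    have "inj_on (\<lambda>\<sigma>. \<sigma> - A) G"
    proof (rule inj_onI)
      fix \<sigma> \<tau> assume "\<sigma> \<in> G" "\<tau> \<in> G" "\<sigma> - A = \<tau> - A"
      then show "\<sigma> = \<tau>" using G by (metis Int_Diff_Un)
    qed
    then have "card G = card ((\<lambda>\<sigma>. \<sigma> - A) ` G)" by (simp add: card_image)
    also have "\<dots> \<le> card (Pow ({..<i} - A))" by (intro card_mono) (auto simp: G_def)
    also have "\<dots> = 2 ^ (i - card A)" using finA by (simp add: card_Pow card_Diff_subset)
    finally have "card G * 2 ^ m \<le> 2 ^ (i - card A) * 2 ^ card A"
      using m by (intro mult_mono power_increasing) auto
    also have "\<dots> = 2 ^ i"
      using card_mono[OF _ finA(2)] by (simp add: power_add[symmetric])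
    finally show ?thesis unfolding G_def .
  qed
qed

locale learning = sequence_space M + concept_space M C
  for M :: "'a measure" and C +
  fixes d :: nat and f :: "'a \<Rightarrow> int"
  assumes vc: "s \<in> space (Pi\<^sub>M {..<k} (\<lambda>_. M)) \<Longrightarrow> shatters C k s \<Longrightarrow> k \<le> d"
    and target: "f \<in> C"
begin

lemma f_measurable[measurable]: "f \<in> M \<rightarrow>\<^sub>M count_space UNIV"
  by (rule classifier_measurable_UNIV[OF target])

lemma space_S: "w \<in> space S \<Longrightarrow> w l \<in> space M"
  by (auto simp: space_PiM)

text \<open>Labels are binary, so prescribing the error set relative to \<open>f\<close> amounts to
  prescribing the labels. Index sets shattered by error sets thus give tuples shattered by
  \<open>C\<close>, and the Sauer-Shelah lemma applies.\<close>

lemma card_traces: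
  assumes w: "w \<in> space S"
  shows "card ((\<lambda>h. {l \<in> {..<n}. h (w l) \<noteq> f (w l)}) ` C) \<le> (n + 1) ^ d"
proof -
  have "card ((\<lambda>h. {l \<in> {..<n}. h (w l) \<noteq> f (w l)}) ` C) \<le> (card {..<n} + 1) ^ d"
  proof (rule Sauer_Shelah)
    fix A assume A: "A \<subseteq> {..<n}"
      and sh: "\<And>B. B \<subseteq> A \<Longrightarrow> \<exists>T\<in>(\<lambda>h. {l \<in> {..<n}. h (w l) \<noteq> f (w l)}) ` C. T \<inter> A = B"
    define k where "k = card A"
    obtain g where g: "bij_betw g {..<k} A"
      unfolding k_def using A by (metis bij_betw_from_nat_into_finite finite_subset finite_lessThan)
    have gA: "g i \<in> A" if "i < k" for i using g that by (auto simp: bij_betw_def)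
    have "shatters C k (\<lambda>i\<in>{..<k}. w (g i))"
      unfolding shatters_def
    proof
      fix y :: "nat \<Rightarrow> int" assume y: "y \<in> {..<k} \<rightarrow> {-1, 1}"
      define B where "B = g ` {i. i < k \<and> y i \<noteq> f (w (g i))}"
      have "B \<subseteq> A" using gA by (auto simp: B_def)
      then obtain h where h: "h \<in> C" "{l \<in> {..<n}. h (w l) \<noteq> f (w l)} \<inter> A = B"
        using sh[of B] by blast
      have "h (w (g i)) = y i" if i: "i < k" for i
      proof -
        have "g i \<in> B \<longleftrightarrow> y i \<noteq> f (w (g i))"
          using g i by (auto simp: B_def bij_betw_def inj_on_def)
        moreover have "g i \<in> B \<longleftrightarrow> h (w (g i)) \<noteq> f (w (g i))"
          using gA[OF i] A unfolding h(2)[symmetric] by blast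
        moreover have "y i \<in> {-1, 1}" using y i by auto
        moreover have "h (w (g i)) \<in> {-1, 1}" "f (w (g i)) \<in> {-1, 1}"
          using classifier_values target h(1) space_S[OF w] by blast+
        ultimately show ?thesis by auto
      qed
      then show "\<exists>h\<in>C. \<forall>i<k. h ((\<lambda>i\<in>{..<k}. w (g i)) i) = y i"
        using h(1) by (intro bexI[of _ h]) auto
    qed
    moreover have "(\<lambda>i\<in>{..<k}. w (g i)) \<in> space (Pi\<^sub>M {..<k} (\<lambda>_. M))"
      using space_S[OF w] by (auto simp: space_PiM)
    ultimately show "card A \<le> d" using vc unfolding k_def by blast
  qed auto
  then show ?thesis by simp
qed

text \<open>The ghost sample event. It replaces the error rate of \<open>h\<close> by a count over
  finitely many points.\<close>

definition double_sample_fails :: "nat \<Rightarrow> nat \<Rightarrow> (nat \<Rightarrow> 'a) \<Rightarrow> bool" where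
  "double_sample_fails i m w \<longleftrightarrow> (\<exists>h\<in>C. (\<forall>l<i. h (w l) = f (w l)) \<and> m \<le> card {l \<in> {i..<2*i}. h (w l) \<noteq> f (w l)})"

text \<open>The quantifier over \<open>h\<close> reduces to finitely many error sets
  \<open>T\<close>, each asking whether the labels of \<open>f\<close>, flipped on \<open>T\<close>,
  are realizable.\<close>

lemma pred_double_sample_fails[measurable]: "Measurable.pred S (double_sample_fails i m)"
proof -
  let ?z = "\<lambda>T l w. if l \<in> T then - f (w l) else f (w l)"
  have "double_sample_fails i m w \<longleftrightarrow> (\<exists>T\<in>{T \<in> Pow {..<2*i}. (\<forall>l<i. l \<notin> T) \<and> m \<le> card (T \<inter> {i..<2*i})}.
      \<exists>h\<in>C. \<forall>l<2*i. h (w l) = ?z T l w)" if w: "w \<in> space S" for w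
  proof
    assume "double_sample_fails i m w"
    then obtain h where h: "h \<in> C" "\<forall>l<i. h (w l) = f (w l)" "m \<le> card {l \<in> {i..<2*i}. h (w l) \<noteq> f (w l)}"
      by (auto simp: double_sample_fails_def)
    define T where "T = {l \<in> {..<2*i}. h (w l) \<noteq> f (w l)}"
    have "T \<inter> {i..<2*i} = {l \<in> {i..<2*i}. h (w l) \<noteq> f (w l)}" by (auto simp: T_def)
    then have "T \<in> {T \<in> Pow {..<2*i}. (\<forall>l<i. l \<notin> T) \<and> m \<le> card (T \<inter> {i..<2*i})}"
      using h by (auto simp: T_def)
    moreover have "h (w l) = ?z T l w" if "l < 2 * i" for l
    proof -
      have "h (w l) \<in> {-1, 1}" "f (w l) \<in> {-1, 1}"
        using classifier_values target h(1) space_S[OF w] by blast+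
      then show ?thesis using that by (auto simp: T_def)
    qed
    ultimately show "\<exists>T\<in>{T \<in> Pow {..<2*i}. (\<forall>l<i. l \<notin> T) \<and> m \<le> card (T \<inter> {i..<2*i})}.
        \<exists>h\<in>C. \<forall>l<2*i. h (w l) = ?z T l w" using h(1) by blast
  next
    assume "\<exists>T\<in>{T \<in> Pow {..<2*i}. (\<forall>l<i. l \<notin> T) \<and> m \<le> card (T \<inter> {i..<2*i})}.
        \<exists>h\<in>C. \<forall>l<2*i. h (w l) = ?z T l w"
    then obtain T h where T: "\<forall>l<i. l \<notin> T" "m \<le> card (T \<inter> {i..<2*i})" "h \<in> C"
      and h: "\<And>l. l < 2 * i \<Longrightarrow> h (w l) = ?z T l w" by auto
    have "T \<inter> {i..<2*i} = {l \<in> {i..<2*i}. h (w l) \<noteq> f (w l)}"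
    proof -
      have "h (w l) \<noteq> f (w l) \<longleftrightarrow> l \<in> T" if "l < 2 * i" for l
        using h[OF that] classifier_values[OF target space_S[OF w, of l]] by auto
      then show ?thesis by (intro set_eqI) (simp add: conj_commute cong: conj_cong)
    qed
    then show "double_sample_fails i m w"
      unfolding double_sample_fails_def using T h by (intro bexI[of _ h]) auto
  qed
  moreover have "Measurable.pred S (\<lambda>w. \<exists>T\<in>{T \<in> Pow {..<2*i}. (\<forall>l<i. l \<notin> T) \<and> m \<le> card (T \<inter> {i..<2*i})}.
      \<exists>h\<in>C. \<forall>l<2*i. h (w l) = ?z T l w)"
  proof (rule pred_intros_finite(4))
    fix T show "Measurable.pred S (\<lambda>w. \<exists>h\<in>C. \<forall>l<2*i. h (w l) = ?z T l w)"
      by (rule pred_realizable) measurable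
  qed simp
  ultimately show ?thesis by (subst measurable_cong) auto
qed

lemma distr_permute:
  assumes "bij \<pi>"
  shows "distr S S (\<lambda>w l. w (\<pi> l)) = S"
  using distr_PiM_reindex[of UNIV "\<lambda>_. M" \<pi> UNIV] assms M.prob_space_axioms
  by (simp add: bij_is_inj restrict_UNIV)

lemma measurable_permute: "(\<lambda>w l. w (\<pi> l)) \<in> S \<rightarrow>\<^sub>M S"
  by (rule measurable_PiM_single') (auto simp: space_PiM)

text \<open>A union bound over the at most \<open>(2 * i + 1) ^ d\<close> error sets on the double
  sample, each of which fails for at most a fraction \<open>1 / 2 ^ m\<close> of the swaps.\<close>

lemma card_swaps_failing:
  assumes w: "w \<in> space S"
  shows "card {\<sigma> \<in> Pow {..<i}. double_sample_fails i m (\<lambda>l. w (swap i \<sigma> l))} * 2 ^ m \<le> (2 * i + 1) ^ d * 2 ^ i"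
proof -
  define F where "F = (\<lambda>h. {l \<in> {..<2*i}. h (w l) \<noteq> f (w l)}) ` C"
  define G where "G T = {\<sigma> \<in> Pow {..<i}. (\<forall>l<i. swap i \<sigma> l \<notin> T) \<and> m \<le> card {l \<in> {i..<2*i}. swap i \<sigma> l \<in> T}}" for T
  have finF: "finite F" by (rule finite_subset[of _ "Pow {..<2*i}"]) (auto simp: F_def)
  have "{\<sigma> \<in> Pow {..<i}. double_sample_fails i m (\<lambda>l. w (swap i \<sigma> l))} \<subseteq> (\<Union>T\<in>F. G T)"
  proof
    fix \<sigma> assume \<sigma>: "\<sigma> \<in> {\<sigma> \<in> Pow {..<i}. double_sample_fails i m (\<lambda>l. w (swap i \<sigma> l))}"
    then obtain h where h: "h \<in> C" "\<And>l. l < i \<Longrightarrow> h (w (swap i \<sigma> l)) = f (w (swap i \<sigma> l))"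
      "m \<le> card {l \<in> {i..<2*i}. h (w (swap i \<sigma> l)) \<noteq> f (w (swap i \<sigma> l))}"
      by (auto simp: double_sample_fails_def)
    define T where "T = {l \<in> {..<2*i}. h (w l) \<noteq> f (w l)}"
    have "{l \<in> {i..<2*i}. h (w (swap i \<sigma> l)) \<noteq> f (w (swap i \<sigma> l))} = {l \<in> {i..<2*i}. swap i \<sigma> l \<in> T}"
      using swap_less by (auto simp: T_def)
    then have "\<sigma> \<in> G T" using \<sigma> h by (auto simp: G_def T_def)
    moreover have "T \<in> F" using h(1) by (auto simp: F_def T_def)
    ultimately show "\<sigma> \<in> (\<Union>T\<in>F. G T)" by blast
  qed
  moreover have finG: "finite (G T)" for T
    by (rule finite_subset[of _ "Pow {..<i}"]) (auto simp: G_def)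
  ultimately have "card {\<sigma> \<in> Pow {..<i}. double_sample_fails i m (\<lambda>l. w (swap i \<sigma> l))} \<le> card (\<Union>T\<in>F. G T)"
    using finF by (intro card_mono) auto
  also have "\<dots> \<le> (\<Sum>T\<in>F. card (G T))" by (rule card_UN_le[OF finF])
  finally have "card {\<sigma> \<in> Pow {..<i}. double_sample_fails i m (\<lambda>l. w (swap i \<sigma> l))} * 2 ^ m \<le> (\<Sum>T\<in>F. card (G T) * 2 ^ m)"
    by (simp add: sum_distrib_right[symmetric])
  also have "\<dots> \<le> (\<Sum>T\<in>F. 2 ^ i)"
    unfolding G_def by (intro sum_mono card_swap_le)
  also have "\<dots> = card F * 2 ^ i" by simp
  also have "\<dots> \<le> (2 * i + 1) ^ d * 2 ^ i"
    unfolding F_def by (intro mult_right_mono card_traces[OF w]) simp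
  finally show ?thesis .
qed

text \<open>Symmetrization: every swap preserves the law of the sequence, so the probability equals
  its average over all \<open>2 ^ i\<close> swaps, and this average is bounded for each fixed double
  sample.\<close>

lemma prob_double_sample_fails:
  "P.prob {w \<in> space S. double_sample_fails i m w} \<le> (2 * i + 1) ^ d / 2 ^ m"
proof -
  let ?E = "{w \<in> space S. double_sample_fails i m w}"
  let ?p = "\<lambda>\<sigma> w. \<lambda>l. w (swap i \<sigma> l)"
  have bij: "bij (swap i \<sigma>)" for \<sigma>
    by (rule o_bij[of "swap i \<sigma>"]) (auto simp: swap_swap)
  have "P.prob ?E = (\<integral>w. indicator ?E (?p \<sigma> w) \<partial>S)" for \<sigma>
  proof -
    have "P.prob ?E = (\<integral>w. indicator ?E w \<partial>distr S S (?p \<sigma>))"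
      by (simp add: distr_permute[OF bij])
    also have "\<dots> = (\<integral>w. indicator ?E (?p \<sigma> w) \<partial>S)"
      by (rule integral_distr[OF measurable_permute]) measurable
    finally show ?thesis .
  qed
  then have "2 ^ i * P.prob ?E = (\<Sum>\<sigma>\<in>Pow {..<i}. (\<integral>w. indicator ?E (?p \<sigma> w) \<partial>S))"
    by (simp add: card_Pow)
  also have "\<dots> = (\<integral>w. (\<Sum>\<sigma>\<in>Pow {..<i}. indicator ?E (?p \<sigma> w)) \<partial>S)"
  proof (rule Bochner_Integration.integral_sum[symmetric])
    fix \<sigma>
    have [measurable]: "?p \<sigma> \<in> S \<rightarrow>\<^sub>M S" by (rule measurable_permute)
    show "integrable S (\<lambda>w. indicat_real ?E (?p \<sigma> w))"
      by (rule P.integrable_const_bound[of _ 1]) (auto simp: indicator_def)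
  qed
  also have "\<dots> \<le> (2 * i + 1) ^ d * 2 ^ i / 2 ^ m"
  proof (rule P.integral_le_const)
    show "integrable S (\<lambda>w. \<Sum>\<sigma>\<in>Pow {..<i}. indicat_real ?E (?p \<sigma> w))"
    proof (rule Bochner_Integration.integrable_sum)
      fix \<sigma>
      have [measurable]: "?p \<sigma> \<in> S \<rightarrow>\<^sub>M S" by (rule measurable_permute)
      show "integrable S (\<lambda>w. indicat_real ?E (?p \<sigma> w))"
        by (rule P.integrable_const_bound[of _ 1]) (auto simp: indicator_def)
    qed
    have "(\<Sum>\<sigma>\<in>Pow {..<i}. indicat_real ?E (?p \<sigma> w)) \<le> (2 * i + 1) ^ d * 2 ^ i / 2 ^ m" if w: "w \<in> space S" for w
    proof -
      have "(\<Sum>\<sigma>\<in>Pow {..<i}. indicat_real ?E (?p \<sigma> w)) = (\<Sum>\<sigma>\<in>Pow {..<i}. of_bool (double_sample_fails i m (?p \<sigma> w)))"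
        using w by (intro sum.cong) (auto simp: indicator_def space_PiM)
      also have "\<dots> = real (card {\<sigma> \<in> Pow {..<i}. double_sample_fails i m (?p \<sigma> w)})"
        by (simp add: of_bool_def sum.If_cases Int_def)
      also have "\<dots> \<le> (2 * i + 1) ^ d * 2 ^ i / 2 ^ m"
        using card_swaps_failing[OF w, of i m] by (simp add: le_divide_eq flip: of_nat_le_iff[where 'a = real])
      finally show ?thesis .
    qed
    then show "AE w in S. (\<Sum>\<sigma>\<in>Pow {..<i}. indicat_real ?E (?p \<sigma> w)) \<le> (2 * i + 1) ^ d * 2 ^ i / 2 ^ m"
      by (intro AE_I2)
  qed
  finally show ?thesis by (simp add: field_simps)
qed

end

text \<open>A Chernoff bound. Each hit contributes a factor 1/2; the mean of the product is
  \<open>(1 - p / 2) ^ i\<close>, at most \<open>exp (- 2 * m)\<close> because \<open>p * i\<close>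
  is at least \<open>4 * m\<close>. Fewer than \<open>m\<close> hits make the product at least
  \<open>(1 / 2) ^ m\<close>, which leaves \<open>(2 * exp (- 2)) ^ m\<close>.\<close>

lemma (in sequence_space) prob_few_hits:
  fixes i m :: nat
  assumes D[measurable]: "D \<in> sets M" and p: "4 * m \<le> M.prob D * i" and m: "1 \<le> m"
  shows "P.prob {w \<in> space S. card {l. l < i \<and> w l \<in> D} < m} \<le> 1 / 2"
proof -
  let ?p = "M.prob D"
  let ?A = "{w \<in> space S. card {l. l < i \<and> w l \<in> D} < m}"
  have card_eq: "card {l. l < i \<and> w l \<in> D} = (\<Sum>l<i. of_bool (w l \<in> D))" for w
    by (simp add: of_bool_def sum.If_cases Int_def)
  have [measurable]: "?A \<in> sets S" unfolding card_eq by measurable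
  have "emeasure S ?A * ennreal ((1 / 2) ^ m) = (\<integral>\<^sup>+w. ennreal ((1 / 2) ^ m) * indicator ?A w \<partial>S)"
    by (simp add: nn_integral_cmult_indicator mult.commute)
  also have "\<dots> \<le> (\<integral>\<^sup>+w. (\<Prod>l<i. ennreal (1 - of_bool (w l \<in> D) / 2)) \<partial>S)"
  proof (intro nn_integral_mono)
    fix w
    have "(1 / 2) ^ m \<le> (\<Prod>l<i. 1 - of_bool (w l \<in> D) / 2 :: real)" if "w \<in> ?A"
    proof -
      have "(\<Prod>l<i. 1 - of_bool (w l \<in> D) / 2 :: real) = (\<Prod>l<i. if w l \<in> D then 1 / 2 else 1)"
        by (intro prod.cong) auto
      also have "\<dots> = (1 / 2) ^ card {l. l < i \<and> w l \<in> D}"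
        by (simp add: prod.If_cases Int_def)
      also have "\<dots> \<ge> (1 / 2) ^ m"
        using that by (intro power_decreasing) auto
      finally show ?thesis .
    qed
    then show "ennreal ((1 / 2) ^ m) * indicator ?A w \<le> (\<Prod>l<i. ennreal (1 - of_bool (w l \<in> D) / 2))"
      by (auto simp: indicator_def prod_ennreal intro!: ennreal_leI)
  qed
  also have "\<dots> \<le> (\<Prod>l<i. ennreal (1 - ?p / 2))"
  proof (rule nn_integral_prod_le[where G = "\<lambda>_ x _. ennreal (1 - of_bool (x \<in> D) / 2)"])
    have "(\<integral>\<^sup>+x. ennreal (1 - of_bool (x \<in> D) / 2) \<partial>M) = ennreal (\<integral>x. 1 - indicator D x / 2 \<partial>M)"
      by (subst nn_integral_eq_integral[symmetric])
         (auto simp: indicator_def of_bool_def intro!: M.integrable_const_bound[of _ 1] nn_integral_cong)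
    also have "(\<integral>x. 1 - indicator D x / 2 \<partial>M) = 1 - ?p / 2"
      by (subst Bochner_Integration.integral_diff) (auto simp: M.prob_space M.emeasure_eq_measure)
    finally show "(\<integral>\<^sup>+x. ennreal (1 - of_bool (x \<in> D) / 2) \<partial>M) \<le> ennreal (1 - ?p / 2)" by simp
  qed measurable
  also have "\<dots> = ennreal ((1 - ?p / 2) ^ i)"
    by (simp add: ennreal_power order_trans[OF M.prob_le_1])
  also have "\<dots> \<le> ennreal (exp (- 2 * m))"
  proof (rule ennreal_leI)
    have "(1 - ?p / 2) ^ i \<le> exp (- ?p / 2) ^ i"
      using exp_ge_add_one_self[of "- ?p / 2"] by (intro power_mono) (auto intro: order_trans[OF M.prob_le_1])
    also have "\<dots> = exp (- (?p * i) / 2)" by (simp add: exp_of_nat_mult[symmetric] mult_ac)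
    also have "\<dots> \<le> exp (- 2 * m)" using p by simp
    finally show "(1 - ?p / 2) ^ i \<le> exp (- 2 * m)" .
  qed
  finally have "ennreal (P.prob ?A * (1 / 2) ^ m) \<le> ennreal (exp (- 2 * m))"
    by (simp add: P.emeasure_eq_measure ennreal_mult)
  then have "P.prob ?A * (1 / 2) ^ m \<le> exp (- 2 * real m)" by simp
  then have "P.prob ?A \<le> exp (- 2 * real m) * 2 ^ m"
    by (simp add: field_simps)
  also have "\<dots> = (2 * exp (- 2)) ^ m"
    by (simp add: power_mult_distrib exp_of_nat_mult[symmetric] mult_ac)
  also have "\<dots> \<le> (1 / 2) ^ m"
  proof (rule power_mono)
    have "(2::real) * 2 \<le> exp 1 * exp 1"
      using exp_ge_add_one_self[of 1] by (intro mult_mono) auto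
    then show "2 * exp (- 2) \<le> (1 / 2 :: real)"
      by (simp add: exp_minus field_simps exp_add[symmetric])
  qed simp
  also have "\<dots> \<le> (1 / 2) ^ 1" using m by (intro power_decreasing) auto
  finally show ?thesis by simp
qed

context learning
begin

lemma er_eq: "er M f h = M.prob {x \<in> space M. h x \<noteq> f x}"
  by (simp add: er_def)

text \<open>The set of samples on which some consistent hypothesis is bad need not be measurable; the
  witness \<open>B\<close> is the measurable set of first halves whose double sample fails with probability
  at least one half.\<close>

theorem epsilon_net:
  assumes m: "1 \<le> m"
  obtains B where "B \<in> sets S" "P.prob B \<le> 2 * (2 * real i + 1) ^ d / 2 ^ m"
    "\<And>w h. w \<in> space S - B \<Longrightarrow> h \<in> version C i w (\<lambda>j. f (w j)) \<Longrightarrow> er M f h * i \<le> 4 * m"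
proof
  let ?E = "\<lambda>w w'. double_sample_fails i m (comb_seq i w w')"
  let ?g = "\<lambda>w. emeasure S {w' \<in> space S. ?E w w'}"
  define B where "B = {w \<in> space S. ennreal (1 / 2) \<le> ?g w}"
  have [measurable]: "Measurable.pred (S \<Otimes>\<^sub>M S) (\<lambda>(w, w'). ?E w w')" by measurable
  have [measurable]: "?g \<in> borel_measurable S"
    by (rule P.measurable_emeasure) measurable
  show B[measurable]: "B \<in> sets S" unfolding B_def by measurable
  \<comment> \<open>Markov's inequality for \<open>?g\<close>, whose mean is the failure probability
    of a full double sample.\<close>
  have "ennreal (1 / 2) * emeasure S B = (\<integral>\<^sup>+w. ennreal (1 / 2) * indicator B w \<partial>S)"
    by (simp add: nn_integral_cmult_indicator)
  also have "\<dots> \<le> (\<integral>\<^sup>+w. ?g w \<partial>S)"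
    by (intro nn_integral_mono) (auto simp: B_def indicator_def)
  also have "\<dots> = emeasure (S \<Otimes>\<^sub>M S) {v \<in> space (S \<Otimes>\<^sub>M S). ?E (fst v) (snd v)}"
    by (subst P.emeasure_pair_measure_alt)
       (auto simp: space_pair_measure split_beta' intro!: nn_integral_cong arg_cong[where f = "emeasure S"])
  also have "\<dots> = emeasure (distr (S \<Otimes>\<^sub>M S) S (\<lambda>(w, w'). comb_seq i w w')) {w \<in> space S. double_sample_fails i m w}"
    by (subst emeasure_distr)
       (auto simp: split_beta' intro!: arg_cong[where f = "emeasure (S \<Otimes>\<^sub>M S)"] dest: measurable_space[OF measurable_comb_seq])
  also have "\<dots> = ennreal (P.prob {w \<in> space S. double_sample_fails i m w})"
    unfolding PiM_comb_seq by (rule P.emeasure_eq_measure)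
  also have "\<dots> \<le> ennreal ((2 * i + 1) ^ d / 2 ^ m)"
    by (intro ennreal_leI order_trans[OF prob_double_sample_fails]) (simp add: add.commute)
  finally have "ennreal (1 / 2 * P.prob B) \<le> ennreal ((2 * i + 1) ^ d / 2 ^ m)"
    unfolding P.emeasure_eq_measure by (subst ennreal_mult) auto
  then have "1 / 2 * P.prob B \<le> (2 * i + 1) ^ d / 2 ^ m"
    by (subst (asm) ennreal_le_iff) auto
  then show "P.prob B \<le> 2 * (2 * real i + 1) ^ d / 2 ^ m" by (simp add: mult_ac add_ac)
  fix w h assume w: "w \<in> space S - B" and h: "h \<in> version C i w (\<lambda>j. f (w j))"
  show "er M f h * i \<le> 4 * m"
  proof (rule ccontr)
    assume *: "\<not> er M f h * i \<le> 4 * m"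
    have hC: "h \<in> C" using h by (simp add: version_def)
    have [measurable]: "h \<in> M \<rightarrow>\<^sub>M count_space UNIV" by (rule classifier_measurable_UNIV[OF hC])
    define D where "D = {x \<in> space M. h x \<noteq> f x}"
    have D[measurable]: "D \<in> sets M" unfolding D_def by measurable
    let ?A = "{w' \<in> space S. card {l. l < i \<and> w' l \<in> D} < m}"
    have card_eq: "card {l. l < i \<and> w l \<in> D} = (\<Sum>l<i. of_bool (w l \<in> D))" for w
      by (simp add: of_bool_def sum.If_cases Int_def)
    have [measurable]: "?A \<in> sets S" unfolding card_eq by measurable
    \<comment> \<open>A consistent \<open>h\<close> with too large an error is wrong on at least
      \<open>m\<close> ghost points with probability at least one half. This puts \<open>w\<close>
      into \<open>B\<close>, a contradiction.\<close>
    have "P.prob ?A \<le> 1 / 2"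
      using * m by (intro prob_few_hits[OF D]) (auto simp: er_eq D_def)
    then have "1 / 2 \<le> P.prob (space S - ?A)"
      by (subst P.prob_compl) auto
    also have "\<dots> \<le> P.prob {w' \<in> space S. ?E w w'}"
    proof (rule P.finite_measure_mono)
      show "space S - ?A \<subseteq> {w' \<in> space S. ?E w w'}"
      proof
        fix w' assume w': "w' \<in> space S - ?A"
        have "card {l. l < i \<and> w' l \<in> D} = card ((\<lambda>l. l + i) ` {l. l < i \<and> w' l \<in> D})"
          by (rule card_image[symmetric]) simp
        also have "(\<lambda>l. l + i) ` {l. l < i \<and> w' l \<in> D} =
            {l \<in> {i..<2*i}. h (comb_seq i w w' l) \<noteq> f (comb_seq i w w' l)}"
        proof (intro set_eqI iffI)
          fix l assume "l \<in> {l \<in> {i..<2*i}. h (comb_seq i w w' l) \<noteq> f (comb_seq i w w' l)}"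
          then have "l = (l - i) + i" "l - i < i" "w' (l - i) \<in> D"
            using w' by (auto simp: D_def comb_seq_def space_PiM)
          then show "l \<in> (\<lambda>l. l + i) ` {l. l < i \<and> w' l \<in> D}" by blast
        qed (auto simp: D_def comb_seq_def)
        finally show "w' \<in> {w' \<in> space S. ?E w w'}"
          using w' h hC unfolding double_sample_fails_def
          by (auto intro!: bexI[of _ h] simp: version_def comb_seq_less)
      qed
      have "(\<lambda>w'. comb_seq i w w') \<in> S \<rightarrow>\<^sub>M S"
        using w by (intro measurable_comb_seq' measurable_const measurable_ident_sets) auto
      then show "{w' \<in> space S. ?E w w'} \<in> P.events"
        using measurable_compose[OF _ pred_double_sample_fails[of i m]] by (simp add: pred_def)
    qed
    finally have "ennreal (1 / 2) \<le> ?g w"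
      unfolding P.emeasure_eq_measure by (rule ennreal_leI)
    then have "w \<in> B"
      using w unfolding B_def by blast
    then show False using w by simp
  qed
qed

end

section \<open>The learner\<close>

text \<open>The subtraction is truncated, but the least order is positive whenever \<open>\<tau> < 1\<close> and \<open>V\<close> is
  nonempty, since the empty tuple is then shattered with probability one.\<close>

definition decide ::
    "real \<Rightarrow> (nat \<Rightarrow> ('a \<Rightarrow> int) set \<Rightarrow> real) \<Rightarrow> ('a \<Rightarrow> int) set \<Rightarrow> 'a \<Rightarrow> int option" where
  "decide \<tau> \<phi> V x =
     (let k = (LEAST k. \<phi> k V \<le> \<tau>) - 1 in
      if \<phi> k {h\<in>V. h x = -1} < \<phi> k V / 2 then Some 1
      else if \<phi> k {h\<in>V. h x = 1} < \<phi> k V / 2 then Some (-1)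
      else None)"

text \<open>\<open>labels\<close> replays the run from the answers \<open>H\<close> received so far and gets stuck, returning
  fewer than the demanded number of labels, at the first point whose label is still to be requested.\<close>

primrec labels :: "(int list \<Rightarrow> int option) \<Rightarrow> history \<Rightarrow> nat \<Rightarrow> int list" where
  "labels D H 0 = []"
| "labels D H (Suc i) =
     (let L = labels D H i in
      if length L < i then L
      else case D L of Some y \<Rightarrow> L @ [y]
           | None \<Rightarrow> (case map_of H i of Some y \<Rightarrow> L @ [y] | None \<Rightarrow> L))"

text \<open>The fifth root lets the \<open>t ^ 4\<close> initial requests and fewer than
  \<open>t ^ 5 - t ^ 4\<close> later ones fit into the budget.\<close>

definition budget_root :: "nat \<Rightarrow> nat" where
  "budget_root n = (GREATEST t. t ^ 5 \<le> n)"

definition shatter_freq :: "(nat \<Rightarrow> 'a) \<Rightarrow> nat \<Rightarrow> ('a \<Rightarrow> int) set \<Rightarrow> real" where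
  "shatter_freq w k V = freq k (shatters V k) w"

text \<open>The points before index \<open>2\<^sup>t\<close> are labeled and those after it estimate probabilities. The point
  with index \<open>2\<^sup>t\<close> itself is left out, so that it can be exchanged for the test point.\<close>

definition decide_sample :: "('a \<Rightarrow> int) set \<Rightarrow> nat \<Rightarrow> (nat \<Rightarrow> 'a) \<Rightarrow> int list \<Rightarrow> 'a \<Rightarrow> int option" where
  "decide_sample C t X L x =
     decide (1 / t) (shatter_freq (\<lambda>j. X (j + Suc (2 ^ t)))) (version C (length L) X ((!) L)) x"

text \<open>\<open>None\<close> means that the label has to be requested. Nothing is inferred from
  fewer than \<open>t ^ 4\<close> points, since the version space may still be too wide for
  \<open>decide\<close> to be reliable.\<close>

definition next_label :: "('a \<Rightarrow> int) set \<Rightarrow> nat \<Rightarrow> (nat \<Rightarrow> 'a) \<Rightarrow> int list \<Rightarrow> int option" where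
  "next_label C t X L = (if length L < t ^ 4 then None else decide_sample C t X L (X (length L)))"

text \<open>No state is kept between rounds: all labels are recomputed from the history. The final
  classifier treats the test point like one more sample point; the default 1 matters only where the
  learner would have requested the label.\<close>

definition learner :: "('a \<Rightarrow> int) set \<Rightarrow> 'a active_learner" where
  "learner C =
     \<lparr>query = \<lambda>n u X H. let t = budget_root n; L = labels (next_label C t X) H (2 ^ t) in
        if length L < 2 ^ t then Some (length L) else None,
      answer = \<lambda>n u X H x. let t = budget_root n; L = labels (next_label C t X) H (2 ^ t) in
        (case decide_sample C t X L x of Some y \<Rightarrow> y | None \<Rightarrow> 1)\<rparr>"

text \<open>As long as all labels are true, the replay only ever consults \<open>D\<close> on true
  prefixes, so correctness of \<open>D\<close> there is enough. An early stop occurs at an index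
  that is undecided and still missing from the history.\<close>

lemma labels_prefix:
  assumes Y: "\<And>j y. (j, y) \<in> set H \<Longrightarrow> y = Y j"
    and D: "\<And>i y. i < N \<Longrightarrow> D (map Y [0..<i]) = Some y \<Longrightarrow> y = Y i"
    and "i \<le> N"
  shows "\<exists>m\<le>i. labels D H i = map Y [0..<m] \<and>
    (m < i \<longrightarrow> D (map Y [0..<m]) = None \<and> m \<notin> fst ` set H)"
  using \<open>i \<le> N\<close>
proof (induction i)
  case (Suc i)
  then obtain m where m: "m \<le> i" "labels D H i = map Y [0..<m]"
    "m < i \<Longrightarrow> D (map Y [0..<m]) = None \<and> m \<notin> fst ` set H" by auto
  show ?case
  proof (cases "m < i")
    case True
    with m show ?thesis by (intro exI[of _ m]) (simp add: Let_def)
  next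
    case False
    with m have m: "labels D H i = map Y [0..<i]" by simp
    show ?thesis
    proof (cases "D (map Y [0..<i])")
      case None
      show ?thesis
      proof (cases "map_of H i")
        assume "map_of H i = None"
        moreover from this have "i \<notin> fst ` set H" by (simp add: map_of_eq_None_iff)
        ultimately show ?thesis
          using None m by (intro exI[of _ i]) (simp add: Let_def)
      next
        fix y assume y: "map_of H i = Some y"
        then have "y = Y i" using map_of_SomeD[OF y] Y by blast
        with None m y show ?thesis by (intro exI[of _ "Suc i"]) (simp add: Let_def)
      qed
    next
      case (Some y)
      then have "y = Y i" using D Suc.prems by simp
      with Some m show ?thesis by (intro exI[of _ "Suc i"]) (simp add: Let_def)
    qed
  qed
qed simp

text \<open>Every round either finds the replay complete or requests a new undecided index. There
  are at most \<open>n\<close> such indices, so \<open>n\<close> rounds suffice.\<close>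

lemma labels_interact:
  assumes D: "\<And>i y. i < N \<Longrightarrow> D (map Y [0..<i]) = Some y \<Longrightarrow> y = Y i"
    and requests: "card {i. i < N \<and> D (map Y [0..<i]) = None} \<le> n"
    and q: "\<And>H. q H = (let L = labels D H N in if length L < N then Some (length L) else None)"
  shows "labels D (interact q Y n) N = map Y [0..<N]"
proof -
  define R where "R = {i. i < N \<and> D (map Y [0..<i]) = None}"
  have finR: "finite R" by (simp add: R_def)
  have state: "\<exists>m\<le>N. labels D H N = map Y [0..<m] \<and> (m < N \<longrightarrow> m \<in> R - fst ` set H)"
    if correct: "\<And>j y. (j, y) \<in> set H \<Longrightarrow> y = Y j" for H
  proof -
    have "\<exists>m\<le>N. labels D H N = map Y [0..<m] \<and>
        (m < N \<longrightarrow> D (map Y [0..<m]) = None \<and> m \<notin> fst ` set H)"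
      by (rule labels_prefix[of H Y N D N]) (use correct in blast, use D in blast, simp)
    then show ?thesis unfolding R_def by blast
  qed
  have q_None: "labels D H N = map Y [0..<N]"
    if correct: "\<And>j y. (j, y) \<in> set H \<Longrightarrow> y = Y j" and None: "q H = None" for H
  proof -
    obtain m where m: "m \<le> N" "labels D H N = map Y [0..<m]"
      using state[OF correct] by blast
    moreover have "\<not> length (labels D H N) < N"
      using None unfolding q Let_def by (simp split: if_splits)
    ultimately show ?thesis by simp
  qed
  have q_Some: "i \<in> R - fst ` set H"
    if correct: "\<And>j y. (j, y) \<in> set H \<Longrightarrow> y = Y j" and Some: "q H = Some i" for H i
  proof -
    obtain m where m: "m \<le> N" "labels D H N = map Y [0..<m]" "m < N \<longrightarrow> m \<in> R - fst ` set H"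
      using state[OF correct] by blast
    moreover have "length (labels D H N) < N" "i = length (labels D H N)"
      using Some unfolding q Let_def by (simp_all split: if_splits)
    ultimately show ?thesis by simp
  qed
  have inv: "(\<forall>j y. (j, y) \<in> set (interact q Y t) \<longrightarrow> y = Y j) \<and> fst ` set (interact q Y t) \<subseteq> R \<and>
      (q (interact q Y t) = None \<or> card (fst ` set (interact q Y t)) = t)" for t
  proof (induction t)
    case (Suc t)
    let ?H = "interact q Y t"
    have correct: "\<And>j y. (j, y) \<in> set ?H \<Longrightarrow> y = Y j" using Suc by blast
    show ?case
    proof (cases "q ?H")
      case None
      with Suc show ?thesis by (simp add: Let_def)
    next
      case (Some i)
      then have H: "interact q Y (Suc t) = ?H @ [(i, Y i)]" by (simp add: Let_def)
      have "i \<in> R - fst ` set ?H" using q_Some[OF correct Some] .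
      moreover have "card (fst ` set ?H) = t" using Suc Some by simp
      ultimately show ?thesis using Suc unfolding H by simp
    qed
  qed simp
  let ?H = "interact q Y n"
  have correct: "\<And>j y. (j, y) \<in> set ?H \<Longrightarrow> y = Y j" using inv[of n] by blast
  \<comment> \<open>Another request would be an undecided index beyond the \<open>n\<close> distinct
    ones already in the history.\<close>
  have "q ?H = None"
  proof (rule ccontr)
    assume "q ?H \<noteq> None"
    then obtain i where i: "q ?H = Some i" by blast
    then have "i \<in> R - fst ` set ?H" using q_Some correct by blast
    then have "fst ` set ?H \<subset> R" using inv[of n] by blast
    then have "card (fst ` set ?H) < card R" using finR by (simp add: psubset_card_mono)
    then show False using inv[of n] i requests unfolding R_def by simp
  qed
  from q_None[OF correct this] show ?thesis .
qed

section \<open>Measurability of the learner\<close>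

lemma measurable_decide:
  assumes [measurable]: "\<And>k. (\<lambda>v. \<phi> v k (V v)) \<in> borel_measurable N"
    and [measurable]: "\<And>k y. (\<lambda>v. \<phi> v k {h\<in>V v. h (x v) = y}) \<in> borel_measurable N"
  shows "(\<lambda>v. decide \<tau> (\<phi> v) (V v) (x v)) \<in> N \<rightarrow>\<^sub>M count_space UNIV"
proof -
  have k[measurable]: "(\<lambda>v. (LEAST k. \<phi> v k (V v) \<le> \<tau>) - 1) \<in> N \<rightarrow>\<^sub>M count_space UNIV"
    by measurable
  \<comment> \<open>The order found is random but has countably many values, so it may be frozen.
    The same device handles the random label lists below.\<close>
  show ?thesis
    unfolding decide_def Let_def
    by (rule measurable_compose_countable'[where f = "\<lambda>k v.
        if \<phi> v k {h\<in>V v. h (x v) = -1} < \<phi> v k (V v) / 2 then Some 1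
        else if \<phi> v k {h\<in>V v. h (x v) = 1} < \<phi> v k (V v) / 2 then Some (-1) else None", OF _ k])
      measurable
qed

lemma measurable_labels:
  assumes D[measurable]: "\<And>L. (\<lambda>v. D v L) \<in> N \<rightarrow>\<^sub>M count_space UNIV"
  shows "(\<lambda>v. labels (D v) H i) \<in> N \<rightarrow>\<^sub>M count_space UNIV"
proof (induction i)
  case (Suc i)
  let ?step = "\<lambda>L o'. if length L < i then L
      else case o' of Some y \<Rightarrow> L @ [y]
           | None \<Rightarrow> (case map_of H i of Some y \<Rightarrow> L @ [y] | None \<Rightarrow> L)"
  have "(\<lambda>v. ?step (labels (D v) H i) (D v (labels (D v) H i))) \<in> N \<rightarrow>\<^sub>M count_space UNIV"
    by (rule measurable_compose_countable'[where f = "\<lambda>L v. ?step L (D v L)" and g = "\<lambda>v. labels (D v) H i" and I = UNIV])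
       (auto intro!: Suc measurable_compose[OF D, where g = "?step L" for L])
  then show ?case by (simp add: Let_def)
qed simp

context concept_space
begin

lemma measurable_shatter_freq:
  assumes w[measurable]: "w \<in> N \<rightarrow>\<^sub>M Pi\<^sub>M UNIV (\<lambda>_. M)"
    and X[measurable]: "\<And>j. j < i \<Longrightarrow> X j \<in> N \<rightarrow>\<^sub>M M"
    and l[measurable]: "\<And>j. j < i \<Longrightarrow> l j \<in> N \<rightarrow>\<^sub>M count_space UNIV"
  shows "(\<lambda>v. shatter_freq (w v) k (version C i (\<lambda>j. X j v) (\<lambda>j. l j v))) \<in> borel_measurable N"
proof -
  have "Measurable.pred (N \<Otimes>\<^sub>M Pi\<^sub>M {..<k} (\<lambda>_. M))
      (\<lambda>v. shatters (version C i (\<lambda>j. X j (fst v)) (\<lambda>j. l j (fst v))) k (\<lambda>j. snd v j))"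
    by (rule pred_shatters) measurable
  then show ?thesis
    unfolding shatter_freq_def by (intro borel_measurable_freq[OF _ w]) (simp add: split_beta')
qed

lemma measurable_decide_sample:
  assumes X[measurable]: "X \<in> N \<rightarrow>\<^sub>M Pi\<^sub>M UNIV (\<lambda>_. M)" and x[measurable]: "x \<in> N \<rightarrow>\<^sub>M M"
  shows "(\<lambda>v. decide_sample C t (X v) L (x v)) \<in> N \<rightarrow>\<^sub>M count_space UNIV"
  unfolding decide_sample_def
proof (rule measurable_decide)
  have Xj[measurable]: "(\<lambda>v. X v j) \<in> N \<rightarrow>\<^sub>M M" for j
    using measurable_compose[OF X measurable_component_singleton[of j UNIV]] by simp
  have w: "(\<lambda>v j. X v (j + Suc (2 ^ t))) \<in> N \<rightarrow>\<^sub>M Pi\<^sub>M UNIV (\<lambda>_. M)"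
    by (rule measurable_PiM_single') (auto simp: PiE_def dest: measurable_space[OF Xj])
  show "(\<lambda>v. shatter_freq (\<lambda>j. X v (j + Suc (2 ^ t))) k (version C (length L) (X v) ((!) L))) \<in> borel_measurable N" for k
    by (rule measurable_shatter_freq[OF w Xj, where l = "\<lambda>j _. L ! j"]) simp
  fix k y
  have eq: "{h \<in> version C (length L) (X v) ((!) L). h (x v) = y} =
      version C (Suc (length L)) (\<lambda>j. (if j = length L then x else (\<lambda>v. X v j)) v) (((!) L)(length L := y))" for v
    unfolding version_Suc_upd[symmetric] by (rule version_cong) auto
  show "(\<lambda>v. shatter_freq (\<lambda>j. X v (j + Suc (2 ^ t))) k {h \<in> version C (length L) (X v) ((!) L). h (x v) = y})
      \<in> borel_measurable N"
    unfolding eq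
    by (rule measurable_shatter_freq[OF w, where l = "\<lambda>j _. (((!) L)(length L := y)) j"]) auto
qed

lemma active_learning_algorithm_learner: "active_learning_algorithm M (learner C)"
proof -
  have next_meas: "(\<lambda>v. next_label C t (X v) L) \<in> N \<rightarrow>\<^sub>M count_space UNIV"
    if X: "X \<in> N \<rightarrow>\<^sub>M Pi\<^sub>M UNIV (\<lambda>_. M)" for X and N :: "'b measure" and t L
    unfolding next_label_def
    using measurable_decide_sample[OF X measurable_compose[OF X measurable_component_singleton]] by simp
  have labels_meas: "(\<lambda>v. labels (next_label C t (X v)) H i) \<in> N \<rightarrow>\<^sub>M count_space UNIV"
    if X: "X \<in> N \<rightarrow>\<^sub>M Pi\<^sub>M UNIV (\<lambda>_. M)" for X and N :: "'b measure" and t H i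
    by (rule measurable_labels[OF next_meas[OF X]])
  have "(\<lambda>v. query (learner C) n (fst v) (snd v) H) \<in> seed \<Otimes>\<^sub>M Pi\<^sub>M UNIV (\<lambda>_. M) \<rightarrow>\<^sub>M count_space UNIV" for n H
    unfolding learner_def Let_def
    by (simp, rule measurable_compose[OF labels_meas[OF measurable_snd]
        measurable_count_space[of "\<lambda>L. if length L < 2 ^ budget_root n then Some (length L) else None"]])
  moreover have "(\<lambda>v. answer (learner C) n (fst (fst v)) (snd (fst v)) H (snd v)) \<in>
      (seed \<Otimes>\<^sub>M Pi\<^sub>M UNIV (\<lambda>_. M)) \<Otimes>\<^sub>M M \<rightarrow>\<^sub>M count_space {-1, 1}" for n H
  proof -
    let ?N = "(seed \<Otimes>\<^sub>M Pi\<^sub>M UNIV (\<lambda>_. M)) \<Otimes>\<^sub>M M"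
    have X: "(\<lambda>v. snd (fst v)) \<in> ?N \<rightarrow>\<^sub>M Pi\<^sub>M UNIV (\<lambda>_. M)" by measurable
    let ?L = "\<lambda>v. labels (next_label C (budget_root n) (snd (fst v))) H (2 ^ budget_root n)"
    have "(\<lambda>v. decide_sample C (budget_root n) (snd (fst v)) (?L v) (snd v)) \<in> ?N \<rightarrow>\<^sub>M count_space UNIV"
      by (rule measurable_compose_countable'[where f = "\<lambda>L v. decide_sample C (budget_root n) (snd (fst v)) L (snd v)" and I = UNIV])
         (auto intro: measurable_decide_sample[OF X] labels_meas[OF X])
    then have "(\<lambda>v. case decide_sample C (budget_root n) (snd (fst v)) (?L v) (snd v) of Some y \<Rightarrow> y | None \<Rightarrow> 1)
        \<in> ?N \<rightarrow>\<^sub>M count_space UNIV"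
      by (rule measurable_compose) simp
    moreover have "(case decide_sample C t X L x of Some y \<Rightarrow> y | None \<Rightarrow> 1) \<in> {-1, 1}" for t X L x
      by (simp add: decide_sample_def decide_def Let_def)
    ultimately show ?thesis
      unfolding learner_def Let_def
      by (simp add: measurable_count_space_eq2_countable Pi_def)
  qed
  ultimately show ?thesis
    unfolding active_learning_algorithm_def by (simp add: split_beta')
qed

end

section \<open>Shattering probabilities of the true version space\<close>

definition shatter_prob :: "'a measure \<Rightarrow> nat \<Rightarrow> ('a \<Rightarrow> int) set \<Rightarrow> real" where
  "shatter_prob P k V = measure (Pi\<^sub>M {..<k} (\<lambda>_. P)) {s \<in> space (Pi\<^sub>M {..<k} (\<lambda>_. P)). shatters V k s}"

context learning
begin

abbreviation tuples :: "nat \<Rightarrow> (nat \<Rightarrow> 'a) measure" where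
  "tuples k \<equiv> Pi\<^sub>M {..<k} (\<lambda>_. M)"

lemma prob_space_tuples: "prob_space (tuples k)"
  by (intro prob_space_PiM M.prob_space_axioms)

lemma measurable_coordinate: "(\<lambda>w. w j) \<in> S \<rightarrow>\<^sub>M M"
  by measurable

lemma measurable_truth: "(\<lambda>w. f (w j)) \<in> S \<rightarrow>\<^sub>M count_space UNIV"
  by measurable

lemma pred_shatters_pair:
  assumes X[measurable]: "\<And>j. j < i \<Longrightarrow> X j \<in> N \<rightarrow>\<^sub>M M"
    and l[measurable]: "\<And>j. j < i \<Longrightarrow> l j \<in> N \<rightarrow>\<^sub>M count_space UNIV"
  shows "Measurable.pred (N \<Otimes>\<^sub>M tuples k)
    (\<lambda>(v, s). shatters (version C i (\<lambda>j. X j v) (\<lambda>j. l j v)) k s)"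
proof -
  have "Measurable.pred (N \<Otimes>\<^sub>M tuples k)
      (\<lambda>v. shatters (version C i (\<lambda>j. X j (fst v)) (\<lambda>j. l j (fst v))) k (\<lambda>j. snd v j))"
    by (rule pred_shatters) measurable
  then show ?thesis by (simp add: split_beta')
qed

lemma borel_measurable_shatter_prob:
  assumes X: "\<And>j. j < i \<Longrightarrow> X j \<in> N \<rightarrow>\<^sub>M M"
    and l: "\<And>j. j < i \<Longrightarrow> l j \<in> N \<rightarrow>\<^sub>M count_space UNIV"
  shows "(\<lambda>v. shatter_prob M k (version C i (\<lambda>j. X j v) (\<lambda>j. l j v))) \<in> borel_measurable N"
proof -
  interpret K: prob_space "tuples k" by (rule prob_space_tuples)
  have "(\<lambda>v. emeasure (tuples k) {s \<in> space (tuples k). shatters (version C i (\<lambda>j. X j v) (\<lambda>j. l j v)) k s})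
      \<in> borel_measurable N"
    by (rule K.measurable_emeasure) (use pred_shatters_pair[OF X l] in \<open>simp_all add: pred_def split_beta'\<close>)
  then show ?thesis
    unfolding shatter_prob_def measure_def by measurable
qed

lemma pred_shatters_fixed:
  assumes "\<And>j. j < i \<Longrightarrow> X j \<in> space M"
  shows "Measurable.pred (tuples k) (shatters (version C i X l) k)"
proof -
  have "Measurable.pred (tuples k) (\<lambda>s. shatters (version C i (\<lambda>j. (\<lambda>j _. X j) j s) (\<lambda>j. (\<lambda>j _. l j) j s)) k (\<lambda>j. (\<lambda>j s. s j) j s))"
    by (rule pred_shatters) (use assms in auto)
  then show ?thesis by simp
qed

lemma AE_shatter_freq_fixed:
  assumes "\<And>j. j < i \<Longrightarrow> X j \<in> space M"
  shows "AE w in S. shatter_freq w k (version C i X l) = shatter_prob M k (version C i X l)"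
  unfolding shatter_freq_def shatter_prob_def by (rule AE_freq[OF pred_shatters_fixed[OF assms]])

text \<open>The version space is a function of the coordinates before \<open>i \<le> N\<close>, the
  frequencies use only those from \<open>N\<close> on; by independence the version space may be
  taken as fixed.\<close>

lemma AE_shatter_freq:
  assumes l: "\<And>j. j < i \<Longrightarrow> l j \<in> S \<rightarrow>\<^sub>M count_space UNIV"
    and past: "\<And>w w' j. (\<And>j. j < i \<Longrightarrow> w j = w' j) \<Longrightarrow> j < i \<Longrightarrow> l j w = l j w'"
    and i: "i \<le> N"
  shows "AE w in S. shatter_freq (\<lambda>j. w (j + N)) k (version C i w (\<lambda>j. l j w)) =
    shatter_prob M k (version C i w (\<lambda>j. l j w))"
proof -
  let ?Q = "\<lambda>w w'. shatter_freq w' k (version C i w (\<lambda>j. l j w)) = shatter_prob M k (version C i w (\<lambda>j. l j w))"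
  have X: "(\<lambda>v. fst v j) \<in> S \<Otimes>\<^sub>M S \<rightarrow>\<^sub>M M" and l': "j < i \<Longrightarrow> (\<lambda>v. l j (fst v)) \<in> S \<Otimes>\<^sub>M S \<rightarrow>\<^sub>M count_space UNIV" for j
    using l by auto
  have snd: "snd \<in> S \<Otimes>\<^sub>M S \<rightarrow>\<^sub>M S" by measurable
  show ?thesis
  proof (rule AE_tail[where Q = ?Q and N = N])
    have "Measurable.pred (S \<Otimes>\<^sub>M S) (\<lambda>v. ?Q (fst v) (snd v))"
    proof -
      note [measurable] = measurable_shatter_freq[OF snd X l', where k = k]
        borel_measurable_shatter_prob[OF X l', where k = k]
      show ?thesis by measurable
    qed
    then show "Measurable.pred (S \<Otimes>\<^sub>M S) (\<lambda>(w, w'). ?Q w w')" by (simp add: split_beta')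
    show "AE w' in S. ?Q w w'" if "w \<in> space S" for w
      by (rule AE_shatter_freq_fixed) (use that space_S in auto)
    fix w w' w'' :: "nat \<Rightarrow> 'a" assume *: "\<And>j. j < N \<Longrightarrow> w j = w' j"
    have "version C i w (\<lambda>j. l j w) = version C i w' (\<lambda>j. l j w')"
      using * i by (intro version_cong past) auto
    then show "?Q w w'' \<longleftrightarrow> ?Q w' w''" by simp
  qed
qed

end

section \<open>The disagreement core and random samples\<close>

locale margin_learning = learning +
  assumes shatter_sets: "shatter_sets_measurable C M"
begin

abbreviation core :: "nat \<Rightarrow> (nat \<Rightarrow> 'a) set" where
  "core \<equiv> disagreement_core C M f"

lemma sets_shattered_tuples: "0 < r \<Longrightarrow> shattered_tuples C M f k r \<in> sets (tuples k)"
  using shatter_sets target by (auto simp: shatter_sets_measurable_def)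

lemma shattered_tuples_mono: "r \<le> r' \<Longrightarrow> shattered_tuples C M f k r \<subseteq> shattered_tuples C M f k r'"
  by (auto simp: shattered_tuples_def cball_class_def elim!: shatters_mono)

lemma core_eq: "core k = (\<Inter>n::nat. shattered_tuples C M f k (1 / Suc n))"
proof
  show "(\<Inter>n::nat. shattered_tuples C M f k (1 / Suc n)) \<subseteq> core k"
  proof
    fix s assume s: "s \<in> (\<Inter>n::nat. shattered_tuples C M f k (1 / Suc n))"
    have "s \<in> shattered_tuples C M f k r" if "r > 0" for r
    proof -
      obtain n where "1 / Suc n < r" by (rule nat_approx_posE[OF \<open>r > 0\<close>])
      then show ?thesis using s shattered_tuples_mono[of "1 / Suc n" r k] by auto
    qed
    then show "s \<in> core k" by (auto simp: disagreement_core_def)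
  qed
qed (auto simp: disagreement_core_def)

lemma sets_core: "core k \<in> sets (tuples k)"
  unfolding core_eq by (intro sets.countable_INT) (auto intro: sets_shattered_tuples)

lemma tendsto_shattered_tuples:
  "(\<lambda>n. measure (tuples k) (shattered_tuples C M f k (1 / Suc n))) \<longlonglongrightarrow> measure (tuples k) (core k)"
proof -
  interpret K: prob_space "tuples k" by (rule prob_space_tuples)
  show ?thesis
    unfolding core_eq
  proof (rule K.finite_Lim_measure_decseq)
    show "decseq (\<lambda>n. shattered_tuples C M f k (1 / Suc n))"
      by (intro decseq_SucI shattered_tuples_mono) (simp add: frac_le)
  qed (auto intro: sets_shattered_tuples)
qed

text \<open>\<open>h n\<close> errs somewhere on the sample with probability at most
  \<open>i / Suc n\<close>. The event that all of them err is contained in each of these, hence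
  null.\<close>

lemma AE_agree_with_core_witness:
  assumes h: "\<And>n. h n \<in> C" "\<And>n::nat. er M f (h n) \<le> 1 / Suc n"
  shows "AE w in S. \<exists>n. h n \<in> version C i w (\<lambda>j. f (w j))"
proof -
  define A where "A n = {w \<in> space S. h n \<in> version C i w (\<lambda>j. f (w j))}" for n
  have hm[measurable]: "h n \<in> M \<rightarrow>\<^sub>M count_space UNIV" for n by (rule classifier_measurable_UNIV[OF h(1)])
  have A_eq: "A n = {w \<in> space S. \<forall>j\<in>{..<i}. h n (w j) = f (w j)}" for n
    using h(1) by (auto simp: A_def version_def)
  have A[measurable]: "A n \<in> sets S" for n unfolding A_eq by measurable
  have le: "P.prob (space S - A n) \<le> i / Suc n" for n
  proof -
    let ?D = "{x \<in> space M. h n x \<noteq> f x}"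
    have D[measurable]: "?D \<in> sets M" by measurable
    have "space S - A n \<subseteq> (\<Union>j\<in>{..<i}. (\<lambda>w. w j) -` ?D \<inter> space S)"
      by (auto simp: A_eq space_S)
    then have "P.prob (space S - A n) \<le> P.prob (\<Union>j\<in>{..<i}. (\<lambda>w. w j) -` ?D \<inter> space S)"
      by (intro P.finite_measure_mono) auto
    also have "\<dots> \<le> (\<Sum>j<i. P.prob ((\<lambda>w. w j) -` ?D \<inter> space S))"
      by (intro P.finite_measure_subadditive_finite) auto
    also have "\<dots> = (\<Sum>j<i. er M f (h n))"
    proof (intro sum.cong refl)
      fix j
      have "P.prob ((\<lambda>w. w j) -` ?D \<inter> space S) = measure (distr S M (\<lambda>w. w j)) ?D"
        by (subst measure_distr) auto
      then show "P.prob ((\<lambda>w. w j) -` ?D \<inter> space S) = er M f (h n)"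
        by (simp add: PiM_component er_def)
    qed
    also have "\<dots> \<le> i * (1 / Suc n)" using mult_left_mono[OF h(2)[of n], of "real i"] by (simp del: of_nat_Suc)
    finally show ?thesis by simp
  qed
  have "P.prob (\<Inter>n. space S - A n) \<le> i / Suc n" for n
    by (rule order_trans[OF P.finite_measure_mono le]) auto
  then have "P.prob (\<Inter>n. space S - A n) \<le> 0"
    by (intro LIMSEQ_le_const[OF LIMSEQ_Suc[OF lim_const_over_n, of "real i"]]) auto
  then have "P.prob (\<Inter>n. space S - A n) = 0"
    by (simp add: measure_le_0_iff)
  then have "AE w in S. w \<notin> (\<Inter>n. space S - A n)"
    by (subst AE_iff_null_sets[symmetric]) (auto simp: null_sets_def P.emeasure_eq_measure)
  then show ?thesis
    by (rule AE_mp) (auto intro!: AE_I2 simp: A_def)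
qed

text \<open>Each of the finitely many labelings of \<open>s\<close> is realized by concepts
  arbitrarily close to \<open>f\<close>, and almost surely one of them agrees with \<open>f\<close>
  on the sample.\<close>

lemma AE_shatters_core_tuple:
  assumes s: "s \<in> core k"
  shows "AE w in S. shatters (version C i w (\<lambda>j. f (w j))) k s"
proof -
  have "AE w in S. \<exists>h\<in>version C i w (\<lambda>j. f (w j)). \<forall>l<k. h (s l) = y l" if y: "y \<in> {..<k} \<rightarrow>\<^sub>E {-1, 1}" for y
  proof -
    have "\<exists>h. h \<in> C \<and> er M f h \<le> 1 / Suc n \<and> (\<forall>l<k. h (s l) = y l)" for n
    proof -
      have "s \<in> shattered_tuples C M f k (1 / Suc n)" using s unfolding core_eq by blast
      then have "shatters (cball_class C M f (1 / Suc n)) k s" by (simp add: shattered_tuples_def)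
      then show ?thesis using y unfolding shatters_iff_PiE cball_class_def by blast
    qed
    then obtain h where "\<And>n. h n \<in> C" "\<And>n. er M f (h n) \<le> 1 / Suc n" "\<And>n. \<forall>l<k. h n (s l) = y l"
      by metis
    then show ?thesis
      by (intro eventually_mono[OF AE_agree_with_core_witness[of h i]]) blast+
  qed
  then have "AE w in S. \<forall>y\<in>{..<k} \<rightarrow>\<^sub>E {-1, 1}. \<exists>h\<in>version C i w (\<lambda>j. f (w j)). \<forall>l<k. h (s l) = y l"
    by (intro AE_finite_allI finite_PiE) auto
  then show ?thesis unfolding shatters_iff_PiE .
qed

text \<open>Fubini exchanges the quantifiers: for almost every sample, almost every tuple of the
  core is shattered by the version space.\<close>

lemma AE_core_le_shatter_prob:
  "AE w in S. measure (tuples k) (core k) \<le> shatter_prob M k (version C i w (\<lambda>j. f (w j)))"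
proof -
  interpret K: prob_space "tuples k" by (rule prob_space_tuples)
  interpret KS: pair_sigma_finite "tuples k" S
    by (simp add: pair_sigma_finite_def K.sigma_finite_measure_axioms P.sigma_finite_measure_axioms)
  note pred[measurable] = pred_shatters_pair[OF measurable_coordinate measurable_truth, where i = i and k = k]
  have "AE s in tuples k. AE w in S. s \<in> core k \<longrightarrow> shatters (version C i w (\<lambda>j. f (w j))) k s"
  proof (rule AE_I2)
    fix s
    show "AE w in S. s \<in> core k \<longrightarrow> shatters (version C i w (\<lambda>j. f (w j))) k s"
      using AE_shatters_core_tuple[of s k i] by (cases "s \<in> core k") auto
  qed
  moreover have "Measurable.pred (tuples k \<Otimes>\<^sub>M S) (\<lambda>(s, w). s \<in> core k \<longrightarrow> shatters (version C i w (\<lambda>j. f (w j))) k s)"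
  proof -
    have [measurable]: "Measurable.pred (tuples k \<Otimes>\<^sub>M S) (\<lambda>v. shatters (version C i (snd v) (\<lambda>j. f (snd v j))) k (fst v))"
      using measurable_compose[OF measurable_pair_swap' pred] by (simp add: split_beta')
    have [measurable]: "core k \<in> sets (tuples k)" by (rule sets_core)
    show ?thesis by (simp add: split_beta')
  qed
  ultimately have "AE w in S. AE s in tuples k. s \<in> core k \<longrightarrow> shatters (version C i w (\<lambda>j. f (w j))) k s"
    by (subst (asm) KS.AE_commute) (simp_all add: pred_def split_beta')
  then show ?thesis
  proof (rule AE_mp, intro AE_I2 impI)
    fix w assume w: "w \<in> space S"
      and ae: "AE s in tuples k. s \<in> core k \<longrightarrow> shatters (version C i w (\<lambda>j. f (w j))) k s"
    show "measure (tuples k) (core k) \<le> shatter_prob M k (version C i w (\<lambda>j. f (w j)))"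
      unfolding shatter_prob_def
    proof (rule K.finite_measure_mono_AE)
      show "AE s in tuples k. s \<in> core k \<longrightarrow> s \<in> {s \<in> space (tuples k). shatters (version C i w (\<lambda>j. f (w j))) k s}"
        using ae by (rule AE_mp) (auto intro!: AE_I2)
      show "{s \<in> space (tuples k). shatters (version C i w (\<lambda>j. f (w j))) k s} \<in> sets (tuples k)"
        using pred_shatters_fixed[of i w] space_S[OF w] by (simp add: pred_def)
    qed
  qed
qed

section \<open>Correctness of inferred labels\<close>

abbreviation truth_space :: "nat \<Rightarrow> (nat \<Rightarrow> 'a) \<Rightarrow> ('a \<Rightarrow> int) set" where
  "truth_space i w \<equiv> version C i w (\<lambda>j. f (w j))"

text \<open>The points on which \<open>decide\<close> abstains when the least order it finds is
  \<open>k + 1\<close>.\<close>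

definition region :: "nat \<Rightarrow> ('a \<Rightarrow> int) set \<Rightarrow> 'a set" where
  "region k V = {x \<in> space M. shatter_prob M k V / 2 \<le> shatter_prob M k {h\<in>V. h x = -1} \<and>
     shatter_prob M k V / 2 \<le> shatter_prob M k {h\<in>V. h x = 1}}"

lemma restrict_version_eq:
  "{h \<in> version C i X l. h x = y} =
    version C (Suc i) (\<lambda>j. if j = i then x else X j) (\<lambda>j. if j = i then y else l j)"
  unfolding version_Suc_upd[symmetric] by (rule version_cong) auto

lemma borel_measurable_shatter_prob_restrict:
  assumes X: "\<And>j. j < i \<Longrightarrow> X j \<in> N \<rightarrow>\<^sub>M M" and x: "x \<in> N \<rightarrow>\<^sub>M M"
    and l: "\<And>j. j < i \<Longrightarrow> l j \<in> N \<rightarrow>\<^sub>M count_space UNIV" and y: "y \<in> N \<rightarrow>\<^sub>M count_space UNIV"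
  shows "(\<lambda>v. shatter_prob M k {h \<in> version C i (\<lambda>j. X j v) (\<lambda>j. l j v). h (x v) = y v}) \<in> borel_measurable N"
proof -
  have "(\<lambda>v. shatter_prob M k (version C (Suc i) (\<lambda>j. (if j = i then x else X j) v) (\<lambda>j. (if j = i then y else l j) v)))
      \<in> borel_measurable N"
    by (rule borel_measurable_shatter_prob) (use assms in auto)
  then show ?thesis unfolding restrict_version_eq by (simp add: if_distribR)
qed

lemma borel_measurable_shatter_freq_restrict:
  assumes w: "w \<in> N \<rightarrow>\<^sub>M S"
    and X: "\<And>j. j < i \<Longrightarrow> X j \<in> N \<rightarrow>\<^sub>M M" and x: "x \<in> N \<rightarrow>\<^sub>M M"
    and l: "\<And>j. j < i \<Longrightarrow> l j \<in> N \<rightarrow>\<^sub>M count_space UNIV" and y: "y \<in> N \<rightarrow>\<^sub>M count_space UNIV"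
  shows "(\<lambda>v. shatter_freq (w v) k {h \<in> version C i (\<lambda>j. X j v) (\<lambda>j. l j v). h (x v) = y v}) \<in> borel_measurable N"
proof -
  have "(\<lambda>v. shatter_freq (w v) k (version C (Suc i) (\<lambda>j. (if j = i then x else X j) v) (\<lambda>j. (if j = i then y else l j) v)))
      \<in> borel_measurable N"
    by (rule measurable_shatter_freq[OF w]) (use assms in auto)
  then show ?thesis unfolding restrict_version_eq by (simp add: if_distribR)
qed

lemma pred_shatters_restrict_fixed:
  assumes "\<And>j. j < i \<Longrightarrow> X j \<in> space M" "x \<in> space M"
  shows "{s \<in> space (tuples k). shatters {h \<in> version C i X l. h x = y} k s} \<in> sets (tuples k)"
  using pred_shatters_fixed[where i = "Suc i" and X = "\<lambda>j. if j = i then x else X j" and k = k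
      and l = "\<lambda>j. if j = i then y else l j"] assms
  unfolding restrict_version_eq pred_def by auto

lemma AE_core_le_all:
  "AE w in S. \<forall>i k. measure (tuples k) (core k) \<le> shatter_prob M k (truth_space i w)"
  by (simp add: AE_all_countable AE_core_le_shatter_prob)

text \<open>With sample point \<open>i\<close> in place of \<open>x\<close>, the half that agrees
  with \<open>f\<close> is the next version space, for which the bound is known. That point is then
  exchanged for an independent \<open>x\<close>.\<close>

lemma AE_core_le_point:
  "AE w in S. \<forall>i. AE x in M. \<forall>k. measure (tuples k) (core k) \<le> shatter_prob M k {h \<in> truth_space i w. h x = f x}"
proof -
  have "AE w in S. AE x in M. \<forall>k. measure (tuples k) (core k) \<le> shatter_prob M k {h \<in> truth_space i w. h x = f x}" for i
  proof (subst AE_coordinate[symmetric, where i = i and Q = "\<lambda>x w. \<forall>k. measure (tuples k) (core k) \<le> shatter_prob M k {h \<in> truth_space i w. h x = f x}"])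
    have [measurable]: "(\<lambda>v. shatter_prob M k {h \<in> version C i (\<lambda>j. snd v j) (\<lambda>j. f (snd v j)). h (fst v) = f (fst v)})
        \<in> borel_measurable (M \<Otimes>\<^sub>M S)" for k
      by (rule borel_measurable_shatter_prob_restrict) measurable
    show "Measurable.pred (M \<Otimes>\<^sub>M S) (\<lambda>(x, w). \<forall>k. measure (tuples k) (core k) \<le> shatter_prob M k {h \<in> truth_space i w. h x = f x})"
      by (simp add: split_beta')
    show "(\<forall>k. measure (tuples k) (core k) \<le> shatter_prob M k {h \<in> truth_space i (w(i := y)). h x = f x}) \<longleftrightarrow>
        (\<forall>k. measure (tuples k) (core k) \<le> shatter_prob M k {h \<in> truth_space i w. h x = f x})" for x y w
    proof -
      have "truth_space i (w(i := y)) = truth_space i w" by (rule version_cong) auto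
      then show ?thesis by simp
    qed
    have "{h \<in> truth_space i w. h (w i) = f (w i)} = truth_space (Suc i) w" for w
      by (auto simp: version_def less_Suc_eq)
    then show "AE w in S. \<forall>k. measure (tuples k) (core k) \<le> shatter_prob M k {h \<in> truth_space i w. h (w i) = f (w i)}"
      using AE_core_le_all by (auto elim!: eventually_mono)
  qed
  then show ?thesis by (simp add: AE_all_countable)
qed

lemma AE_shatter_freq_truth_space:
  "AE w in S. \<forall>i\<le>N. \<forall>k. shatter_freq (\<lambda>j. w (j + Suc N)) k (truth_space i w) = shatter_prob M k (truth_space i w)"
proof -
  have "AE w in S. shatter_freq (\<lambda>j. w (j + Suc N)) k (truth_space i w) = shatter_prob M k (truth_space i w)"
    if "i \<le> N" for i k
    by (rule AE_shatter_freq[where l = "\<lambda>j w. f (w j)"]) (use that in auto)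
  then show ?thesis
    by (auto simp: AE_all_countable intro!: AE_impI)
qed

lemma AE_shatter_freq_next:
  "AE w in S. \<forall>i\<le>N. \<forall>k y. shatter_freq (\<lambda>j. w (j + Suc N)) k {h \<in> truth_space i w. h (w i) = y} =
    shatter_prob M k {h \<in> truth_space i w. h (w i) = y}"
proof -
  have "AE w in S. shatter_freq (\<lambda>j. w (j + Suc N)) k {h \<in> truth_space i w. h (w i) = y} =
    shatter_prob M k {h \<in> truth_space i w. h (w i) = y}" if "i \<le> N" for i k y
  proof -
    have "AE w in S. shatter_freq (\<lambda>j. w (j + Suc N)) k (version C (Suc i) w (\<lambda>j. if j = i then y else f (w j))) =
        shatter_prob M k (version C (Suc i) w (\<lambda>j. if j = i then y else f (w j)))"
      by (rule AE_shatter_freq[where l = "\<lambda>j w. if j = i then y else f (w j)"]) (use that in auto)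
    moreover have "{h \<in> truth_space i w. h (w i) = y} = version C (Suc i) w (\<lambda>j. if j = i then y else f (w j))" for w
      by (auto simp: version_def less_Suc_eq)
    ultimately show ?thesis by simp
  qed
  then show ?thesis
    by (auto simp: AE_all_countable intro!: AE_impI)
qed

text \<open>Index \<open>N\<close> enters neither the version space nor the frequencies, which start
  at \<open>Suc N\<close>, so it can be traded for an independent test point.\<close>

lemma AE_shatter_freq_point:
  "AE w in S. AE x in M. \<forall>k y. shatter_freq (\<lambda>j. w (j + Suc N)) k {h \<in> truth_space N w. h x = y} =
    shatter_prob M k {h \<in> truth_space N w. h x = y}"
proof (subst AE_coordinate[symmetric, where i = N and Q = "\<lambda>x w. \<forall>k y. shatter_freq (\<lambda>j. w (j + Suc N)) k {h \<in> truth_space N w. h x = y} =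
    shatter_prob M k {h \<in> truth_space N w. h x = y}"])
  have [measurable]: "(\<lambda>v. shatter_prob M k {h \<in> version C N (\<lambda>j. snd v j) (\<lambda>j. f (snd v j)). h (fst v) = y})
      \<in> borel_measurable (M \<Otimes>\<^sub>M S)" for k y
    by (rule borel_measurable_shatter_prob_restrict) measurable
  have [measurable]: "(\<lambda>v j. snd v (j + Suc N)) \<in> M \<Otimes>\<^sub>M S \<rightarrow>\<^sub>M S"
    by (rule measurable_PiM_single') (auto simp: space_pair_measure space_PiM)
  have [measurable]: "(\<lambda>v. shatter_freq (\<lambda>j. snd v (j + Suc N)) k {h \<in> version C N (\<lambda>j. snd v j) (\<lambda>j. f (snd v j)). h (fst v) = y})
      \<in> borel_measurable (M \<Otimes>\<^sub>M S)" for k y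
    by (rule borel_measurable_shatter_freq_restrict) measurable
  show "Measurable.pred (M \<Otimes>\<^sub>M S) (\<lambda>(x, w). \<forall>k y. shatter_freq (\<lambda>j. w (j + Suc N)) k {h \<in> truth_space N w. h x = y} =
      shatter_prob M k {h \<in> truth_space N w. h x = y})"
    by (simp only: split_beta') measurable
  show "(\<forall>k y. shatter_freq (\<lambda>j. (w(N := y')) (j + Suc N)) k {h \<in> truth_space N (w(N := y')). h x = y} =
      shatter_prob M k {h \<in> truth_space N (w(N := y')). h x = y}) \<longleftrightarrow>
      (\<forall>k y. shatter_freq (\<lambda>j. w (j + Suc N)) k {h \<in> truth_space N w. h x = y} =
      shatter_prob M k {h \<in> truth_space N w. h x = y})" for x y' w
  proof -
    have "truth_space N (w(N := y')) = truth_space N w" by (rule version_cong) auto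
    then show ?thesis by simp
  qed
  show "AE w in S. \<forall>k y. shatter_freq (\<lambda>j. w (j + Suc N)) k {h \<in> truth_space N w. h (w N) = y} =
      shatter_prob M k {h \<in> truth_space N w. h (w N) = y}"
    using AE_shatter_freq_next[of N] by (auto elim!: eventually_mono)
qed

text \<open>The least order is \<open>Suc k0\<close>, so \<open>decide\<close> compares halves at
  order \<open>k0\<close>. The half with the true label has probability at least \<open>c\<close>,
  strictly above the threshold, so only the wrong half can be discarded.\<close>

lemma decide_correct:
  assumes "\<And>k. \<phi> k V = shatter_prob M k V"
    and "\<And>k y. \<phi> k {h\<in>V. h x = y} = shatter_prob M k {h\<in>V. h x = y}"
    and below: "\<And>k. k < Suc k0 \<Longrightarrow> \<tau> < shatter_prob M k V" and "shatter_prob M (Suc k0) V \<le> \<tau>"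
    and c: "shatter_prob M k0 V < 2 * c" "c \<le> shatter_prob M k0 {h\<in>V. h x = f x}"
    and x: "x \<in> space M"
  shows "decide \<tau> \<phi> V x = (if x \<in> region k0 V then None else Some (f x))"
proof -
  have "(LEAST k. \<phi> k V \<le> \<tau>) = Suc k0"
    using assms(1,4) below by (intro Least_equality) (auto simp: not_less[symmetric])
  moreover have "f x = -1 \<or> f x = 1" using classifier_values[OF target x] by auto
  ultimately show ?thesis
    using assms(1,2) c x by (auto simp: decide_def Let_def region_def)
qed

lemma shatters_Suc:
  assumes "shatters {h\<in>V. h x = -1} k s" "shatters {h\<in>V. h x = 1} k s"
  shows "shatters V (Suc k) (s(k := x))"
  unfolding shatters_def
proof
  fix y :: "nat \<Rightarrow> int" assume y: "y \<in> {..<Suc k} \<rightarrow> {-1, 1}"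
  then have "y k = -1 \<or> y k = 1" "y \<in> {..<k} \<rightarrow> {-1, 1}" by auto
  then have "\<exists>h\<in>{h\<in>V. h x = y k}. \<forall>i<k. h (s i) = y i"
    using assms unfolding shatters_def by auto
  then obtain h where "h \<in> V" "h x = y k" "\<And>i. i < k \<Longrightarrow> h (s i) = y i" by blast
  then show "\<exists>h\<in>V. \<forall>i<Suc k. h ((s(k := x)) i) = y i"
    by (intro bexI[of _ h]) (auto simp: less_Suc_eq)
qed

lemma sets_region:
  assumes X: "\<And>j. j < i \<Longrightarrow> X j \<in> space M"
  shows "region k (version C i X l) \<in> sets M"
proof -
  have [measurable]: "(\<lambda>x. shatter_prob M k {h \<in> version C i X l. h x = y}) \<in> borel_measurable M" for y
    by (rule borel_measurable_shatter_prob_restrict[where X = "\<lambda>j _. X j" and x = "\<lambda>x. x"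
          and l = "\<lambda>j _. l j" and y = "\<lambda>_. y"]) (use X in auto)
  show ?thesis unfolding region_def by measurable
qed

text \<open>Inclusion-exclusion: one half has probability at least \<open>c\<close>, the other at
  least half that of \<open>V\<close>, and their union at most that of \<open>V\<close>. The
  intersection keeps at least \<open>c\<close> minus half of \<open>3 / 2 * c\<close>.\<close>

lemma prob_both_shatter_ge:
  assumes X: "\<And>j. j < i \<Longrightarrow> X j \<in> space M" and V: "V = version C i X l"
    and s: "shatter_prob M k V \<le> 3 / 2 * c" and fx: "c \<le> shatter_prob M k {h\<in>V. h x = f x}"
    and x: "x \<in> region k V"
  shows "c / 4 \<le> measure (tuples k) {s \<in> space (tuples k). shatters {h\<in>V. h x = -1} k s \<and> shatters {h\<in>V. h x = 1} k s}"
proof -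
  interpret K: prob_space "tuples k" by (rule prob_space_tuples)
  have xM: "x \<in> space M" using x by (simp add: region_def)
  define A where "A y = {s \<in> space (tuples k). shatters {h\<in>V. h x = y} k s}" for y
  have A: "A y \<in> sets (tuples k)" for y
    unfolding A_def V by (rule pred_shatters_restrict_fixed[OF X xM])
  have "f x = -1 \<or> f x = 1" using classifier_values[OF target xM] by auto
  then have "c + shatter_prob M k V / 2 \<le> measure (tuples k) (A (-1)) + measure (tuples k) (A 1)"
    using fx x by (auto simp: region_def A_def shatter_prob_def)
  also have "\<dots> = measure (tuples k) (A (-1) \<union> A 1) + measure (tuples k) (A (-1) \<inter> A 1)"
    using measure_Un3[of "A (-1)" "tuples k" "A 1"] A by (simp add: fmeasurable_def K.emeasure_finite less_top[symmetric])
  also have "measure (tuples k) (A (-1) \<union> A 1) \<le> shatter_prob M k V"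
    unfolding shatter_prob_def
  proof (rule K.finite_measure_mono)
    show "A (-1) \<union> A 1 \<subseteq> {s \<in> space (tuples k). shatters V k s}"
      by (auto simp: A_def elim!: shatters_mono)
    show "{s \<in> space (tuples k). shatters V k s} \<in> sets (tuples k)"
      unfolding V using pred_shatters_fixed[OF X] by (simp add: pred_def)
  qed
  finally have "c / 4 \<le> measure (tuples k) (A (-1) \<inter> A 1)" using s by simp
  also have "A (-1) \<inter> A 1 = {s \<in> space (tuples k). shatters {h\<in>V. h x = -1} k s \<and> shatters {h\<in>V. h x = 1} k s}"
    by (auto simp: A_def)
  finally show ?thesis .
qed

text \<open>If both halves at \<open>x\<close> shatter \<open>s\<close>, then \<open>V\<close>
  shatters \<open>s\<close> extended by \<open>x\<close>. Each \<open>x\<close> in the region thus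
  extends a fraction at least \<open>c / 4\<close> of all \<open>k\<close>-tuples to shattered ones;
  integrate over \<open>x\<close>.\<close>

lemma prob_region_le:
  assumes X: "\<And>j. j < i \<Longrightarrow> X j \<in> space M" and V: "V = version C i X l"
    and s: "shatter_prob M k V \<le> 3 / 2 * c" and c: "0 \<le> c"
    and fx: "AE x in M. c \<le> shatter_prob M k {h\<in>V. h x = f x}"
  shows "M.prob (region k V) * (c / 4) \<le> shatter_prob M (Suc k) V"
proof -
  interpret K: prob_space "tuples k" by (rule prob_space_tuples)
  interpret K': prob_space "tuples (Suc k)" by (rule prob_space_tuples)
  interpret product_sigma_finite "\<lambda>_::nat. M"
    by (simp add: product_sigma_finite_def M.sigma_finite_measure_axioms)
  let ?A = "{s \<in> space (tuples (Suc k)). shatters V (Suc k) s}"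
  have A: "?A \<in> sets (tuples (Suc k))"
    unfolding V using pred_shatters_fixed[OF X] by (simp add: pred_def)
  have region[measurable]: "region k V \<in> sets M" unfolding V by (rule sets_region[OF X])
  have "ennreal (M.prob (region k V) * (c / 4)) = ennreal (c / 4) * emeasure M (region k V)"
    using c by (simp add: M.emeasure_eq_measure ennreal_mult[symmetric] mult.commute)
  also have "\<dots> = (\<integral>\<^sup>+x. ennreal (c / 4) * indicator (region k V) x \<partial>M)"
    by (rule nn_integral_cmult_indicator[symmetric]) (rule region)
  also have "\<dots> \<le> (\<integral>\<^sup>+x. (\<integral>\<^sup>+s. indicator ?A (s(k := x)) \<partial>tuples k) \<partial>M)"
  proof (rule nn_integral_mono_AE, rule AE_mp[OF fx], rule AE_I2, rule impI)
    fix x assume x: "x \<in> space M" and cx: "c \<le> shatter_prob M k {h\<in>V. h x = f x}"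
    let ?B = "{s \<in> space (tuples k). shatters {h\<in>V. h x = -1} k s \<and> shatters {h\<in>V. h x = 1} k s}"
    show "ennreal (c / 4) * indicator (region k V) x \<le> (\<integral>\<^sup>+s. indicator ?A (s(k := x)) \<partial>tuples k)"
    proof (cases "x \<in> region k V")
      case True
      have B: "?B \<in> sets (tuples k)"
      proof -
        have "?B = {s \<in> space (tuples k). shatters {h\<in>V. h x = -1} k s} \<inter> {s \<in> space (tuples k). shatters {h\<in>V. h x = 1} k s}"
          by blast
        also have "\<dots> \<in> sets (tuples k)"
          unfolding V by (intro sets.Int pred_shatters_restrict_fixed[OF X x])
        finally show ?thesis .
      qed
      have "ennreal (c / 4) \<le> emeasure (tuples k) ?B"
        unfolding K.emeasure_eq_measure by (intro ennreal_leI prob_both_shatter_ge[OF X V s cx True])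
      also have "\<dots> = (\<integral>\<^sup>+s. indicator ?B s \<partial>tuples k)" using B by simp
      also have "\<dots> \<le> (\<integral>\<^sup>+s. indicator ?A (s(k := x)) \<partial>tuples k)"
      proof (intro nn_integral_mono)
        fix s assume "s \<in> space (tuples k)"
        then have "s(k := x) \<in> space (tuples (Suc k))"
          using x by (simp add: space_PiM lessThan_Suc PiE_fun_upd)
        then show "indicator ?B s \<le> (indicator ?A (s(k := x)) :: ennreal)"
          using shatters_Suc[of V x k s] by (simp add: indicator_def)
      qed
      finally show ?thesis using True by simp
    qed simp
  qed
  also have "\<dots> = (\<integral>\<^sup>+s. indicator ?A s \<partial>Pi\<^sub>M (insert k {..<k}) (\<lambda>_. M))"
    using A by (subst product_nn_integral_insert_rev) (auto simp: lessThan_Suc)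
  also have "\<dots> = emeasure (tuples (Suc k)) ?A"
    using A by (simp add: lessThan_Suc)
  also have "\<dots> = ennreal (shatter_prob M (Suc k) V)"
    by (simp add: K'.emeasure_eq_measure shatter_prob_def)
  finally show ?thesis by (simp add: shatter_prob_def)
qed

end

section \<open>Error and number of requests\<close>

text \<open>Each dyadic block contributes at most 1; the term at \<open>i = 0\<close> is zero
  because \<open>1 / 0 = 0\<close>.\<close>

lemma sum_inverse_le: "(\<Sum>i<2 ^ t. 1 / real i) \<le> t"
proof (induction t)
  case (Suc t)
  have "(\<Sum>i<2 ^ Suc t. 1 / real i) = (\<Sum>i<2 ^ t. 1 / real i) + (\<Sum>i\<in>{2 ^ t..<2 ^ Suc t}. 1 / real i)"
    by (subst sum.union_disjoint[symmetric]) (auto simp: ivl_disj_un)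
  also have "(\<Sum>i\<in>{2 ^ t..<2 ^ Suc t}. 1 / real i) \<le> (\<Sum>i\<in>{2 ^ t..<2 ^ Suc t :: nat}. 1 / 2 ^ t)"
  proof (intro sum_mono)
    fix i :: nat assume "i \<in> {2 ^ t..<2 ^ Suc t}"
    then have "real (2 ^ t) \<le> real i" by (simp only: of_nat_le_iff atLeastLessThan_iff)
    then show "1 / real i \<le> 1 / 2 ^ t" by (intro frac_le) auto
  qed
  also have "\<dots> = 1" by simp
  finally show ?case using Suc by simp
qed simp

text \<open>\<open>Suc k0\<close> stands for the critical order \<open>d_tilde\<close>.
  \<open>\<delta>\<close> keeps all lower orders visibly shattered, and within radius
  \<open>r0\<close> order \<open>k0\<close> is shattered little more often than on its core.\<close>

locale bounded_learning = margin_learning +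
  fixes k0 :: nat and \<theta> c \<delta> r0 :: real
  assumes theta: "\<And>r. 0 < r \<Longrightarrow> measure (tuples (Suc k0)) (shattered_tuples C M f (Suc k0) r) \<le> \<theta> * r"
    and c_def: "c = measure (tuples k0) (core k0)"
    and \<delta>: "0 < \<delta>" "\<And>k. k < Suc k0 \<Longrightarrow> \<delta> \<le> measure (tuples k) (core k)"
    and r0: "0 < r0" "measure (tuples k0) (shattered_tuples C M f k0 r0) \<le> 3 / 2 * c"
begin

lemma c_pos: "0 < c"
  using \<delta>(1) \<delta>(2)[of k0] by (simp add: c_def)

lemma \<theta>_nonneg: "0 \<le> \<theta>"
  using order_trans[OF measure_nonneg theta[of 1]] by simp

lemma shatter_prob_le_ball:
  assumes w: "w \<in> space S" and r: "0 < r" and V: "\<And>h. h \<in> truth_space i w \<Longrightarrow> er M f h \<le> r"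
  shows "shatter_prob M k (truth_space i w) \<le> measure (tuples k) (shattered_tuples C M f k r)"
proof -
  interpret K: prob_space "tuples k" by (rule prob_space_tuples)
  have "truth_space i w \<subseteq> cball_class C M f r"
    using V by (auto simp: cball_class_def version_def)
  then show ?thesis
    unfolding shatter_prob_def
    by (intro K.finite_measure_mono sets_shattered_tuples r)
       (auto simp: shattered_tuples_def elim!: shatters_mono)
qed

text \<open>After \<open>t ^ 4\<close> points the radius is at most \<open>4 / t^2\<close>, hence
  below \<open>r0\<close>. The condition on \<open>\<theta>\<close> then pushes order
  \<open>k0 + 1\<close> below the threshold \<open>1 / t\<close>, the one on \<open>\<delta>\<close>
  keeps lower orders above it, and the last one makes the final sample size \<open>2 ^ t\<close>
  admissible.\<close>

definition large :: "nat \<Rightarrow> bool" where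
  "large t \<longleftrightarrow> 1 \<le> t \<and> 4 / t\<^sup>2 \<le> r0 \<and> 4 * \<theta> \<le> t \<and> 1 / t < \<delta> \<and> t ^ 4 \<le> 2 ^ t"

definition core_sequence :: "(nat \<Rightarrow> 'a) \<Rightarrow> bool" where
  "core_sequence w \<longleftrightarrow> (\<forall>i k. measure (tuples k) (core k) \<le> shatter_prob M k (truth_space i w)) \<and>
     (\<forall>i. AE x in M. \<forall>k. measure (tuples k) (core k) \<le> shatter_prob M k {h \<in> truth_space i w. h x = f x})"

definition exact_frequencies :: "nat \<Rightarrow> (nat \<Rightarrow> 'a) \<Rightarrow> bool" where
  "exact_frequencies N w \<longleftrightarrow>
     (\<forall>i\<le>N. \<forall>k. shatter_freq (\<lambda>j. w (j + Suc N)) k (truth_space i w) = shatter_prob M k (truth_space i w)) \<and>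
     (\<forall>i\<le>N. \<forall>k y. shatter_freq (\<lambda>j. w (j + Suc N)) k {h \<in> truth_space i w. h (w i) = y} =
        shatter_prob M k {h \<in> truth_space i w. h (w i) = y}) \<and>
     (AE x in M. \<forall>k y. shatter_freq (\<lambda>j. w (j + Suc N)) k {h \<in> truth_space N w. h x = y} =
        shatter_prob M k {h \<in> truth_space N w. h x = y})"

text \<open>The conclusion of \<open>epsilon_net\<close> with \<open>m = t^2\<close>, a choice whose
  failure probability survives a union bound over \<open>2 ^ t\<close> sample sizes.\<close>

definition shrinking :: "nat \<Rightarrow> (nat \<Rightarrow> 'a) \<Rightarrow> bool" where
  "shrinking t w \<longleftrightarrow> (\<forall>i\<in>{1..2 ^ t}. \<forall>h\<in>truth_space i w. er M f h * i \<le> 4 * t\<^sup>2)"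

text \<open>The factor \<open>4 / c\<close> from \<open>prob_region_le\<close>, times
  \<open>\<theta>\<close>, times the radius \<open>4 * t^2 / i\<close>.\<close>

definition request_bound :: "nat \<Rightarrow> nat \<Rightarrow> real" where
  "request_bound t i = 16 * \<theta> / c * t\<^sup>2 / i"

lemma request_bound_nonneg: "0 \<le> request_bound t i"
  using \<theta>_nonneg c_pos by (simp add: request_bound_def)

text \<open>The last conjunct caps the probability of a request given the past, so the moment bound
  holds without conditioning on the good event, where the cap is automatic.\<close>

definition late_request :: "nat \<Rightarrow> nat \<Rightarrow> 'a \<Rightarrow> (nat \<Rightarrow> 'a) \<Rightarrow> bool" where
  "late_request t i x w \<longleftrightarrow> t ^ 4 \<le> i \<and> x \<in> region k0 (truth_space i w) \<and>
     M.prob (region k0 (truth_space i w)) \<le> request_bound t i"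

definition few_requests :: "nat \<Rightarrow> (nat \<Rightarrow> 'a) \<Rightarrow> bool" where
  "few_requests t w \<longleftrightarrow> card {i. i < 2 ^ t \<and> late_request t i (w i) w} < t ^ 5 - t ^ 4"

lemma AE_core_sequence: "AE w in S. core_sequence w"
  unfolding core_sequence_def using AE_core_le_all AE_core_le_point by eventually_elim simp

lemma AE_exact_frequencies: "AE w in S. exact_frequencies N w"
  unfolding exact_frequencies_def
  using AE_shatter_freq_truth_space AE_shatter_freq_next AE_shatter_freq_point by eventually_elim simp

text \<open>The version space lies in the ball of radius \<open>4 * t^2 / i\<close>, at most
  \<open>4 / t^2\<close> since \<open>i \<ge> t ^ 4\<close>. Upper bounds come from this ball, lower
  bounds from the core.\<close>

lemma narrow:
  assumes t: "large t" and w: "w \<in> space S" "core_sequence w" "shrinking t w"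
    and i: "t ^ 4 \<le> i" "i \<le> 2 ^ t"
  shows "\<And>k. k < Suc k0 \<Longrightarrow> 1 / t < shatter_prob M k (truth_space i w)"
    and "shatter_prob M (Suc k0) (truth_space i w) \<le> \<theta> * (4 * (real t)\<^sup>2 / real i)"
    and "shatter_prob M (Suc k0) (truth_space i w) \<le> 1 / t"
    and "shatter_prob M k0 (truth_space i w) \<le> 3 / 2 * c"
proof -
  have t1: "1 \<le> t" using t by (simp add: large_def)
  have i1: "1 \<le> i" using t1 i(1) by (meson one_le_power order_trans)
  define r where "r = 4 * t\<^sup>2 / real i"
  have r: "0 < r" using t1 i1 by (simp add: r_def)
  have "real t ^ 4 \<le> real i" using i(1) by (metis of_nat_le_iff of_nat_power)
  then have "r \<le> 4 * t\<^sup>2 / real t ^ 4"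
    unfolding r_def using t1 by (intro frac_le) auto
  also have "\<dots> = 4 / t\<^sup>2" using t1 by (simp add: power2_eq_square power4_eq_xxxx)
  finally have r_le: "r \<le> 4 / t\<^sup>2" .
  have V: "er M f h \<le> r" if "h \<in> truth_space i w" for h
    using w(3) that i i1 by (auto simp: shrinking_def r_def le_divide_eq)
  note ball = shatter_prob_le_ball[OF w(1), where i = i]
  show "1 / t < shatter_prob M k (truth_space i w)" if k: "k < Suc k0" for k
  proof -
    have "1 / t < \<delta>" using t by (simp add: large_def)
    also note \<delta>(2)[OF k]
    also have "measure (tuples k) (core k) \<le> shatter_prob M k (truth_space i w)"
      using w(2) by (simp add: core_sequence_def)
    finally show ?thesis .
  qed
  show *: "shatter_prob M (Suc k0) (truth_space i w) \<le> \<theta> * (4 * (real t)\<^sup>2 / real i)"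
    using ball[OF r V, where k = "Suc k0"] theta[OF r] by (simp add: r_def)
  also have "\<dots> \<le> \<theta> * (4 / (real t)\<^sup>2)"
    using r_le \<theta>_nonneg by (intro mult_left_mono) (simp_all add: r_def)
  also have "\<dots> \<le> 1 / t"
    using t t1 by (simp add: large_def power2_eq_square field_simps)
  finally show "shatter_prob M (Suc k0) (truth_space i w) \<le> 1 / t" .
  have "er M f h \<le> r0" if "h \<in> truth_space i w" for h
    using V[OF that] r_le t by (simp add: large_def)
  from ball[OF r0(1) this, where k = k0] r0(2) show "shatter_prob M k0 (truth_space i w) \<le> 3 / 2 * c"
    by simp
qed

lemma prob_region_le_request_bound:
  assumes t: "large t" and w: "w \<in> space S" "core_sequence w" "shrinking t w"
    and i: "t ^ 4 \<le> i" "i \<le> 2 ^ t"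
  shows "M.prob (region k0 (truth_space i w)) \<le> request_bound t i"
proof -
  have "AE x in M. \<forall>k. measure (tuples k) (core k) \<le> shatter_prob M k {h \<in> truth_space i w. h x = f x}"
    using w(2) unfolding core_sequence_def by blast
  then have "AE x in M. c \<le> shatter_prob M k0 {h \<in> truth_space i w. h x = f x}"
    unfolding c_def by (rule eventually_mono) blast
  then have "M.prob (region k0 (truth_space i w)) * (c / 4) \<le> shatter_prob M (Suc k0) (truth_space i w)"
    using narrow(4)[OF assms] c_pos space_S[OF w(1)]
    by (intro prob_region_le[of i w]) auto
  also have "\<dots> \<le> \<theta> * (4 * (real t)\<^sup>2 / real i)" by (rule narrow(2)[OF assms])
  finally have "4 / c * (M.prob (region k0 (truth_space i w)) * (c / 4)) \<le> 4 / c * (\<theta> * (4 * (real t)\<^sup>2 / real i))"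
    using c_pos by (intro mult_left_mono) auto
  then show ?thesis using c_pos by (simp add: request_bound_def mult_ac)
qed

lemma decide_eq:
  assumes t: "large t" and w: "w \<in> space S" "core_sequence w" "shrinking t w"
    and i: "t ^ 4 \<le> i" "i \<le> 2 ^ t"
    and x: "x \<in> space M" "c \<le> shatter_prob M k0 {h \<in> truth_space i w. h x = f x}"
    and \<phi>: "\<And>k. \<phi> k (truth_space i w) = shatter_prob M k (truth_space i w)"
      "\<And>k y. \<phi> k {h\<in>truth_space i w. h x = y} = shatter_prob M k {h\<in>truth_space i w. h x = y}"
  shows "decide (1 / t) \<phi> (truth_space i w) x = (if x \<in> region k0 (truth_space i w) then None else Some (f x))"
  using narrow[OF t w i] c_pos
  by (intro decide_correct[OF \<phi>, where c = c] x) auto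

lemma next_label_truth:
  "next_label C t w (map (\<lambda>i. f (w i)) [0..<i]) =
    (if i < t ^ 4 then None
     else decide (1 / t) (shatter_freq (\<lambda>j. w (j + Suc (2 ^ t)))) (truth_space i w) (w i))"
proof -
  have "version C i w ((!) (map (\<lambda>i. f (w i)) [0..<i])) = truth_space i w"
    by (rule version_cong) auto
  then show ?thesis by (simp add: next_label_def decide_sample_def)
qed

lemma labels_correct:
  assumes t: "large t" "t ^ 5 \<le> n"
    and w: "w \<in> space S" "core_sequence w" "shrinking t w"
    and freq: "exact_frequencies (2 ^ t) w" and few: "few_requests t w"
    and q: "\<And>H. q H = (let L = labels (next_label C t w) H (2 ^ t) in if length L < 2 ^ t then Some (length L) else None)"
  shows "labels (next_label C t w) (interact q (\<lambda>i. f (w i)) n) (2 ^ t) = map (\<lambda>i. f (w i)) [0..<2 ^ t]"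
proof -
  define late where "late = {i. i < 2 ^ t \<and> late_request t i (w i) w}"
  have step: "next_label C t w (map (\<lambda>i. f (w i)) [0..<i]) = (if i < t ^ 4 \<or> i \<in> late then None else Some (f (w i)))"
    if i: "i < 2 ^ t" for i
  proof (cases "i < t ^ 4")
    case False
    then have i': "t ^ 4 \<le> i" "i \<le> 2 ^ t" using i by auto
    have "{h \<in> truth_space i w. h (w i) = f (w i)} = truth_space (Suc i) w"
      by (auto simp: version_def less_Suc_eq)
    then have "c \<le> shatter_prob M k0 {h \<in> truth_space i w. h (w i) = f (w i)}"
      using w(2) by (simp add: core_sequence_def c_def)
    then have "decide (1 / t) (shatter_freq (\<lambda>j. w (j + Suc (2 ^ t)))) (truth_space i w) (w i) =
        (if w i \<in> region k0 (truth_space i w) then None else Some (f (w i)))"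
      using freq i' space_S[OF w(1)] by (intro decide_eq[OF t(1) w i']) (auto simp: exact_frequencies_def)
    then show ?thesis
      using False i i' prob_region_le_request_bound[OF t(1) w i']
      by (auto simp: next_label_truth late_def late_request_def)
  qed (simp add: next_label_truth)
  show ?thesis
  proof (rule labels_interact)
    show "y = f (w i)" if "i < 2 ^ t" "next_label C t w (map (\<lambda>i. f (w i)) [0..<i]) = Some y" for i y
      using that step[OF that(1)] by (simp split: if_splits)
    have "{i. i < 2 ^ t \<and> next_label C t w (map (\<lambda>i. f (w i)) [0..<i]) = None} \<subseteq> {..<t ^ 4} \<union> late"
      using step by (auto split: if_splits)
    then have "card {i. i < 2 ^ t \<and> next_label C t w (map (\<lambda>i. f (w i)) [0..<i]) = None} \<le> card ({..<t ^ 4} \<union> late)"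
      by (intro card_mono) (auto simp: late_def)
    also have "\<dots> \<le> card {..<t ^ 4} + card late" by (rule card_Un_le)
    also have "\<dots> \<le> t ^ 4 + (t ^ 5 - t ^ 4)"
      using few by (simp add: few_requests_def late_def)
    also have "\<dots> = t ^ 5" using t by (simp add: large_def power_increasing)
    finally show "card {i. i < 2 ^ t \<and> next_label C t w (map (\<lambda>i. f (w i)) [0..<i]) = None} \<le> n"
      using t(2) by simp
    show "q H = (let L = labels (next_label C t w) H (2 ^ t) in if length L < 2 ^ t then Some (length L) else None)" for H
      by (rule q)
  qed
qed

text \<open>Up to a null set of test points the classifier errs only where \<open>decide\<close>
  abstains, that is, inside the region.\<close>

lemma er_returned_le:
  assumes t: "large (budget_root n)" "budget_root n ^ 5 \<le> n"
    and w: "w \<in> space S" "core_sequence w" "shrinking (budget_root n) w"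
    and freq: "exact_frequencies (2 ^ budget_root n) w" and few: "few_requests (budget_root n) w"
  shows "er M f (returned (learner C) n f u w) \<le> request_bound (budget_root n) (2 ^ budget_root n)"
proof -
  define t where "t = budget_root n"
  note assms = assms[folded t_def]
  have N: "t ^ 4 \<le> 2 ^ t" "2 ^ t \<le> (2 ^ t :: nat)" using assms(1) by (simp_all add: large_def)
  let ?Y = "map (\<lambda>i. f (w i)) [0..<2 ^ t]"
  have labels: "labels (next_label C t w) (interact (query (learner C) n u w) (\<lambda>i. f (w i)) n) (2 ^ t) = ?Y"
    by (rule labels_correct[OF assms]) (simp add: learner_def t_def Let_def)
  have "version C (2 ^ t) w ((!) ?Y) = truth_space (2 ^ t) w"
    by (rule version_cong) auto
  then have ret: "returned (learner C) n f u w x =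
      (case decide (1 / t) (shatter_freq (\<lambda>j. w (j + Suc (2 ^ t)))) (truth_space (2 ^ t) w) x of Some y \<Rightarrow> y | None \<Rightarrow> 1)" for x
    using labels by (simp add: returned_def learner_def t_def Let_def decide_sample_def)
  have "AE x in M. \<forall>k. measure (tuples k) (core k) \<le> shatter_prob M k {h \<in> truth_space (2 ^ t) w. h x = f x}"
    using assms(4) unfolding core_sequence_def by blast
  then have "AE x in M. c \<le> shatter_prob M k0 {h \<in> truth_space (2 ^ t) w. h x = f x}"
    unfolding c_def by (rule eventually_mono) blast
  moreover have "AE x in M. \<forall>k y. shatter_freq (\<lambda>j. w (j + Suc (2 ^ t))) k {h \<in> truth_space (2 ^ t) w. h x = y} =
        shatter_prob M k {h \<in> truth_space (2 ^ t) w. h x = y}"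
    using assms(6) by (simp add: exact_frequencies_def)
  moreover have "AE x in M. x \<in> space M" by simp
  ultimately have "AE x in M. x \<in> {x \<in> space M. returned (learner C) n f u w x \<noteq> f x} \<longrightarrow>
      x \<in> region k0 (truth_space (2 ^ t) w)"
  proof eventually_elim
    case (elim x)
    have "decide (1 / t) (shatter_freq (\<lambda>j. w (j + Suc (2 ^ t)))) (truth_space (2 ^ t) w) x =
        (if x \<in> region k0 (truth_space (2 ^ t) w) then None else Some (f x))"
      using elim assms(6) by (intro decide_eq[OF assms(1,3,4,5) N]) (auto simp: exact_frequencies_def)
    then show ?case unfolding ret by simp
  qed
  then have "er M f (returned (learner C) n f u w) \<le> M.prob (region k0 (truth_space (2 ^ t) w))"
    unfolding er_def by (intro M.finite_measure_mono_AE sets_region) (auto simp: space_S[OF w(1)])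
  also have "\<dots> \<le> request_bound t (2 ^ t)"
    by (rule prob_region_le_request_bound[OF assms(1,3,4,5) N])
  finally show ?thesis by (simp add: t_def)
qed

text \<open>A union bound over the sample sizes. As in \<open>epsilon_net\<close>, the failure event
  is merely covered by a measurable set.\<close>

lemma prob_not_shrinking:
  assumes "1 \<le> t"
  obtains B where "B \<in> sets S" "P.prob B \<le> (\<Sum>i\<in>{1..2 ^ t::nat}. 2 * (2 * real i + 1) ^ d / 2 ^ t\<^sup>2)"
    "\<And>w. w \<in> space S - B \<Longrightarrow> shrinking t w"
proof -
  have "\<exists>B. B \<in> sets S \<and> P.prob B \<le> 2 * (2 * real i + 1) ^ d / 2 ^ t\<^sup>2 \<and>
      (\<forall>w\<in>space S - B. \<forall>h\<in>truth_space i w. er M f h * i \<le> 4 * t\<^sup>2)" for i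
  proof -
    have "1 \<le> t\<^sup>2" using assms by simp
    from epsilon_net[OF this, of i] show ?thesis by (metis of_nat_power)
  qed
  then obtain B where B: "\<And>i. B i \<in> sets S" "\<And>i. P.prob (B i) \<le> 2 * (2 * real i + 1) ^ d / 2 ^ t\<^sup>2"
      "\<And>i w h. w \<in> space S - B i \<Longrightarrow> h \<in> truth_space i w \<Longrightarrow> er M f h * i \<le> 4 * t\<^sup>2"
    by metis
  show ?thesis
  proof (rule that[of "\<Union>i\<in>{1..2 ^ t}. B i"])
    show "(\<Union>i\<in>{1..2 ^ t}. B i) \<in> sets S" using B(1) by blast
    have "P.prob (\<Union>i\<in>{1..2 ^ t}. B i) \<le> (\<Sum>i\<in>{1..2 ^ t}. P.prob (B i))"
      using B(1) by (intro P.finite_measure_subadditive_finite) auto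
    also have "\<dots> \<le> (\<Sum>i\<in>{1..2 ^ t::nat}. 2 * (2 * real i + 1) ^ d / 2 ^ t\<^sup>2)"
      by (intro sum_mono B(2))
    finally show "P.prob (\<Union>i\<in>{1..2 ^ t}. B i) \<le> (\<Sum>i\<in>{1..2 ^ t::nat}. 2 * (2 * real i + 1) ^ d / 2 ^ t\<^sup>2)" .
    show "shrinking t w" if "w \<in> space S - (\<Union>i\<in>{1..2 ^ t}. B i)" for w
      using that B(3) unfolding shrinking_def by blast
  qed
qed

lemma pred_late_request[measurable]: "Measurable.pred (M \<Otimes>\<^sub>M S) (\<lambda>(x, w). late_request t i x w)"
proof -
  have [measurable]: "(\<lambda>v. shatter_prob M k0 {h \<in> version C i (\<lambda>j. snd v j) (\<lambda>j. f (snd v j)). h (fst v) = y})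
      \<in> borel_measurable (M \<Otimes>\<^sub>M S)" for y
    by (rule borel_measurable_shatter_prob_restrict) measurable
  have [measurable]: "(\<lambda>v. shatter_prob M k0 {h \<in> version C i (\<lambda>j. fst v j) (\<lambda>j. f (fst v j)). h (snd v) = y})
      \<in> borel_measurable (S \<Otimes>\<^sub>M M)" for y
    by (rule borel_measurable_shatter_prob_restrict) measurable
  have [measurable]: "(\<lambda>w. shatter_prob M k0 (version C i (\<lambda>j. w j) (\<lambda>j. f (w j)))) \<in> borel_measurable S"
    by (rule borel_measurable_shatter_prob) measurable
  have [measurable]: "(\<lambda>w. emeasure M (region k0 (truth_space i w))) \<in> borel_measurable S"
  proof (rule M.measurable_emeasure)
    have "Measurable.pred (S \<Otimes>\<^sub>M M) (\<lambda>v. snd v \<in> region k0 (truth_space i (fst v)))"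
      unfolding region_def by simp
    then show "{v \<in> space (S \<Otimes>\<^sub>M M). snd v \<in> region k0 (truth_space i (fst v))} \<in> sets (S \<Otimes>\<^sub>M M)"
      by (simp add: pred_def)
  qed (auto simp: region_def)
  have [measurable]: "(\<lambda>w. M.prob (region k0 (truth_space i w))) \<in> borel_measurable S"
    unfolding measure_def by measurable
  have [measurable]: "Measurable.pred (M \<Otimes>\<^sub>M S) (\<lambda>v. fst v \<in> region k0 (truth_space i (snd v)))"
    unfolding region_def by simp
  show ?thesis unfolding late_request_def by (simp only: split_beta') measurable
qed

text \<open>Markov's inequality for 2 to the number of late requests. Given the past, each index
  contributes a factor of mean at most \<open>1 + request_bound t i\<close>; the product is at most
  the exponential of a harmonic sum, bounded by \<open>t\<close>.\<close>

lemma prob_many_requests: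
  assumes t: "1 \<le> t"
  shows "{w \<in> space S. \<not> few_requests t w} \<in> sets S"
    and "P.prob {w \<in> space S. \<not> few_requests t w} \<le> exp (16 * \<theta> / c * t ^ 3) / 2 ^ (t ^ 5 - t ^ 4)"
proof -
  let ?A = "{w \<in> space S. \<not> few_requests t w}"
  let ?b = "t ^ 5 - t ^ 4"
  have card_eq: "card {i. i < 2 ^ t \<and> late_request t i (w i) w} = (\<Sum>i<2 ^ t. of_bool (late_request t i (w i) w))" for w
    by (simp add: of_bool_def sum.If_cases Int_def)
  have [measurable]: "Measurable.pred S (\<lambda>w. late_request t i (w i) w)" for i
    using measurable_compose[OF measurable_Pair[OF measurable_coordinate measurable_ident_sets[OF refl]] pred_late_request] by simp
  show A[measurable]: "?A \<in> sets S" unfolding few_requests_def card_eq by measurable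
  have "ennreal (2 ^ ?b) * emeasure S ?A = (\<integral>\<^sup>+w. ennreal (2 ^ ?b) * indicator ?A w \<partial>S)"
    by (rule nn_integral_cmult_indicator[symmetric]) (rule A)
  also have "\<dots> \<le> (\<integral>\<^sup>+w. (\<Prod>i<2 ^ t. 1 + of_bool (late_request t i (w i) w)) \<partial>S)"
  proof (intro nn_integral_mono)
    fix w
    have "(2::ennreal) ^ ?b \<le> (\<Prod>i<2 ^ t. 1 + of_bool (late_request t i (w i) w))" if "w \<in> ?A"
    proof -
      have "(\<Prod>i<2 ^ t. 1 + of_bool (late_request t i (w i) w)) = (\<Prod>i<2 ^ t. if late_request t i (w i) w then 2 else 1 :: ennreal)"
        by (intro prod.cong) (auto simp: one_add_one)
      also have "\<dots> = 2 ^ card {i. i < 2 ^ t \<and> late_request t i (w i) w}"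
        by (simp add: prod.If_cases Int_def)
      also have "\<dots> \<ge> 2 ^ ?b"
        using that by (intro power_increasing) (auto simp: few_requests_def)
      finally show ?thesis .
    qed
    then show "ennreal (2 ^ ?b) * indicator ?A w \<le> (\<Prod>i<2 ^ t. 1 + of_bool (late_request t i (w i) w))"
      by (auto simp: indicator_def ennreal_power[symmetric])
  qed
  also have "\<dots> \<le> (\<Prod>i<2 ^ t. ennreal (1 + request_bound t i))"
  proof (rule nn_integral_prod_le[where G = "\<lambda>i x w. 1 + of_bool (late_request t i x w)"])
    show "(\<lambda>(x, w). 1 + of_bool (late_request t i x w) :: ennreal) \<in> borel_measurable (M \<Otimes>\<^sub>M S)" for i
      using pred_late_request[of t i] by (simp only: split_beta') measurable
    show "1 + of_bool (late_request t i x w) = (1 + of_bool (late_request t i x w') :: ennreal)"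
      if *: "\<And>j. j < i \<Longrightarrow> w j = w' j" for i x and w w' :: "nat \<Rightarrow> 'a"
    proof -
      have "truth_space i w = truth_space i w'" using * by (intro version_cong) auto
      then show ?thesis by (simp add: late_request_def)
    qed
    fix i w assume w: "w \<in> space S"
    have R[measurable]: "region k0 (truth_space i w) \<in> sets M"
      by (rule sets_region) (rule space_S[OF w])
    show "(\<integral>\<^sup>+x. 1 + of_bool (late_request t i x w) \<partial>M) \<le> ennreal (1 + request_bound t i)"
    \<comment> \<open>If the cap holds, the factor has mean one plus the probability of the region;
      otherwise no late request is possible and the factor is 1.\<close>
    proof (cases "t ^ 4 \<le> i \<and> M.prob (region k0 (truth_space i w)) \<le> request_bound t i")
      case True
      then have "(\<integral>\<^sup>+x. 1 + of_bool (late_request t i x w) \<partial>M) = (\<integral>\<^sup>+x. 1 + indicator (region k0 (truth_space i w)) x \<partial>M)"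
        by (intro nn_integral_cong) (auto simp: late_request_def indicator_def)
      also have "\<dots> = 1 + ennreal (M.prob (region k0 (truth_space i w)))"
        by (subst nn_integral_add) (auto simp: M.prob_space M.emeasure_eq_measure)
      also have "\<dots> \<le> ennreal (1 + request_bound t i)"
        using True request_bound_nonneg[of t i] by (subst ennreal_plus) (auto intro!: add_left_mono ennreal_leI)
      finally show ?thesis .
    next
      case False
      then have "(\<integral>\<^sup>+x. 1 + of_bool (late_request t i x w) \<partial>M) = (\<integral>\<^sup>+x. 1 \<partial>M)"
        by (intro nn_integral_cong) (auto simp: late_request_def)
      also have "\<dots> = ennreal 1" by (simp add: M.emeasure_space_1)
      also have "\<dots> \<le> ennreal (1 + request_bound t i)"
        using request_bound_nonneg[of t i] by (intro ennreal_leI) simp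
      finally show ?thesis .
    qed
  qed
  also have "\<dots> = ennreal (\<Prod>i<2 ^ t. 1 + request_bound t i)"
    using request_bound_nonneg by (intro prod_ennreal) (simp add: add_nonneg_nonneg)
  also have "(\<Prod>i<2 ^ t. 1 + request_bound t i) \<le> (\<Prod>i<2 ^ t. exp (request_bound t i))"
    using request_bound_nonneg by (intro prod_mono) (auto simp: exp_ge_add_one_self add_nonneg_nonneg)
  also have "\<dots> = exp (\<Sum>i<2 ^ t. request_bound t i)" by (simp add: exp_sum)
  also have "(\<Sum>i<2 ^ t. request_bound t i) = 16 * \<theta> / c * t\<^sup>2 * (\<Sum>i<2 ^ t. 1 / real i)"
    by (simp add: request_bound_def sum_distrib_left)
  also have "\<dots> \<le> 16 * \<theta> / c * t\<^sup>2 * t"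
    using \<theta>_nonneg c_pos by (intro mult_left_mono sum_inverse_le) auto
  also have "\<dots> = 16 * \<theta> / c * t ^ 3" by (simp add: power2_eq_square power3_eq_cube)
  finally have "ennreal (2 ^ ?b * P.prob ?A) \<le> ennreal (exp (16 * \<theta> / c * t ^ 3))"
    by (simp add: P.emeasure_eq_measure ennreal_mult ennreal_leI)
  then have "2 ^ ?b * P.prob ?A \<le> exp (16 * \<theta> / c * t ^ 3)"
    by (subst (asm) ennreal_le_iff) auto
  then show "P.prob ?A \<le> exp (16 * \<theta> / c * t ^ 3) / 2 ^ ?b"
    by (simp add: field_simps)
qed

end

section \<open>The exponential rate\<close>

lemma prob_space_seed: "prob_space seed"
  unfolding seed_def by (rule prob_space_uniform_measure) auto

context bounded_learning
begin

lemma expected_er_le: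
  assumes t: "large (budget_root n)" "budget_root n ^ 5 \<le> n" "t = budget_root n"
  shows "expected_er (learner C) n f M \<le>
    ennreal ((\<Sum>i\<in>{1..2 ^ t::nat}. 2 * (2 * real i + 1) ^ d / 2 ^ t\<^sup>2) +
      exp (16 * \<theta> / c * t ^ 3) / 2 ^ (t ^ 5 - t ^ 4) + request_bound t (2 ^ t))"
    (is "_ \<le> ennreal (?b1 + ?b2 + ?b3)")
proof -
  have t1: "1 \<le> t" using t by (simp add: large_def)
  obtain B where B: "B \<in> sets S" "P.prob B \<le> ?b1" "\<And>w. w \<in> space S - B \<Longrightarrow> shrinking t w"
    by (rule prob_not_shrinking[OF t1], rule that)
  define F where "F = {w \<in> space S. \<not> few_requests t w}"
  have F: "F \<in> sets S" "P.prob F \<le> ?b2"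
    using prob_many_requests[OF t1] by (simp_all add: F_def)
  have "AE w in S. core_sequence w \<and> exact_frequencies (2 ^ t) w"
    using AE_core_sequence AE_exact_frequencies by eventually_elim simp
  then obtain N where N: "{w \<in> space S. \<not> (core_sequence w \<and> exact_frequencies (2 ^ t) w)} \<subseteq> N"
      "emeasure S N = 0" "N \<in> sets S"
    by (rule AE_E)
  \<comment> \<open>A measurable majorant that is uniform in the seed: at least 1 on the exceptional
    sets, the region bound elsewhere.\<close>
  define g where "g w = indicator (B \<union> F \<union> N) w + ennreal ?b3" for w
  have g[measurable]: "g \<in> borel_measurable S"
    unfolding g_def using B(1) F(1) N(3) by measurable
  have le_g: "ennreal (er M f (returned (learner C) n f u w)) \<le> g w" if w: "w \<in> space S" for u w
  proof (cases "w \<in> B \<union> F \<union> N")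
    case True
    have "ennreal (er M f (returned (learner C) n f u w)) \<le> ennreal 1"
      by (intro ennreal_leI) (simp add: er_def)
    also have "\<dots> \<le> g w" using True by (simp add: g_def)
    finally show ?thesis .
  next
    case False
    then have "w \<in> space S" "core_sequence w" "shrinking t w" "exact_frequencies (2 ^ t) w" "few_requests t w"
      using w B(3) N(1) by (auto simp: F_def)
    then have "er M f (returned (learner C) n f u w) \<le> ?b3"
      using er_returned_le[of n w u] t by simp
    then show ?thesis using False by (auto simp: g_def intro!: ennreal_leI)
  qed
  interpret seed: prob_space seed by (rule prob_space_seed)
  have "expected_er (learner C) n f M = (\<integral>\<^sup>+v. ennreal (er M f (returned (learner C) n f (fst v) (snd v))) \<partial>(seed \<Otimes>\<^sub>M S))"
    by (simp add: expected_er_def split_beta')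
  also have "\<dots> \<le> (\<integral>\<^sup>+v. g (snd v) \<partial>(seed \<Otimes>\<^sub>M S))"
    by (intro nn_integral_mono le_g) (auto simp: space_pair_measure)
  also have "\<dots> = (\<integral>\<^sup>+u. \<integral>\<^sup>+w. g w \<partial>S \<partial>seed)"
    by (subst P.nn_integral_fst[symmetric]) auto
  also have "\<dots> = (\<integral>\<^sup>+w. g w \<partial>S)"
    by (simp add: seed.emeasure_space_1)
  also have "\<dots> = emeasure S (B \<union> F \<union> N) + ennreal ?b3"
    unfolding g_def using B(1) F(1) N(3) by (subst nn_integral_add) (auto simp: P.emeasure_space_1)
  also have "emeasure S (B \<union> F \<union> N) \<le> emeasure S B + emeasure S F + emeasure S N"
    using B(1) F(1) N(3) by (intro order_trans[OF emeasure_subadditive] add_right_mono emeasure_subadditive) auto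
  also have "\<dots> = ennreal (P.prob B + P.prob F)"
    using N(2) by (simp add: P.emeasure_eq_measure)
  also have "\<dots> \<le> ennreal (?b1 + ?b2)"
    by (intro ennreal_leI add_mono B(2) F(2))
  also have "ennreal (?b1 + ?b2) + ennreal ?b3 = ennreal (?b1 + ?b2 + ?b3)"
    by (intro ennreal_plus[symmetric] add_nonneg_nonneg sum_nonneg request_bound_nonneg) auto
  finally show ?thesis by (simp add: add_mono)
qed

text \<open>The exponent \<open>t + 1 + (t + 2) * d\<close> of the numerator is linear in
  \<open>t\<close>, so \<open>2 ^ t^2\<close> beats it with a factor \<open>2 ^ t\<close> to
  spare.\<close>

lemma net_failure_le:
  assumes "3 * (d + 1) + 1 \<le> t"
  shows "(\<Sum>i\<in>{1..2 ^ t::nat}. 2 * (2 * real i + 1) ^ d / 2 ^ t\<^sup>2) \<le> 1 / 2 ^ t"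
proof -
  have "(\<Sum>i\<in>{1..2 ^ t::nat}. 2 * (2 * real i + 1) ^ d / 2 ^ t\<^sup>2) \<le>
      (\<Sum>i\<in>{1..2 ^ t::nat}. 2 * (2 ^ (t + 2)) ^ d / 2 ^ t\<^sup>2)"
  proof (intro sum_mono divide_right_mono mult_left_mono power_mono)
    fix i :: nat assume "i \<in> {1..2 ^ t}"
    then have "real i \<le> 2 ^ t" by simp
    moreover have "(1::real) \<le> 2 ^ t" "(2::real) ^ (t + 2) = 4 * 2 ^ t" by simp_all
    ultimately show "2 * real i + 1 \<le> 2 ^ (t + 2)" by linarith
  qed auto
  also have "\<dots> = 2 ^ t * (2 * (2 ^ (t + 2)) ^ d) / 2 ^ t\<^sup>2" by simp
  also have "\<dots> = 2 ^ (t + 1 + (t + 2) * d) / 2 ^ t\<^sup>2"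
    by (simp only: power_add[of 2 "t + 1"] power_add[of 2 t 1] power_mult power_one_right mult.assoc)
  also have "\<dots> \<le> 2 ^ (t\<^sup>2 - t) / 2 ^ t\<^sup>2"
  proof (intro divide_right_mono power_increasing)
    have "t + 1 + (t + 2) * d + t \<le> 3 * t * (d + 1) + t"
      using assms by (simp add: algebra_simps)
    also have "\<dots> = t * (3 * (d + 1) + 1)" by (simp add: algebra_simps)
    also have "\<dots> \<le> t * t" using assms by (intro mult_left_mono) auto
    finally show "t + 1 + (t + 2) * d \<le> t\<^sup>2 - t" by (simp add: power2_eq_square)
  qed auto
  also have "\<dots> = 1 / 2 ^ t"
    using assms by (simp add: power_diff power2_eq_square)
  finally show ?thesis .
qed

text \<open>Bounding e by 4 makes the numerator at most \<open>2 ^ t ^ 4\<close>, and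
  \<open>t \<ge> 3\<close> gives \<open>t ^ 5 \<ge> 2 * t ^ 4 + t\<close>.\<close>

lemma budget_failure_le:
  assumes "16 * \<theta> / c \<le> real K" "2 * K \<le> t" "3 \<le> t"
  shows "exp (16 * \<theta> / c * t ^ 3) / 2 ^ (t ^ 5 - t ^ 4) \<le> 1 / 2 ^ t"
proof -
  have "exp (16 * \<theta> / c * t ^ 3) \<le> exp (real K * t ^ 3)"
    unfolding exp_le_cancel_iff using assms(1) by (intro mult_right_mono) auto
  also have "\<dots> = exp 1 ^ (K * t ^ 3)" by (simp add: exp_of_nat_mult[symmetric])
  also have "\<dots> \<le> 4 ^ (K * t ^ 3)" using exp_le by (intro power_mono) auto
  also have "\<dots> = 2 ^ (2 * K * t ^ 3)" by (simp add: power_mult)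
  also have "\<dots> \<le> 2 ^ t ^ 4"
  proof (rule power_increasing)
    have "2 * K * t ^ 3 \<le> t * t ^ 3" using assms(2) by (intro mult_right_mono) auto
    then show "2 * K * t ^ 3 \<le> t ^ 4" by (simp add: power_Suc[symmetric] del: power_Suc)
  qed simp
  finally have "exp (16 * \<theta> / c * t ^ 3) / 2 ^ (t ^ 5 - t ^ 4) \<le> 2 ^ t ^ 4 / 2 ^ (t ^ 5 - t ^ 4)"
    by (intro divide_right_mono) auto
  also have "\<dots> \<le> 2 ^ t ^ 4 / 2 ^ (t ^ 4 + t)"
  proof (intro divide_left_mono power_increasing)
    have "t ^ 1 \<le> t ^ 4" using assms(3) by (intro power_increasing) auto
    moreover have "3 * t ^ 4 \<le> t * t ^ 4" using assms(3) by (intro mult_right_mono) auto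
    ultimately show "t ^ 4 + t \<le> t ^ 5 - t ^ 4" by (simp add: power_Suc[symmetric] del: power_Suc)
  qed auto
  also have "\<dots> = 1 / 2 ^ t" by (simp add: power_add)
  finally show ?thesis .
qed

lemma eventually_large: "eventually large sequentially"
proof -
  have "(\<lambda>t. 4 / (real t)\<^sup>2) \<longlonglongrightarrow> 0" by real_asymp
  then have "\<forall>\<^sub>F t in sequentially. 4 / (real t)\<^sup>2 < r0" using r0(1) by (rule order_tendstoD)
  moreover have "(\<lambda>t. 1 / real t) \<longlonglongrightarrow> 0" by real_asymp
  then have "\<forall>\<^sub>F t in sequentially. 1 / real t < \<delta>" using \<delta>(1) by (rule order_tendstoD)
  moreover have "\<forall>\<^sub>F t in sequentially. 4 * \<theta> \<le> real t"
    using filterlim_real_sequentially by (simp add: filterlim_at_top)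
  moreover have "\<forall>\<^sub>F t in sequentially. real t ^ 4 \<le> 2 ^ t" by real_asymp
  ultimately show ?thesis
    using eventually_ge_at_top[of 1]
  proof eventually_elim
    case (elim t)
    have "real (t ^ 4) \<le> real (2 ^ t)" using elim by simp
    then have "t ^ 4 \<le> 2 ^ t" by (simp only: of_nat_le_iff)
    with elim show ?case by (simp add: large_def)
  qed
qed

lemma budget_root_power_le: "budget_root n ^ 5 \<le> n"
  unfolding budget_root_def
proof (rule GreatestI_nat[of _ 0 n])
  show "t \<le> n" if "t ^ 5 \<le> n" for t
    using that power_increasing[of 1 5 t] by (cases "t = 0") auto
qed simp

theorem eventually_expected_er_le:
  "\<exists>T. \<forall>n. T \<le> budget_root n \<longrightarrow> expected_er (learner C) n f M \<le> ennreal (exp (- real (budget_root n) / 2))"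
proof -
  obtain K :: nat where K: "16 * \<theta> / c \<le> K" using real_arch_simple by blast
  \<comment> \<open>\<open>1 / 2 ^ t\<close> is at most \<open>exp (- 3 * t / 5)\<close>. The part
    \<open>exp (- t / 10)\<close> absorbs \<open>t^2\<close> and the coefficient
    \<open>2 + K\<close>, made of 1 for each failure term and \<open>K\<close> for the region;
    \<open>exp (- t / 2)\<close> remains.\<close>
  have "(\<lambda>t. (real t)\<^sup>2 * exp (- real t / 10)) \<longlonglongrightarrow> 0" by real_asymp
  then have "\<forall>\<^sub>F t in sequentially. (real t)\<^sup>2 * exp (- real t / 10) < 1 / (2 + K)"
    by (rule order_tendstoD) simp
  then have "\<forall>\<^sub>F t in sequentially. large t \<and> 3 * (d + 1) + 1 \<le> t \<and> 2 * K \<le> t \<and> 3 \<le> t \<and>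
      (real t)\<^sup>2 * exp (- real t / 10) < 1 / (2 + K)"
    using eventually_large by (intro eventually_conj eventually_ge_at_top)
  then obtain T where T: "\<And>t. T \<le> t \<Longrightarrow> large t \<and> 3 * (d + 1) + 1 \<le> t \<and> 2 * K \<le> t \<and> 3 \<le> t \<and>
      (real t)\<^sup>2 * exp (- real t / 10) < 1 / (2 + K)"
    unfolding eventually_sequentially by blast
  have "expected_er (learner C) n f M \<le> ennreal (exp (- real (budget_root n) / 2))" if n: "T \<le> budget_root n" for n
  proof -
    define t where "t = budget_root n"
    have t: "large t" "3 * (d + 1) + 1 \<le> t" "2 * K \<le> t" "3 \<le> t" "(real t)\<^sup>2 * exp (- real t / 10) < 1 / (2 + K)"
      using T[OF n] by (simp_all add: t_def)
    have "request_bound t (2 ^ t) \<le> K * (real t)\<^sup>2 / 2 ^ t"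
      unfolding request_bound_def of_nat_power of_nat_numeral
      by (intro divide_right_mono mult_right_mono K) auto
    moreover have one: "1 / 2 ^ t \<le> (real t)\<^sup>2 / 2 ^ t"
      using t(4) by (intro divide_right_mono) auto
    ultimately have "(\<Sum>i\<in>{1..2 ^ t::nat}. 2 * (2 * real i + 1) ^ d / 2 ^ t\<^sup>2) +
      exp (16 * \<theta> / c * t ^ 3) / 2 ^ (t ^ 5 - t ^ 4) + request_bound t (2 ^ t) \<le>
      (real t)\<^sup>2 / 2 ^ t + (real t)\<^sup>2 / 2 ^ t + K * (real t)\<^sup>2 / 2 ^ t"
      by (intro add_mono order_trans[OF net_failure_le[OF t(2)] one]
          order_trans[OF budget_failure_le[OF K t(3,4)] one])
    also have "\<dots> = (2 + K) * ((real t)\<^sup>2 / 2 ^ t)"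
      by (simp add: algebra_simps add_divide_distrib)
    also have "(real t)\<^sup>2 / 2 ^ t \<le> (real t)\<^sup>2 * (exp (- real t / 10) * exp (- real t / 2))"
    proof -
      \<comment> \<open>\<open>exp (3 / 5) \<le> 2\<close> because its fifth power is at most 27,
        below 32.\<close>
      have "exp (3 / 5 :: real) ^ 5 = exp 1 ^ 3" by (simp add: exp_of_nat_mult[symmetric])
      also have "\<dots> \<le> 3 ^ 3" using exp_le by (intro power_mono) auto
      also have "\<dots> \<le> 2 ^ 5" by simp
      finally have "exp (3 / 5 :: real) \<le> 2" by (rule power_le_imp_le_base[where n = 4, simplified]) simp
      then have "exp (3 / 5 :: real) ^ t \<le> 2 ^ t" by (intro power_mono) auto
      then have "1 / 2 ^ t \<le> 1 / exp (3 / 5 :: real) ^ t" by (intro divide_left_mono) auto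
      also have "\<dots> = exp (- real t / 10) * exp (- real t / 2)"
        by (simp add: exp_of_nat_mult[symmetric] exp_add[symmetric] exp_minus[symmetric] inverse_eq_divide[symmetric])
      finally have "(real t)\<^sup>2 * (1 / 2 ^ t) \<le> (real t)\<^sup>2 * (exp (- real t / 10) * exp (- real t / 2))"
        by (intro mult_left_mono) auto
      then show ?thesis by simp
    qed
    also have "(2 + K) * ((real t)\<^sup>2 * (exp (- real t / 10) * exp (- real t / 2))) =
        ((real t)\<^sup>2 * exp (- real t / 10) * (2 + K)) * exp (- real t / 2)" by simp
    also have "\<dots> \<le> 1 * exp (- real t / 2)"
      using t(5) by (intro mult_right_mono) (simp_all add: less_divide_eq)
    also have "1 * exp (- real t / 2) = exp (- real t / 2)" by simp
    finally show ?thesis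
      using expected_er_le[of n t] t(1) budget_root_power_le[of n]
      by (auto simp: t_def intro: order_trans ennreal_leI)
  qed
  then show ?thesis by blast
qed

end

text \<open>The core of order \<open>Suc d\<close> is empty, so the minimum \<open>k1\<close>
  exists; the core of order 0 is everything, so \<open>k1\<close> has a predecessor
  \<open>k0\<close>. Minimality makes the lower cores positive, and continuity from above yields the
  radius.\<close>

lemma (in margin_learning) bounded_learning_exists:
  assumes theta: "theta_tilde C M f < \<infinity>"
  shows "\<exists>k0 \<theta> c \<delta> r0. bounded_learning M C d f k0 \<theta> c \<delta> r0"
proof -
  let ?null = "\<lambda>k. emeasure (tuples k) (core k) = 0"
  define k1 where "k1 = d_tilde C M f"
  have "core (Suc d) = {}"
  proof (rule ccontr)
    assume "core (Suc d) \<noteq> {}"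
    then obtain s where s: "s \<in> core (Suc d)" by blast
    then have "s \<in> shattered_tuples C M f (Suc d) 1" by (auto simp: disagreement_core_def)
    then have "s \<in> space (tuples (Suc d))" "shatters C (Suc d) s"
      by (auto simp: shattered_tuples_def cball_class_def elim: shatters_mono)
    then show False using vc by fastforce
  qed
  then have "?null (Suc d)" by simp
  then have null: "?null k1" unfolding k1_def d_tilde_def by (rule LeastI)
  have pos: "0 < measure (tuples k) (core k)" if "k < k1" for k
  proof -
    interpret K: prob_space "tuples k" by (rule prob_space_tuples)
    have "\<not> ?null k" using that unfolding k1_def d_tilde_def by (rule not_less_Least)
    then show ?thesis by (simp add: K.emeasure_eq_measure zero_less_measure_iff)
  qed
  have "core 0 = space (tuples 0)"
  proof -
    have "f \<in> cball_class C M f r" if "0 < r" for r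
      using that target by (simp add: cball_class_def er_def)
    then have "space (tuples 0) \<subseteq> core 0"
      by (auto simp: disagreement_core_def shattered_tuples_def shatters_def)
    then show ?thesis using sets.sets_into_space[OF sets_core[of 0]] by blast
  qed
  then have "\<not> ?null 0" using prob_space.emeasure_space_1[OF prob_space_tuples[of 0]] by simp
  with null have "k1 \<noteq> 0" by metis
  then obtain k0 where k0: "k1 = Suc k0" by (cases k1) auto
  define \<theta> where "\<theta> = enn2real (theta_tilde C M f)"
  have \<theta>: "theta_tilde C M f = ennreal \<theta>"
    using theta by (simp add: \<theta>_def)
  have th: "measure (tuples (Suc k0)) (shattered_tuples C M f (Suc k0) r) \<le> \<theta> * r" if r: "0 < r" for r
  proof -
    interpret K: prob_space "tuples (Suc k0)" by (rule prob_space_tuples)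
    let ?m = "emeasure (tuples (Suc k0)) (shattered_tuples C M f (Suc k0) r)"
    have "?m / ennreal r \<le> theta_tilde C M f"
      unfolding theta_tilde_def Let_def k1_def[symmetric] k0 using r
      by (intro max.coboundedI2 SUP_upper2[of r]) auto
    then have "?m / ennreal r * ennreal r \<le> ennreal \<theta> * ennreal r"
      unfolding \<theta> by (rule mult_right_mono) simp
    also have "?m / ennreal r * ennreal r = ?m"
      using r by (simp add: ennreal_divide_times ennreal_times_divide ennreal_mult_divide_eq)
    also have "ennreal \<theta> * ennreal r = ennreal (\<theta> * r)"
      using r by (intro ennreal_mult[symmetric]) (auto simp: \<theta>_def)
    finally show ?thesis
      using r by (simp add: K.emeasure_eq_measure \<theta>_def)
  qed
  define \<delta> where "\<delta> = Min ((\<lambda>k. measure (tuples k) (core k)) ` {..<Suc k0})"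
  have \<delta>: "0 < \<delta>" "\<And>k. k < Suc k0 \<Longrightarrow> \<delta> \<le> measure (tuples k) (core k)"
  proof -
    show "0 < \<delta>" using pos unfolding \<delta>_def k0 by (subst Min_gr_iff) auto
    show "\<delta> \<le> measure (tuples k) (core k)" if "k < Suc k0" for k
      unfolding \<delta>_def using that by (intro Min_le) auto
  qed
  define c where "c = measure (tuples k0) (core k0)"
  have "0 < c" using pos k0 by (simp add: c_def)
  then have "\<forall>\<^sub>F n in sequentially. measure (tuples k0) (shattered_tuples C M f k0 (1 / Suc n)) < 3 / 2 * c"
    by (intro order_tendstoD[OF tendsto_shattered_tuples]) (simp add: c_def)
  then obtain n where n: "measure (tuples k0) (shattered_tuples C M f k0 (1 / Suc n)) < 3 / 2 * c"
    by (meson eventually_sequentially order_refl)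
  have "bounded_learning M C d f k0 \<theta> c \<delta> (1 / Suc n)"
    by unfold_locales (use th \<delta> n c_def in auto)
  then show ?thesis by blast
qed

section \<open>Label complexity of the learner\<close>

definition learner_complexity :: "('a \<Rightarrow> int) set \<Rightarrow> real \<Rightarrow> ('a \<Rightarrow> int) \<Rightarrow> 'a measure \<Rightarrow> enat" where
  "learner_complexity C \<epsilon> f P =
     Inf {enat N |N. 1 \<le> N \<and> (\<forall>n\<ge>N. expected_er (learner C) n f P \<le> ennreal \<epsilon>)}"

text \<open>True by construction for every target and distribution: an infimum over the empty set is
  infinite and demands nothing, any other is attained.\<close>

lemma achieves_learner_complexity:
  "achieves_label_complexity M C (learner C) (learner_complexity C)"
  unfolding achieves_label_complexity_def
proof (intro ballI conjI allI impI)
  fix f P \<epsilon>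
  define A where "A = {enat N |N. 1 \<le> N \<and> (\<forall>n\<ge>N. expected_er (learner C) n f P \<le> ennreal \<epsilon>)}"
  have eq: "learner_complexity C \<epsilon> f P = Inf A" by (simp add: learner_complexity_def A_def)
  show "1 \<le> learner_complexity C \<epsilon> f P"
    unfolding eq by (rule Inf_greatest) (auto simp: A_def one_enat_def)
  fix n assume n: "learner_complexity C \<epsilon> f P \<le> enat n"
  have "A \<noteq> {}"
  proof
    assume "A = {}"
    then have "Inf A = \<infinity>" by (simp add: top_enat_def)
    with n show False by (simp add: eq)
  qed
  then obtain a where "a \<in> A" by blast
  then have "Inf A \<in> A" by (rule wellorder_InfI)
  then obtain N where N: "Inf A = enat N" "\<forall>n\<ge>N. expected_er (learner C) n f P \<le> ennreal \<epsilon>"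
    unfolding A_def by blast
  with n show "expected_er (learner C) n f P \<le> ennreal \<epsilon>" by (simp add: eq)
qed

lemma le_budget_root:
  assumes "t ^ 5 \<le> n"
  shows "t \<le> budget_root n"
  unfolding budget_root_def
proof (rule Greatest_le_nat[where P = "\<lambda>t. t ^ 5 \<le> n" and b = n])
  show "s \<le> n" if "s ^ 5 \<le> n" for s
    using that power_increasing[of 1 5 s] by (cases "s = 0") auto
qed (rule assms)

lemma enat_Polylog_learner_complexity:
  assumes T: "\<And>n. T \<le> budget_root n \<Longrightarrow> expected_er (learner C) n f P \<le> ennreal (exp (- real (budget_root n) / 2))"
  shows "enat_Polylog (\<lambda>\<epsilon>. learner_complexity C \<epsilon> f P)"
proof -
  \<comment> \<open>A root of at least \<open>m \<epsilon>\<close> exceeds both \<open>T\<close> and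
    \<open>2 * ln (1 / \<epsilon>)\<close>, so the error is at most \<open>\<epsilon>\<close>; a
    budget of \<open>m \<epsilon> ^ 5\<close> guarantees such a root.\<close>
  define m where "m \<epsilon> = T + nat \<lceil>2 * ln (1 / \<epsilon>)\<rceil> + 1" for \<epsilon> :: real
  have le: "learner_complexity C \<epsilon> f P \<le> enat (m \<epsilon> ^ 5)" if \<epsilon>: "\<epsilon> \<in> {0<..<1}" for \<epsilon>
    unfolding learner_complexity_def
  proof (rule Inf_lower, clarsimp, intro conjI allI impI)
    show "Suc 0 \<le> m \<epsilon> ^ 5" by (simp add: m_def)
    fix n assume "m \<epsilon> ^ 5 \<le> n"
    then have m: "m \<epsilon> \<le> budget_root n" by (rule le_budget_root)
    then have "expected_er (learner C) n f P \<le> ennreal (exp (- real (budget_root n) / 2))"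
      by (intro T) (simp add: m_def)
    also have "\<dots> \<le> ennreal \<epsilon>"
    proof (rule ennreal_leI)
      have "2 * ln (1 / \<epsilon>) \<le> real (m \<epsilon>)" unfolding m_def by linarith
      also have "\<dots> \<le> real (budget_root n)" using m by simp
      finally have "- real (budget_root n) / 2 \<le> ln \<epsilon>" using \<epsilon> by (simp add: ln_div)
      then have "exp (- real (budget_root n) / 2) \<le> exp (ln \<epsilon>)" by (simp only: exp_le_cancel_iff)
      also have "exp (ln \<epsilon>) = \<epsilon>" using \<epsilon> by simp
      finally show "exp (- real (budget_root n) / 2) \<le> \<epsilon>" .
    qed
    finally show "expected_er (learner C) n f P \<le> ennreal \<epsilon>" .
  qed
  have fin: "learner_complexity C \<epsilon> f P \<noteq> \<infinity>" if "\<epsilon> \<in> {0<..<1}" for \<epsilon>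
  proof
    assume "learner_complexity C \<epsilon> f P = \<infinity>"
    with le[OF that] show False by simp
  qed
  have "(\<lambda>\<epsilon>. real (the_enat (learner_complexity C \<epsilon> f P))) \<in> O[at_right 0](\<lambda>\<epsilon>. ln (1 / \<epsilon>) powr 5)"
  proof (rule bigoI[where c = "(real T + 4) ^ 5"])
    show "\<forall>\<^sub>F \<epsilon> in at_right 0. norm (real (the_enat (learner_complexity C \<epsilon> f P))) \<le>
        (real T + 4) ^ 5 * norm (ln (1 / \<epsilon>) powr 5)"
    \<comment> \<open>Below \<open>exp (-1)\<close> the logarithm is at least 1, so it absorbs
      \<open>T\<close> and the rounding, giving the factor \<open>T + 4\<close>.\<close>
    proof (rule eventually_at_rightI[of 0 "exp (-1)"])
      fix \<epsilon> :: real assume "\<epsilon> \<in> {0<..<exp (-1)}"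
      then have \<epsilon>: "0 < \<epsilon>" "\<epsilon> < exp (-1)" by auto
      have e1: "\<epsilon> < 1" using less_trans[OF \<epsilon>(2), of 1] by simp
      have "ln \<epsilon> \<le> ln (exp (-1))" using \<epsilon> by (subst ln_le_cancel_iff) auto
      then have l: "1 \<le> ln (1 / \<epsilon>)" using \<epsilon> by (simp add: ln_div)
      obtain N where N: "learner_complexity C \<epsilon> f P = enat N" using fin[of \<epsilon>] \<epsilon> e1 by auto
      then have "real N \<le> real (m \<epsilon> ^ 5)" using le[of \<epsilon>] \<epsilon> e1 by simp
      also have "\<dots> = real (m \<epsilon>) ^ 5" by simp
      also have "\<dots> \<le> ((real T + 4) * ln (1 / \<epsilon>)) ^ 5"
      proof (rule power_mono)
        have "real (m \<epsilon>) \<le> real T + 2 * ln (1 / \<epsilon>) + 2" using l unfolding m_def by linarith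
        also have "\<dots> \<le> real T * ln (1 / \<epsilon>) + 2 * ln (1 / \<epsilon>) + 2 * ln (1 / \<epsilon>)"
          using l mult_left_mono[OF l, of "real T"] by simp
        finally show "real (m \<epsilon>) \<le> (real T + 4) * ln (1 / \<epsilon>)" by (simp add: algebra_simps)
      qed simp
      also have "\<dots> = (real T + 4) ^ 5 * ln (1 / \<epsilon>) powr 5"
        using l by (simp add: power_mult_distrib powr_numeral)
      finally show "norm (real (the_enat (learner_complexity C \<epsilon> f P))) \<le>
          (real T + 4) ^ 5 * norm (ln (1 / \<epsilon>) powr 5)" using N by simp
    qed simp
  qed
  then show ?thesis
    unfolding enat_Polylog_def Polylog_def using fin by (auto intro!: exI[of _ 5])
qed

theorem corollary18:
  fixes M :: "'a measure" and C :: "('a \<Rightarrow> int) set"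
  assumes "standard_borel M"
    and "vc_class M C"
    and "sample_sets_measurable M C"
  shows "(\<forall>P\<in>distributions M.
            shatter_sets_measurable C P \<longrightarrow>
            (\<forall>f\<in>C. theta_tilde C P f < \<infinity>) \<longrightarrow>
            exponential_rate_under M C P) \<and>
         ((\<forall>P\<in>distributions M.
            shatter_sets_measurable C P \<and> (\<forall>f\<in>C. theta_tilde C P f < \<infinity>)) \<longrightarrow>
          exponential_rate M C)"
proof -
  have CM: "concept_space M C"
    using assms by (simp add: concept_space_def vc_class_def)
  obtain d where d: "vc_dim M C = enat d"
    using assms(2) by (auto simp: vc_class_def less_infinityE)
  \<comment> \<open>The learner and its complexity function are built from \<open>C\<close> without
    reference to a distribution, so one algorithm serves both statements; only its rate is verified
    separately for each \<open>P\<close>.\<close>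
  have algorithm: "active_learning_algorithm M (learner C)"
    by (rule concept_space.active_learning_algorithm_learner[OF CM])
  have Polylog: "enat_Polylog (\<lambda>\<epsilon>. learner_complexity C \<epsilon> f P)"
    if P: "P \<in> distributions M" and meas: "shatter_sets_measurable C P"
      and f: "f \<in> C" and theta: "theta_tilde C P f < \<infinity>" for P f
  proof -
    have PM: "prob_space P" "sets P = sets M" using P by (auto simp: distributions_def)
    have sp: "space P = space M" using PM(2) by (rule sets_eq_imp_space_eq)
    have sets_tuples: "sets (Pi\<^sub>M {..<k} (\<lambda>_. P)) = sets (Pi\<^sub>M {..<k} (\<lambda>_. M))" for k :: nat
      using PM(2) by (intro sets_PiM_cong) auto
    have space_tuples: "space (Pi\<^sub>M {..<k} (\<lambda>_. P)) = space (Pi\<^sub>M {..<k} (\<lambda>_. M))" for k :: nat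
      by (rule sets_eq_imp_space_eq[OF sets_tuples])
    interpret prob_space P by (rule PM)
    interpret margin_learning P C d f
    proof unfold_locales
      have "classifiers P = classifiers M"
        unfolding classifiers_def by (rule measurable_cong_sets[OF PM(2) refl])
      then show "C \<subseteq> classifiers P"
        using CM by (simp add: concept_space_def)
      show "sample_sets_measurable P C"
        using assms(3) by (simp add: sample_sets_measurable_def sets_tuples space_tuples)
      show "k \<le> d" if "s \<in> space (Pi\<^sub>M {..<k} (\<lambda>_. P))" "shatters C k s" for s k
      proof -
        have "enat k \<le> vc_dim M C"
          unfolding vc_dim_def using that by (intro Sup_upper) (auto simp: space_tuples)
        then show ?thesis by (simp add: d)
      qed
    qed (use f meas in auto)
    obtain k0 \<theta> c \<delta> r0 where "bounded_learning P C d f k0 \<theta> c \<delta> r0"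
      using bounded_learning_exists[OF theta] by blast
    from bounded_learning.eventually_expected_er_le[OF this]
    obtain T where "\<And>n. T \<le> budget_root n \<Longrightarrow>
        expected_er (learner C) n f P \<le> ennreal (exp (- real (budget_root n) / 2))"
      by blast
    then show ?thesis by (rule enat_Polylog_learner_complexity)
  qed
  show ?thesis
    unfolding exponential_rate_under_def exponential_rate_def
    using algorithm achieves_learner_complexity[of M C] Polylog by blast
qed

end
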